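(* Fix $q\in[0,1)$. Let $(\Pi_n)_{n\in\mathbb{N}}$ be the Mallows permutations coupled through the infinite Bernoulli model (so that each $\Pi_n$ is $\pi_{n,q}$-distributed), and let $\mathcal{Y}_q=(o,Y_q)$ be the rooted redwood Mallows tree defined in the context. Then $\mathrm{BST}(\Pi_n)$ converges locally almost surely to $\mathcal{Y}_q$, i.e. for every integer $r\ge1$ and every finite rooted graph $H$, $$\frac{1}{n}\sum_{v\in \mathrm{BST}(\Pi_n)}\mathbb{1}\{B_r(v,\mathrm{BST}(\Pi_n))\equiv H\}\longrightarrow \mathbb{P}\big(B_r(o,Y_q)\equiv H\big)\quad\text{almost surely as } n\to\infty.$$
   Context: Mallows distribution: for $q\in[0,1)$ and $n\in\mathbb{N}$, $\pi_{n,q}(\sigma)=q^{\mathrm{Inv}(\sigma)}/Z_{n,q}$ on the symmetric group $S_n$, where $\mathrm{Inv}(\sigma)=|\{i<j:\sigma(i)>\sigma(j)\}|$, $Z_{n,q}$ is the normalizing constant, and $0^0=1$. Infinite Bernoulli model: let $(B_{i,j})_{i,j\ge1}$ be independent Bernoulli$(1-q)$ variables and recursively $I_i=\min\{j\notin\{I_1,\dots,I_{i-1}\}:B_{i,j}=1\}$. For $n\in\mathbb{N}$, $\Pi_n$ is the permutation of $\{1,\dots,n\}$ recording the relative order of $(I_1,\dots,I_n)$ (i.e. $\Pi_n(i)=|\{j\le n:I_j\le I_i\}|$); it is $\pi_{n,q}$-distributed. $(I_1,I_2,\dots)$ is a permutation of $\mathbb{N}$, called the (one-sided) Mallows permutation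 on $\mathbb{N}$ with parameter $q$. Binary trees: $\mathbb{T}$ is the set of finite words over $\{0,1\}$ including the empty word $\varnothing$; for a set $S$ of words and a word $a$, $aS=\{aw:w\in S\}$. For a finite sequence $x=(x_1,\dots,x_n)$ of distinct numbers, $\mathrm{BST}(x)=\emptyset$ if $n=0$, and otherwise $\mathrm{BST}(x)=\{\varnothing\}\cup 0\,\mathrm{BST}(x_-)\cup 1\,\mathrm{BST}(x_+)$, where $x_-$ (resp. $x_+$) is the subsequence of entries smaller (resp. larger) than $x_1$ in their original order. For infinite $x$, $\mathrm{BST}(x)=\bigcup_n\mathrm{BST}(x_1,\dots,x_n)$. For a permutation $\sigma$, $\mathrm{BST}(\sigma)=\mathrm{BST}(\sigma(1),\sigma(2),\dots)$. A subset of $\mathbb{T}$ is a graph with edges $\{w,w0\},\{w,w1\}$ between its elements. Extended tree: add a letter $\Upsilon$ and use the convention $1^k=$ the word $1\cdots1$ ($k$ letters) if $k>0$, $1^0=\varnothing$, $1^k=\Upsilon^{|k|}$ if $k<0$. Let $\mathbb{Y}=\bigcup_{k\in\mathbb{Z}}(\{1^k\}\cup 1^k0\mathbb{T})$ and $\mathbb{T}_L=\{\varnothing\}\cup 0\mathbb{T}$. Subsets of $\mathbb{Y}$ are graphs with edges $\{1^k,1^{k+1}\}$ and $\{1^k,1^k0\}$ ($k\in\mathbb{Z}$), and $\{w,wa\}$ for $w\in 1^k0\mathbb{T}$, $a\in\{0,1\}$ (between elements of the subset). Redwood tree: an injective $\sigma:\mathbb{Z}\to\mathbb{Z}$ is admissible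 if $|\{i\in\mathbb{N}:\sigma(i)\notin\mathbb{N}\}|+|\{i\in\mathbb{Z}\setminus\mathbb{N}:\sigma(i)\in\mathbb{N}\}|<\infty$. A record index is $r$ with $\sigma(r)>\sigma(k)$ for all $k<r$. For admissible $\sigma$ the record indices form a two-sided infinite set; its standard record representation is the increasing enumeration $(r_k)_{k\in\mathbb{Z}}$ indexed so that $\sigma(r_0)\le0<\sigma(r_1)$. Let $\sigma[k]$ be the finite sequence of values $\sigma(i)$ with $\sigma(r_k)<\sigma(i)<\sigma(r_{k+1})$, in increasing order of $i$. The redwood tree is $\mathrm{RW}(\sigma)=\bigcup_{k\in\mathbb{Z}}\big(\{1^k\}\cup 1^k0\,\mathrm{BST}(\sigma[k])\big)\subseteq\mathbb{Y}$. Two-sided Mallows permutation: let $\Pi_+,\Pi_-$ be independent Mallows permutations on $\mathbb{N}$ with parameter $q$, and $(M_i)_{i\ge1}$ independent with $\mathbb{P}(M_i=m)=q^{im}(1-q^i)$, $m\ge0$. Let $\Lambda_1\ge\Lambda_2\ge\dots$ be the nonincreasing sequence of nonnegative integers with $|\{j:\Lambda_j=i\}|=M_i$ for all $i\ge1$ (eventually $0$). Set $\ell_i=i-\Lambda_i$ ($i\ge1$), and let $k_0>k_{-1}>k_{-2}>\dots$ enumerate $\mathbb{Z}\setminus\{\ell_i:i\ge1\}$. Define $\mathcal{X}_q(\ell_i)=\Pi_+(i)$ and $\mathcal{X}_q(k_i)=1-\Pi_-(1-i)$ for $i\le 0$. This is the two-sided infinite Mallows permutation of $\mathbb{Z}$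 (the unique $q$-invariant law); it is almost surely admissible. Let $Y_q=\mathrm{RW}(\mathcal{X}_q)$ and let $o$ be uniform on the (a.s. finite) set $Y_q\cap\mathbb{T}_L$; $\mathcal{Y}_q=(o,Y_q)$. Local notions: $B_r(v,G)$ is the subgraph of $G$ induced by vertices at graph distance at most $r$ from $v$, rooted at $v$; $\equiv$ denotes isomorphism of rooted graphs (root-preserving graph isomorphism). *)

theory Defs
  imports "HOL-Probability.Probability"
begin

text \<open>A graph is a pair (V, E) with E a (symmetric) edge relation; a rooted graph
  is a triple (V, E, root).\<close>

definition ball_graph :: "nat \<Rightarrow> 'a set \<times> ('a \<times> 'a) set \<Rightarrow> 'a
    \<Rightarrow> 'a set \<times> ('a \<times> 'a) set \<times> 'a" where
  "ball_graph r G v =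
     (let V = fst G; E = snd G \<inter> (fst G \<times> fst G);
          B = {u. \<exists>k\<le>r. (v, u) \<in> E ^^ k}
      in (B, E \<inter> (B \<times> B), v))"

definition rooted_iso :: "'a set \<times> ('a \<times> 'a) set \<times> 'a
    \<Rightarrow> 'b set \<times> ('b \<times> 'b) set \<times> 'b \<Rightarrow> bool" where
  "rooted_iso G H =
     (case G of (V1, E1, o1) \<Rightarrow> case H of (V2, E2, o2) \<Rightarrow>
       (\<exists>f. bij_betw f V1 V2 \<and> f o1 = o2 \<and>
            (\<forall>x\<in>V1. \<forall>y\<in>V1. (x, y) \<in> E1 \<longleftrightarrow> (f x, f y) \<in> E2)))"

section \<open>Binary search trees, words over {0,1} as bool lists (False = 0, True = 1)\<close>

function bst :: "'a::linorder list \<Rightarrow> bool list set" where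
  "bst [] = {}"
| "bst (x # xs) = {[]} \<union> Cons False ` bst (filter (\<lambda>y. y < x) xs)
                       \<union> Cons True ` bst (filter (\<lambda>y. x < y) xs)"
  by pat_completeness auto
termination
  by (relation "Wellfounded.measure (\<lambda>xs. length xs)") (auto simp: le_imp_less_Suc)

definition edgesT :: "bool list set \<Rightarrow> (bool list \<times> bool list) set" where
  "edgesT S = {(u, v). u \<in> S \<and> v \<in> S \<and> (\<exists>a. v = u @ [a] \<or> u = v @ [a])}"

section \<open>Infinite Bernoulli model (indices in \<nat> = {1,2,...})\<close>

definition bern_field :: "real \<Rightarrow> (nat \<times> nat \<Rightarrow> bool) measure" where
  "bern_field q = PiM UNIV (\<lambda>_. measure_pmf (bernoulli_pmf (1 - q)))"

fun Ilist :: "(nat \<times> nat \<Rightarrow> bool) \<Rightarrow> nat \<Rightarrow> nat list" where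
  "Ilist B 0 = []"
| "Ilist B (Suc n) =
     Ilist B n @ [LEAST j. 1 \<le> j \<and> j \<notin> set (Ilist B n) \<and> B (Suc n, j)]"

definition mallowsN :: "(nat \<times> nat \<Rightarrow> bool) \<Rightarrow> nat \<Rightarrow> nat" where
  "mallowsN B i = Ilist B i ! (i - 1)"

definition Pi_list :: "(nat \<times> nat \<Rightarrow> bool) \<Rightarrow> nat \<Rightarrow> nat list" where
  "Pi_list B n = map (\<lambda>x. card {y \<in> set (Ilist B n). y \<le> x}) (Ilist B n)"

definition BST_Pi :: "(nat \<times> nat \<Rightarrow> bool) \<Rightarrow> nat \<Rightarrow> bool list set" where
  "BST_Pi B n = bst (Pi_list B n)"

datatype letter = L0 | L1 | Ups

definition letter_of :: "bool \<Rightarrow> letter" where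
  "letter_of b = (if b then L1 else L0)"

definition one_pow :: "int \<Rightarrow> letter list" where
  "one_pow k = (if k > 0 then replicate (nat k) L1
                else if k = 0 then [] else replicate (nat (- k)) Ups)"

definition branch_word :: "int \<Rightarrow> bool list \<Rightarrow> letter list" where
  "branch_word k w = one_pow k @ [L0] @ map letter_of w"

definition Yset :: "letter list set" where
  "Yset = (\<Union>k. {one_pow k} \<union> range (branch_word k))"

definition TL_set :: "letter list set" where
  "TL_set = {[]} \<union> range (branch_word 0)"

definition Y_basic_edge :: "letter list \<Rightarrow> letter list \<Rightarrow> bool" where
  "Y_basic_edge u v =
     ((\<exists>k. u = one_pow k \<and> v = one_pow (k + 1)) \<or>
      (\<exists>k. u = one_pow k \<and> v = one_pow k @ [L0]) \<or>
      (\<exists>k w a. u = branch_word k w \<and> v = u @ [letter_of a]))"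

definition edgesY :: "letter list set \<Rightarrow> (letter list \<times> letter list) set" where
  "edgesY S = {(u, v). u \<in> S \<and> v \<in> S \<and> (Y_basic_edge u v \<or> Y_basic_edge v u)}"

definition admissible :: "(int \<Rightarrow> int) \<Rightarrow> bool" where
  "admissible \<sigma> \<longleftrightarrow> inj \<sigma> \<and>
     finite {i::int. i \<ge> 1 \<and> \<sigma> i < 1} \<and> finite {i::int. i < 1 \<and> \<sigma> i \<ge> 1}"

definition record_indices :: "(int \<Rightarrow> int) \<Rightarrow> int set" where
  "record_indices \<sigma> = {r. \<forall>k<r. \<sigma> k < \<sigma> r}"

definition std_records :: "(int \<Rightarrow> int) \<Rightarrow> int \<Rightarrow> int" where
  "std_records \<sigma> = (THE \<rho>. strict_mono \<rho> \<and> range \<rho> = record_indices \<sigma> \<and>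
                          \<sigma> (\<rho> 0) \<le> 0 \<and> 0 < \<sigma> (\<rho> 1))"

definition sigma_block :: "(int \<Rightarrow> int) \<Rightarrow> int \<Rightarrow> int list" where
  "sigma_block \<sigma> k =
     (let \<rho> = std_records \<sigma>
      in map \<sigma> (sorted_list_of_set
             {i. \<sigma> (\<rho> k) < \<sigma> i \<and> \<sigma> i < \<sigma> (\<rho> (k + 1))}))"

definition redwood :: "(int \<Rightarrow> int) \<Rightarrow> letter list set" where
  "redwood \<sigma> = (\<Union>k. {one_pow k} \<union> branch_word k ` bst (sigma_block \<sigma> k))"

text \<open>Law of (M_1, M_2, ...): Mv i = M_{i+1}, P(M_i = m) = q^{im}(1 - q^i).\<close>
definition geom_field :: "real \<Rightarrow> (nat \<Rightarrow> nat) measure" where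
  "geom_field q = PiM UNIV (\<lambda>i. measure_pmf (geometric_pmf (1 - q ^ Suc i)))"

text \<open>Joint law of (\<Pi>_+ (via its Bernoulli array), \<Pi>_- (via its Bernoulli array), M), independent.\<close>
definition two_sided_field :: "real \<Rightarrow>
    ((nat \<times> nat \<Rightarrow> bool) \<times> (nat \<times> nat \<Rightarrow> bool) \<times> (nat \<Rightarrow> nat)) measure" where
  "two_sided_field q = bern_field q \<Otimes>\<^sub>M (bern_field q \<Otimes>\<^sub>M geom_field q)"

text \<open>lam j = \<Lambda>_{j+1}: nonincreasing, |{j : \<Lambda>_j = i}| = M_i for i \<ge> 1, eventually 0.\<close>
definition Lambda_seq :: "(nat \<Rightarrow> nat) \<Rightarrow> nat \<Rightarrow> nat" where
  "Lambda_seq Mv = (THE lam. antimono lam \<and>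
      (\<forall>i. card {j. lam j = Suc i} = Mv i) \<and> (\<exists>N. \<forall>j\<ge>N. lam j = 0))"

definition ell :: "(nat \<Rightarrow> nat) \<Rightarrow> nat \<Rightarrow> int" where
  "ell Mv i = int i - int (Lambda_seq Mv (i - 1))"

definition ell_compl :: "(nat \<Rightarrow> nat) \<Rightarrow> int set" where
  "ell_compl Mv = - (ell Mv ` {1..})"

text \<open>kelt Mv m = k_{-m}, i.e. the element of the complement with exactly m larger elements.\<close>
definition kelt :: "(nat \<Rightarrow> nat) \<Rightarrow> nat \<Rightarrow> int" where
  "kelt Mv m = (THE x. x \<in> ell_compl Mv \<and> card {y \<in> ell_compl Mv. x < y} = m)"

definition two_sided_mallows ::
    "(nat \<times> nat \<Rightarrow> bool) \<Rightarrow> (nat \<times> nat \<Rightarrow> bool) \<Rightarrow> (nat \<Rightarrow> nat) \<Rightarrow> int \<Rightarrow> int" where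
  "two_sided_mallows Bp Bm Mv z =
     (if \<exists>i\<ge>1. ell Mv i = z
      then int (mallowsN Bp (THE i. i \<ge> 1 \<and> ell Mv i = z))
      else 1 - int (mallowsN Bm (1 + (THE m. kelt Mv m = z))))"

text \<open>P(B_r(o, Y_q) \<equiv> H), with o uniform on Y_q \<inter> \<T>_L given Y_q.\<close>
definition redwood_prob :: "real \<Rightarrow> nat \<Rightarrow> 'h set \<times> ('h \<times> 'h) set \<times> 'h \<Rightarrow> real" where
  "redwood_prob q r H =
     (\<integral>\<omega>. (case \<omega> of (Bp, Bm, Mv) \<Rightarrow>
        let Y = redwood (two_sided_mallows Bp Bm Mv)
        in real (card {v \<in> Y \<inter> TL_set. rooted_iso (ball_graph r (Y, edgesY Y) v) H})
           / real (card (Y \<inter> TL_set)))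
      \<partial>two_sided_field q)"

definition local_freq :: "(nat \<times> nat \<Rightarrow> bool) \<Rightarrow> nat \<Rightarrow> nat
    \<Rightarrow> 'h set \<times> ('h \<times> 'h) set \<times> 'h \<Rightarrow> real" where
  "local_freq B n r H =
     (let T = BST_Pi B n
      in real (card {v \<in> T. rooted_iso (ball_graph r (T, edgesT T) v) H}) / real n)"

end

theory Submission
  imports Defs "HOL-Library.Sublist"
begin

text \<open>
  Write \<open>F(x)\<close> for the number of nodes of \<open>BST(x)\<close> whose \<open>r\<close>-ball is isomorphic to the given rooted graph.

  \<^emph>\<open>Concentration.\<close>  Cutting one edge of a binary tree changes the count of \<open>r\<close>-balls of a given shape by a
  constant that depends only on \<open>r\<close>.  Appending an element adds a leaf, and deleting the smallest element contracts a node,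
  so \<open>F(xy) = F(x) + F(y) + O(1 + h)\<close>, where \<open>h\<close> is the number of entries of \<open>y\<close> below \<open>max x\<close>.  In the Bernoulli model
  the relative orders of \<open>(I\<^sub>1, \<dots>, I\<^sub>n)\<close> and \<open>(I\<^sub>n\<^sub>+\<^sub>1, \<dots>, I\<^sub>n\<^sub>+\<^sub>m)\<close> are independent, the second one
  is distributed like that of \<open>(I\<^sub>1, \<dots>, I\<^sub>m)\<close>, and \<open>h\<close> is at most the number of holes below \<open>max (I\<^sub>1, \<dots>, I\<^sub>n)\<close>,
  whose second moment is bounded in \<open>n\<close>.  Hence the variance of \<open>F\<close> is \<open>O(n\<^sup>3\<^sup>/\<^sup>2)\<close>, and Chebyshev's inequality,
  Borel--Cantelli along fourth powers and a Lipschitz interpolation reduce the theorem to the convergence of the means.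

  \<^emph>\<open>The mean.\<close>  Split the nodes into the blocks hanging off the right spine, one for each record.  Averaging over a block,
  the count for a permutation of \<open>{1..N}\<close> is the sum over \<open>b < N\<close> of the average over the block that contains the value
  \<open>b + 1\<close>.  Cutting a permutation at height \<open>b\<close> into its values above \<open>b\<close>, its values up to \<open>b\<close> and their interleaving
  splits the inversions additively.  Therefore the relative order of the two-sided Mallows permutation on the window
  \<open>{1 - b..a}\<close>, conditioned on the interleaving partition fitting into the \<open>a \<times> b\<close> box, is exactly the Mallows law on
  permutations of \<open>{1..a + b}\<close>.  For an admissible sequence the block average in large windows is eventually equal to that of
  the redwood tree, so the \<open>b\<close>-th summand tends to the limit probability when both \<open>b\<close> and \<open>N - b\<close> tend to infinity.
\<close>

section \<open>Balls in trees\<close>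

text \<open>The exponent 3/2 comes from trading a covariance for a factor. The centred count of a
  concatenation is \<open>u + e\<close>, where \<open>u\<close> is a sum of two independent centred
  terms and \<open>e\<close> is the gluing error. The cross term is never estimated; instead
  \<open>(u + e)^2\<close> is bounded by \<open>11/10 u^2 + 11 e^2\<close>. Each halving of
  \<open>n\<close> then loses the factor 11/10, and the exponent 3/2 compensates for this, because
  the larger half is at most \<open>2 n / 3\<close> and 11/10 times \<open>sqrt (2/3)\<close> is
  below 1. Chebyshev's inequality at \<open>n\<close> leaves a probability of order
  \<open>1 / sqrt n\<close>, which is summable along fourth powers.

  No partition function is ever evaluated. The law of a window and the law of \<open>Ilist\<close>
  enter as weights \<open>q ^ inv_count p\<close> times a constant independent of \<open>p\<close>,
  and the constants are eliminated by total mass one.\<close>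

lemma rooted_iso_cong:
  assumes f: "bij_betw f V1 V2" "f o1 = o2" "o1 \<in> V1"
    and e: "\<And>x y. x \<in> V1 \<Longrightarrow> y \<in> V1 \<Longrightarrow> (x, y) \<in> E1 \<longleftrightarrow> (f x, f y) \<in> E2"
  shows "rooted_iso (V1, E1, o1) H \<longleftrightarrow> rooted_iso (V2, E2, o2) H"
proof
  assume "rooted_iso (V2, E2, o2) H"
  then obtain h where h: "bij_betw h V2 (fst H)" "h o2 = snd (snd H)"
    "\<forall>x\<in>V2. \<forall>y\<in>V2. (x, y) \<in> E2 \<longleftrightarrow> (h x, h y) \<in> fst (snd H)"
    unfolding rooted_iso_def by (auto split: prod.splits)
  have "bij_betw (h \<circ> f) V1 (fst H)" using bij_betw_trans[OF f(1) h(1)] .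
  moreover have "\<forall>x\<in>V1. \<forall>y\<in>V1. (x, y) \<in> E1 \<longleftrightarrow> ((h \<circ> f) x, (h \<circ> f) y) \<in> fst (snd H)"
    using h(3) e f(1) by (auto simp: bij_betw_def)
  moreover have "(h \<circ> f) o1 = snd (snd H)" using f h by simp
  ultimately show "rooted_iso (V1, E1, o1) H"
    unfolding rooted_iso_def by (auto split: prod.splits)
next
  assume "rooted_iso (V1, E1, o1) H"
  then obtain h where h: "bij_betw h V1 (fst H)" "h o1 = snd (snd H)"
    "\<forall>x\<in>V1. \<forall>y\<in>V1. (x, y) \<in> E1 \<longleftrightarrow> (h x, h y) \<in> fst (snd H)"
    unfolding rooted_iso_def by (auto split: prod.splits)
  define g where "g = inv_into V1 f"
  have g: "bij_betw g V2 V1" unfolding g_def by (rule bij_betw_inv_into[OF f(1)])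
  have fg: "f (g y) = y" "g y \<in> V1" if "y \<in> V2" for y
    using that f(1) unfolding g_def by (auto simp: bij_betw_def f_inv_into_f inv_into_into)
  have "g o2 = o1" using f unfolding g_def bij_betw_def by (metis inv_into_f_f)
  have "bij_betw (h \<circ> g) V2 (fst H)" using bij_betw_trans[OF g h(1)] .
  moreover have "\<forall>x\<in>V2. \<forall>y\<in>V2. (x, y) \<in> E2 \<longleftrightarrow> ((h \<circ> g) x, (h \<circ> g) y) \<in> fst (snd H)"
    using h(3) e fg by (metis comp_apply)
  moreover have "(h \<circ> g) o2 = snd (snd H)" using h \<open>g o2 = o1\<close> by simp
  ultimately show "rooted_iso (V2, E2, o2) H"
    unfolding rooted_iso_def by (auto split: prod.splits)
qed

text \<open>Walks of length at most \<open>r\<close> from \<open>v\<close> correspond under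
  \<open>f\<close>: \<open>edge\<close> pushes them forward, and \<open>lift\<close> brings back an
  edge that starts at the image of an inner vertex. Since \<open>lift\<close> is required only at
  distance below \<open>r\<close>, the two graphs may differ arbitrarily outside the ball.\<close>

lemma ball_iso_transfer:
  fixes E1 :: "('a \<times> 'a) set" and E2 :: "('b \<times> 'b) set"
  assumes E1: "E1 \<subseteq> V1 \<times> V1" and E2: "E2 \<subseteq> V2 \<times> V2"
    and inj: "inj_on f {u. \<exists>k\<le>r. (v, u) \<in> E1 ^^ k}"
    and edge: "\<And>j k x y. j \<le> r \<Longrightarrow> k \<le> r \<Longrightarrow> (v, x) \<in> E1 ^^ j \<Longrightarrow> (v, y) \<in> E1 ^^ k \<Longrightarrow>
      (x, y) \<in> E1 \<longleftrightarrow> (f x, f y) \<in> E2"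
    and lift: "\<And>k u y. k < r \<Longrightarrow> (v, u) \<in> E1 ^^ k \<Longrightarrow> (f u, y) \<in> E2 \<Longrightarrow> \<exists>u'. (u, u') \<in> E1 \<and> y = f u'"
  shows "rooted_iso (ball_graph r (V1, E1) v) H \<longleftrightarrow> rooted_iso (ball_graph r (V2, E2) (f v)) H"
proof -
  define B1 where "B1 = {u. \<exists>k\<le>r. (v, u) \<in> E1 ^^ k}"
  define B2 where "B2 = {u. \<exists>k\<le>r. (f v, u) \<in> E2 ^^ k}"
  have fwd: "k \<le> r \<Longrightarrow> (v, u) \<in> E1 ^^ k \<Longrightarrow> (f v, f u) \<in> E2 ^^ k" for k u
  proof (induction k arbitrary: u)
    case (Suc k)
    then obtain w where w: "(v, w) \<in> E1 ^^ k" "(w, u) \<in> E1" by auto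
    then have "(f v, f w) \<in> E2 ^^ k" using Suc by auto
    moreover have "(f w, f u) \<in> E2" using edge[of k "Suc k" w u] w Suc.prems by auto
    ultimately show ?case by auto
  qed auto
  have bwd: "k \<le> r \<Longrightarrow> (f v, y) \<in> E2 ^^ k \<Longrightarrow> \<exists>u. y = f u \<and> (v, u) \<in> E1 ^^ k" for k y
  proof (induction k arbitrary: y)
    case (Suc k)
    then obtain w where w: "(f v, w) \<in> E2 ^^ k" "(w, y) \<in> E2" by auto
    then obtain u where u: "w = f u" "(v, u) \<in> E1 ^^ k" using Suc by auto
    then obtain u' where "(u, u') \<in> E1" "y = f u'" using lift[of k u y] w Suc.prems by auto
    then show ?case using u by auto
  qed auto
  have img: "f ` B1 = B2" unfolding B1_def B2_def using fwd bwd by blast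
  have bij: "bij_betw f B1 B2" using inj img unfolding bij_betw_def B1_def by simp
  have b1: "ball_graph r (V1, E1) v = (B1, E1 \<inter> B1 \<times> B1, v)"
    using E1 unfolding ball_graph_def B1_def Let_def by (simp add: Int_absorb2)
  have b2: "ball_graph r (V2, E2) (f v) = (B2, E2 \<inter> B2 \<times> B2, f v)"
    using E2 unfolding ball_graph_def B2_def Let_def by (simp add: Int_absorb2)
  show ?thesis unfolding b1 b2
  proof (rule rooted_iso_cong[OF bij])
    show "v \<in> B1" unfolding B1_def by (auto intro: exI[of _ 0])
    show "(x, y) \<in> E1 \<inter> B1 \<times> B1 \<longleftrightarrow> (f x, f y) \<in> E2 \<inter> B2 \<times> B2" if "x \<in> B1" "y \<in> B1" for x y
      using that edge[of _ _ x y] img unfolding B1_def by blast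
  qed simp
qed

definition iso_count :: "nat \<Rightarrow> 'h set \<times> ('h \<times> 'h) set \<times> 'h \<Rightarrow> bool list set \<Rightarrow> nat" where
  "iso_count r H T = card {v \<in> T. rooted_iso (ball_graph r (T, edgesT T) v) H}"

definition subtree_at :: "'a list \<Rightarrow> 'a list set \<Rightarrow> 'a list set" where
  "subtree_at w T = {u. w @ u \<in> T}"

definition prune_at :: "'a list \<Rightarrow> 'a list set \<Rightarrow> 'a list set" where
  "prune_at w T = {u \<in> T. \<not> prefix w u}"

lemma edgesT_subset: "edgesT T \<subseteq> T \<times> T"
  by (auto simp: edgesT_def)

lemma sym_edgesT: "sym (edgesT T)"
  by (auto simp: edgesT_def sym_def)

text \<open>A vertex has at most three neighbours, its two children and
  \<open>butlast u\<close>.\<close>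

lemma edgesT_sphere: "finite {u. (w, u) \<in> edgesT T ^^ k} \<and> card {u. (w, u) \<in> edgesT T ^^ k} \<le> 3 ^ k"
proof (induction k)
  case (Suc k)
  let ?S = "{u. (w, u) \<in> edgesT T ^^ k}"
  have nb: "{y. (u, y) \<in> edgesT T} \<subseteq> {u @ [True], u @ [False], butlast u}" for u
    by (auto simp: edgesT_def)
  have fin: "finite {y. (u, y) \<in> edgesT T}" for u
    by (rule finite_subset[OF nb]) auto
  have c3: "card {y. (u, y) \<in> edgesT T} \<le> 3" for u
  proof -
    have "card {y. (u, y) \<in> edgesT T} \<le> card {u @ [True], u @ [False], butlast u}"
      by (rule card_mono[OF _ nb]) auto
    also have "\<dots> \<le> 3" by (rule order_trans[OF card_insert_le_m1[of 3]]) (auto simp: card_insert_if)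
    finally show ?thesis .
  qed
  have eq: "{u. (w, u) \<in> edgesT T ^^ Suc k} = (\<Union>u\<in>?S. {y. (u, y) \<in> edgesT T})" by auto
  have "card (\<Union>u\<in>?S. {y. (u, y) \<in> edgesT T}) \<le> (\<Sum>u\<in>?S. card {y. (u, y) \<in> edgesT T})"
    by (rule card_UN_le) (use Suc in auto)
  also have "\<dots> \<le> (\<Sum>u\<in>?S. 3)" by (rule sum_mono) (use c3 in auto)
  also have "\<dots> \<le> 3 ^ Suc k" using Suc by simp
  finally show ?case unfolding eq using Suc fin by auto
qed auto

lemma edgesT_ball:
  "finite {u. \<exists>k\<le>r. (w, u) \<in> edgesT T ^^ k}" "card {u. \<exists>k\<le>r. (w, u) \<in> edgesT T ^^ k} \<le> (r + 1) * 3 ^ r"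
proof -
  have eq: "{u. \<exists>k\<le>r. (w, u) \<in> edgesT T ^^ k} = (\<Union>k\<in>{..r}. {u. (w, u) \<in> edgesT T ^^ k})" by auto
  show "finite {u. \<exists>k\<le>r. (w, u) \<in> edgesT T ^^ k}" unfolding eq using edgesT_sphere by auto
  have "card (\<Union>k\<in>{..r}. {u. (w, u) \<in> edgesT T ^^ k}) \<le> (\<Sum>k\<le>r. card {u. (w, u) \<in> edgesT T ^^ k})"
    by (rule card_UN_le) auto
  also have "\<dots> \<le> (\<Sum>k\<le>r. 3 ^ r)"
    by (intro sum_mono order_trans[OF conjunct2[OF edgesT_sphere]]) (auto intro: power_increasing)
  finally show "card {u. \<exists>k\<le>r. (w, u) \<in> edgesT T ^^ k} \<le> (r + 1) * 3 ^ r" unfolding eq by simp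
qed

text \<open>The exceptional set is compared through \<open>g\<close>, so that one ball around the
  cut in the big tree serves for both pieces, with \<open>g\<close> the inclusion of the
  piece.\<close>

lemma card_filter_diff_le:
  assumes "finite S" "finite N" "\<And>x. x \<in> S \<Longrightarrow> g x \<notin> N \<Longrightarrow> P x \<longleftrightarrow> Q x" "inj_on g S"
  shows "\<bar>int (card {x \<in> S. P x}) - int (card {x \<in> S. Q x})\<bar> \<le> int (card N)"
proof -
  have *: "card {x \<in> S. P x} \<le> card {x \<in> S. Q x} + card N"
    if "\<And>x. x \<in> S \<Longrightarrow> g x \<notin> N \<Longrightarrow> P x \<Longrightarrow> Q x" for P Q
  proof -
    have "card {x \<in> S. P x} \<le> card ({x \<in> S. Q x} \<union> {x \<in> S. g x \<in> N})"
      by (rule card_mono) (use assms that in auto)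
    also have "\<dots> \<le> card {x \<in> S. Q x} + card {x \<in> S. g x \<in> N}" by (rule card_Un_le)
    also have "card {x \<in> S. g x \<in> N} \<le> card N"
      by (rule card_inj_on_le[of g]) (use assms in \<open>auto intro: inj_on_subset\<close>)
    finally show ?thesis by simp
  qed
  show ?thesis using *[of P Q] *[of Q P] assms(3) by auto
qed

text \<open>A ball notices the cut only if it reaches \<open>w\<close>: a walk leaves the pruned
  part only by stepping onto \<open>w\<close>, and leaves the subtree only by stepping up from
  \<open>w\<close>. So all affected centres lie in the ball around \<open>w\<close>, and each of the
  two pieces is charged its size once. The word \<open>w\<close> may lie outside \<open>T\<close>,
  as happens when no later entry exceeds the maximum.\<close>

lemma iso_count_cut:
  assumes fin: "finite T"
  shows "\<bar>int (iso_count r H T) - int (iso_count r H (subtree_at w T)) - int (iso_count r H (prune_at w T))\<bar>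
    \<le> 2 * ((int r + 1) * 3 ^ r)"
proof -
  let ?E = "edgesT T" and ?U = "subtree_at w T" and ?A = "prune_at w T"
  let ?P = "\<lambda>v. rooted_iso (ball_graph r (T, ?E) v) H"
  define N where "N = {u. \<exists>k\<le>r. (w, u) \<in> ?E ^^ k}"
  have N: "finite N" "card N \<le> (r + 1) * 3 ^ r" unfolding N_def by (rule edgesT_ball)+
  have symk: "(u, v) \<in> ?E ^^ k \<Longrightarrow> (v, u) \<in> ?E ^^ k" for u v k
  proof (induction k arbitrary: u v)
    case (Suc k)
    then obtain z where "(u, z) \<in> ?E ^^ k" "(z, v) \<in> ?E" by auto
    then have "(z, u) \<in> ?E ^^ k" "(v, z) \<in> ?E" using Suc.IH sym_edgesT by (auto dest: symD)
    then show ?case by (metis relpow_Suc_I2)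
  qed auto
  have finU: "finite ?U" 
  proof (rule finite_imageD)
    show "finite ((@) w ` ?U)" by (rule finite_subset[OF _ fin]) (auto simp: subtree_at_def)
  qed (auto simp: inj_on_def)
  have finA: "finite ?A" using fin by (auto simp: prune_at_def)
  have split: "{v \<in> T. ?P v} = {v \<in> ?A. ?P v} \<union> (@) w ` {u \<in> ?U. ?P (w @ u)}"
    unfolding prune_at_def subtree_at_def prefix_def by blast
  have c: "iso_count r H T = card {v \<in> ?A. ?P v} + card {u \<in> ?U. ?P (w @ u)}"
    unfolding iso_count_def split
    by (subst card_Un_disjoint) (use fin finU in \<open>auto simp: prune_at_def card_image inj_on_def\<close>)
  have A: "rooted_iso (ball_graph r (?A, edgesT ?A) v) H \<longleftrightarrow> ?P v" if v: "v \<in> ?A" "v \<notin> N" for v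
  proof -
    have sub: "edgesT ?A \<subseteq> ?E" by (auto simp: edgesT_def prune_at_def)
    have subk: "edgesT ?A ^^ k \<subseteq> ?E ^^ k" for k using sub by (induction k) auto
    have inA: "u \<in> ?A" if "(v, u) \<in> edgesT ?A ^^ k" for u k
      using that v by (cases k) (auto simp: edgesT_def)
    have "rooted_iso (ball_graph r (?A, edgesT ?A) v) H \<longleftrightarrow> rooted_iso (ball_graph r (T, ?E) (id v)) H"
    proof (rule ball_iso_transfer)
      fix k u y assume k: "k < r" "(v, u) \<in> edgesT ?A ^^ k" "(id u, y) \<in> ?E"
      \<comment> \<open>As \<open>k < r\<close>, stepping onto \<open>w\<close> would put
        \<open>w\<close> within distance \<open>r\<close> of \<open>v\<close>, and by symmetry
        \<open>v\<close> into \<open>N\<close>.\<close>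
      have "(v, y) \<in> ?E ^^ Suc k" using k subk by (auto intro: relcompI)
      then have "(y, v) \<in> ?E ^^ Suc k" by (rule symk)
      then have yw: "y \<noteq> w" using v(2) k(1) unfolding N_def by (auto simp del: relpow.simps)
      have u: "\<not> prefix w u" using inA[OF k(2)] by (simp add: prune_at_def)
      have "y \<in> T" "\<exists>a. y = u @ [a] \<or> u = y @ [a]" using k(3) by (auto simp: edgesT_def)
      then have "y \<in> ?A" using u yw by (auto simp: prune_at_def)
      then show "\<exists>u'. (u, u') \<in> edgesT ?A \<and> y = id u'"
        using k inA[OF k(2)] by (auto simp: edgesT_def)
    next
      fix j k x y assume "(v, x) \<in> edgesT ?A ^^ j" "(v, y) \<in> edgesT ?A ^^ k"
      then have "x \<in> ?A" "y \<in> ?A" using inA by auto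
      then show "(x, y) \<in> edgesT ?A \<longleftrightarrow> (id x, id y) \<in> ?E"
        by (auto simp: edgesT_def prune_at_def)
    qed (use edgesT_subset in auto)
    then show ?thesis by simp
  qed
  have U: "rooted_iso (ball_graph r (?U, edgesT ?U) v) H \<longleftrightarrow> ?P (w @ v)" if v: "v \<in> ?U" "w @ v \<notin> N" for v
  proof -
    have e: "(x, y) \<in> edgesT ?U \<longleftrightarrow> (w @ x, w @ y) \<in> ?E" for x y
      by (auto simp: edgesT_def subtree_at_def)
    have subk: "(x, y) \<in> edgesT ?U ^^ k \<Longrightarrow> (w @ x, w @ y) \<in> ?E ^^ k" for k x y
      using e by (induction k arbitrary: y) auto
    show ?thesis
    proof (rule ball_iso_transfer[where f="(@) w"])
      fix k u y assume k: "k < r" "(v, u) \<in> edgesT ?U ^^ k" "(w @ u, y) \<in> ?E"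
      have "(w @ v, w @ u) \<in> ?E ^^ k" using k subk by auto
      then have "(w @ u, w @ v) \<in> ?E ^^ k" by (rule symk)
      \<comment> \<open>A walk at the root of the subtree sits at \<open>w\<close>, which
        \<open>v\<close> off \<open>N\<close> excludes. Every other vertex of the subtree has all
        its neighbours inside.\<close>
      then have "u \<noteq> []" using v(2) k(1) unfolding N_def by auto
      have "\<exists>a. y = w @ u @ [a] \<or> w @ u = y @ [a]" using k(3) by (auto simp: edgesT_def)
      then obtain a where "y = w @ u @ [a] \<or> w @ u = y @ [a]" by blast
      then have "\<exists>u'. y = w @ u'"
      proof
        assume "w @ u = y @ [a]"
        then have "butlast (w @ u) = y" by simp
        then show ?thesis using \<open>u \<noteq> []\<close> by (auto simp: butlast_append)
      qed auto
      then obtain u' where "y = w @ u'" by blast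
      then show "\<exists>u'. (u, u') \<in> edgesT ?U \<and> y = w @ u'" using e k by auto
    qed (use e edgesT_subset in \<open>auto simp: inj_on_def\<close>)
  qed
  have "\<bar>int (card {v \<in> ?A. ?P v}) - int (iso_count r H ?A)\<bar> \<le> int (card N)"
    unfolding iso_count_def
    by (rule card_filter_diff_le[where g=id]) (use finA N A in auto)
  moreover have "\<bar>int (card {v \<in> ?U. ?P (w @ v)}) - int (iso_count r H ?U)\<bar> \<le> int (card N)"
    unfolding iso_count_def
    by (rule card_filter_diff_le[where g="(@) w"]) (use finU N U in \<open>auto simp: inj_on_def\<close>)
  moreover have "int (card N) \<le> (int r + 1) * 3 ^ r" 
    using of_nat_mono[OF N(2), where 'a=int] by (simp add: algebra_simps)
  ultimately show ?thesis unfolding c by linarith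
qed

section \<open>Binary search trees under concatenation\<close>

lemma finite_bst: "finite (bst xs)"
  by (induction xs rule: bst.induct) auto

lemma bst_map_strict_mono:
  fixes f :: "'a::linorder \<Rightarrow> 'b::linorder"
  assumes "strict_mono_on (set xs) f"
  shows "bst (map f xs) = bst xs"
  using assms
proof (induction xs rule: bst.induct)
  case (2 x xs)
  have 1: "filter (\<lambda>y. y < f x) (map f xs) = map f (filter (\<lambda>y. y < x) xs)"
    unfolding filter_map o_def using 2(3)
    by (intro arg_cong[where f="map f"] filter_cong) (auto simp: strict_mono_on_less)
  have F2: "filter (\<lambda>y. f x < y) (map f xs) = map f (filter (\<lambda>y. x < y) xs)"
    unfolding filter_map o_def using 2(3)
    by (intro arg_cong[where f="map f"] filter_cong) (auto simp: strict_mono_on_less)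
  have "strict_mono_on (set (filter (\<lambda>y. y < x) xs)) f" "strict_mono_on (set (filter (\<lambda>y. x < y) xs)) f"
    using 2(3) by (auto simp: strict_mono_on_def)
  then show ?case using 2(1,2) by (simp add: 1 F2 del: filter_map)
qed simp

lemma card_bst: "distinct xs \<Longrightarrow> card (bst xs) = length xs"
proof (induction xs rule: bst.induct)
  case (2 x xs)
  let ?L = "filter (\<lambda>y. y < x) xs" and ?R = "filter (\<lambda>y. x < y) xs"
  have "card (bst (x # xs)) = Suc (card (Cons False ` bst ?L \<union> Cons True ` bst ?R))"
    by (subst card_insert_disjoint[symmetric]) (auto simp: finite_bst)
  also have "card (Cons False ` bst ?L \<union> Cons True ` bst ?R) = card (bst ?L) + card (bst ?R)"
    by (subst card_Un_disjoint) (auto simp: finite_bst card_image)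
  also have "\<dots> = length ?L + length ?R" using 2 by simp
  also have "\<dots> = length xs"
  proof -
    have "filter (\<lambda>y. x < y) xs = filter (\<lambda>y. \<not> y < x) xs"
      using 2(3) by (intro filter_cong) (auto simp: not_less order_less_le)
    then show ?thesis by (simp add: sum_length_filter_compl)
  qed
  finally show ?case by simp
qed simp

text \<open>A new key ends up in an empty slot. The second conjunct is stronger than
  \<open>w\<close> being new: no descendant of \<open>w\<close> is present, so the new vertex is a
  leaf.\<close>

lemma bst_snoc:
  "x \<notin> set xs \<Longrightarrow> \<exists>w. bst (xs @ [x]) = insert w (bst xs) \<and> (\<forall>u. w @ u \<notin> bst xs)"
proof (induction xs rule: bst.induct)
  case 1
  then show ?case by (intro exI[of _ "[]"]) auto
next
  case (2 z zs)
  let ?L = "filter (\<lambda>y. y < z) zs" and ?R = "filter (\<lambda>y. z < y) zs"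
  show ?case
  proof (cases "x < z")
    case True
    obtain w where w: "bst (?L @ [x]) = insert w (bst ?L)" "\<forall>u. w @ u \<notin> bst ?L"
      using 2 by auto
    have "bst ((z # zs) @ [x]) = insert (False # w) (bst (z # zs))"
      using True w(1) by auto
    then show ?thesis using w(2) by (intro exI[of _ "False # w"]) auto
  next
    case False
    then have *: "z < x" using 2(3) by auto
    obtain w where w: "bst (?R @ [x]) = insert w (bst ?R)" "\<forall>u. w @ u \<notin> bst ?R"
      using 2 by auto
    have "bst ((z # zs) @ [x]) = insert (True # w) (bst (z # zs))"
      using * w(1) by auto
    then show ?thesis using w(2) by (intro exI[of _ "True # w"]) auto
  qed
qed

text \<open>The maximum of \<open>xs\<close> ends the right spine of \<open>bst xs\<close> and has
  no right child there. The entries of \<open>ys\<close> above it all gather in that empty slot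
  \<open>w\<close>, and the others never enter it.\<close>

lemma bst_append:
  assumes "xs \<noteq> []" "distinct xs" "Max (set xs) \<notin> set ys"
  shows "\<exists>w. subtree_at w (bst (xs @ ys)) = bst (filter (\<lambda>y. Max (set xs) < y) ys) \<and>
             prune_at w (bst (xs @ ys)) = bst (xs @ filter (\<lambda>y. y < Max (set xs)) ys)"
  using assms
proof (induction xs arbitrary: ys rule: bst.induct)
  case (2 z zs)
  define M where "M = Max (set (z # zs))"
  let ?R = "filter (\<lambda>y. z < y) zs"
  have M: "z \<le> M" "\<And>y. y \<in> set zs \<Longrightarrow> y \<le> M" "M \<in> set (z # zs)"
    unfolding M_def by (simp_all only: List.finite_set Max_ge Max_in list.set_intros list.distinct set_empty not_False_eq_True)
  show ?case
  proof (cases "?R = []")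
    case True
    then have Mz: "M = z" using M 2(4) unfolding filter_empty_conv by force
    have R: "filter (\<lambda>y. z < y) (filter (\<lambda>y. y < z) ys) = []" by (auto simp: filter_empty_conv)
    show ?thesis unfolding M_def[symmetric] Mz
      by (intro exI[of _ "[True]"]) (use True R in \<open>auto simp: subtree_at_def prune_at_def\<close>)
  next
    case False
    have MR: "Max (set ?R) = M"
    proof (rule Max_eqI)
      obtain y where "y \<in> set zs" "z < y" using False by (auto simp: filter_empty_conv)
      then have "z < M" using M(2) by force
      then show "M \<in> set ?R" using M by auto
    qed (use M in auto)
    have "z < M" using False M(2) by (force simp: filter_empty_conv)
    have Mys: "M \<notin> set ys" using 2(5) unfolding M_def .
    have "\<exists>w. subtree_at w (bst (?R @ filter (\<lambda>y. z < y) ys)) = bst (filter (\<lambda>y. M < y) (filter (\<lambda>y. z < y) ys)) \<and>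
        prune_at w (bst (?R @ filter (\<lambda>y. z < y) ys)) = bst (?R @ filter (\<lambda>y. y < M) (filter (\<lambda>y. z < y) ys))"
      using 2(2)[of "filter (\<lambda>y. z < y) ys"] False 2(4) Mys unfolding MR by auto
    moreover have "filter (\<lambda>y. M < y) (filter (\<lambda>y. z < y) ys) = filter (\<lambda>y. M < y) ys"
      using \<open>z < M\<close> by (auto intro: filter_cong)
    moreover have "filter (\<lambda>y. y < M) (filter (\<lambda>y. z < y) ys) = filter (\<lambda>y. z < y) (filter (\<lambda>y. y < M) ys)"
      by (simp add: conj_commute)
    ultimately obtain w where w: "subtree_at w (bst (?R @ filter (\<lambda>y. z < y) ys)) = bst (filter (\<lambda>y. M < y) ys)"
      "prune_at w (bst (?R @ filter (\<lambda>y. z < y) ys)) = bst (?R @ filter (\<lambda>y. z < y) (filter (\<lambda>y. y < M) ys))"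
      by metis
    have L: "filter (\<lambda>y. y < z) (filter (\<lambda>y. y < M) ys) = filter (\<lambda>y. y < z) ys"
      using \<open>z < M\<close> by (auto intro: filter_cong)
    have s: "subtree_at (True # w) (bst ((z # zs) @ ys)) = subtree_at w (bst (?R @ filter (\<lambda>y. z < y) ys))"
      by (auto simp: subtree_at_def)
    have p: "prune_at (True # w) (bst ((z # zs) @ ys)) =
      {[]} \<union> Cons False ` bst (filter (\<lambda>y. y < z) zs @ filter (\<lambda>y. y < z) ys) \<union>
        Cons True ` prune_at w (bst (?R @ filter (\<lambda>y. z < y) ys))"
      by (auto simp: prune_at_def)
    show ?thesis unfolding M_def[symmetric]
      by (intro exI[of _ "True # w"]) (simp only: s p w, use L in simp)
  qed
qed simp

text \<open>The minimum ends the left spine and so has no left child. Deleting it replaces the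
  subtree at its node \<open>w\<close> by the right branch and leaves everything outside
  \<open>w\<close> alone.\<close>

lemma bst_delete_min:
  assumes "ys \<noteq> []" "distinct ys"
  shows "\<exists>w. (\<forall>u. False # u \<notin> subtree_at w (bst ys)) \<and> [] \<in> subtree_at w (bst ys) \<and>
     subtree_at w (bst (filter (\<lambda>y. Min (set ys) < y) ys)) = subtree_at [True] (subtree_at w (bst ys)) \<and>
     prune_at w (bst (filter (\<lambda>y. Min (set ys) < y) ys)) = prune_at w (bst ys)"
  using assms
proof (induction ys rule: bst.induct)
  case (2 z zs)
  define M where "M = Min (set (z # zs))"
  let ?R = "filter (\<lambda>y. y < z) zs"
  have M: "M \<le> z" "\<And>y. y \<in> set zs \<Longrightarrow> M \<le> y" "M \<in> set (z # zs)"
    unfolding M_def by (simp_all only: List.finite_set Min_le Min_in list.set_intros list.distinct set_empty not_False_eq_True)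
  show ?case
  proof (cases "?R = []")
    case True
    then have Mz: "M = z" using M 2(4) unfolding filter_empty_conv by force
    show ?thesis unfolding M_def[symmetric] Mz
      by (intro exI[of _ "[]"]) (use True in \<open>auto simp: subtree_at_def prune_at_def\<close>)
  next
    case False
    have "M < z" using False M(2) by (force simp: filter_empty_conv)
    have MR: "Min (set ?R) = M"
      by (rule Min_eqI) (use M \<open>M < z\<close> in auto)
    obtain w where w: "\<forall>u. False # u \<notin> subtree_at w (bst ?R)" "[] \<in> subtree_at w (bst ?R)"
     "subtree_at w (bst (filter (\<lambda>y. M < y) ?R)) = subtree_at [True] (subtree_at w (bst ?R))"
     "prune_at w (bst (filter (\<lambda>y. M < y) ?R)) = prune_at w (bst ?R)"
      using 2(1) False 2(4) unfolding MR by auto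
    have fr: "filter (\<lambda>y. M < y) (z # zs) = z # filter (\<lambda>y. M < y) zs" using \<open>M < z\<close> by simp
    have fl: "filter (\<lambda>y. y < z) (filter (\<lambda>y. M < y) zs) = filter (\<lambda>y. M < y) ?R"
      by (simp add: conj_commute)
    have fg: "filter (\<lambda>y. z < y) (filter (\<lambda>y. M < y) zs) = filter (\<lambda>y. z < y) zs"
      using \<open>M < z\<close> by (auto intro: filter_cong)
    have s: "subtree_at (False # w) (bst (z # zs)) = subtree_at w (bst ?R)"
      "subtree_at (False # w) (bst (z # filter (\<lambda>y. M < y) zs)) = subtree_at w (bst (filter (\<lambda>y. M < y) ?R))"
      unfolding bst.simps fl fg by (auto simp: subtree_at_def)
    have p: "prune_at (False # w) (bst (z # zs)) = {[]} \<union> Cons True ` bst (filter (\<lambda>y. z < y) zs) \<union> Cons False ` prune_at w (bst ?R)"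
      "prune_at (False # w) (bst (z # filter (\<lambda>y. M < y) zs)) = {[]} \<union> Cons True ` bst (filter (\<lambda>y. z < y) zs) \<union> 
        Cons False ` prune_at w (bst (filter (\<lambda>y. M < y) ?R))"
      unfolding bst.simps fl fg by (auto simp: prune_at_def)
    show ?thesis unfolding M_def[symmetric] fr
      by (intro exI[of _ "False # w"]) (use w s p in metis)
  qed
qed simp

section \<open>Ball counts under insertion, deletion and concatenation\<close>

definition cut_const :: "nat \<Rightarrow> int" where
  "cut_const r = 2 * ((int r + 1) * 3 ^ r)"

lemma cut_const_nonneg: "0 \<le> cut_const r"
  by (simp add: cut_const_def)

lemma iso_count_singleton: "iso_count r H {w} \<le> 1"
proof -
  have "iso_count r H {w} \<le> card {w}" unfolding iso_count_def by (rule card_mono) auto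
  then show ?thesis by simp
qed

lemma iso_count_insert_leaf:
  assumes "finite T" "\<forall>u. w @ u \<notin> T"
  shows "\<bar>int (iso_count r H (insert w T)) - int (iso_count r H T)\<bar> \<le> cut_const r + 1"
proof -
  have s: "subtree_at w (insert w T) = {[]}" "prune_at w (insert w T) = T"
    using assms(2) by (auto simp: subtree_at_def prune_at_def prefix_def)
  show ?thesis
    using iso_count_cut[of "insert w T" r H w] assms(1) iso_count_singleton[of r H "[]"]
    unfolding s cut_const_def[symmetric] by simp
qed

lemma iso_count_bst_snoc:
  assumes "x \<notin> set xs"
  shows "\<bar>int (iso_count r H (bst (xs @ [x]))) - int (iso_count r H (bst xs))\<bar> \<le> cut_const r + 1"
  using bst_snoc[OF assms] iso_count_insert_leaf[OF finite_bst] by metis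

lemma iso_count_bst_append_le:
  assumes "distinct (xs @ ys)"
  shows "\<bar>int (iso_count r H (bst (xs @ ys))) - int (iso_count r H (bst xs))\<bar> \<le> (cut_const r + 1) * int (length ys)"
  using assms
proof (induction ys rule: rev_induct)
  case (snoc y ys)
  then show ?case using iso_count_bst_snoc[of y "xs @ ys" r H]
    by (auto simp: algebra_simps)
qed simp

text \<open>Three cuts suffice: at \<open>w\<close> in both trees, and at the right child of
  \<open>w\<close> in the original one. After them the two sides differ by the single removed
  vertex.\<close>

lemma iso_count_bst_delete_min:
  assumes "ys \<noteq> []" "distinct ys"
  shows "\<bar>int (iso_count r H (bst ys)) - int (iso_count r H (bst (filter (\<lambda>y. Min (set ys) < y) ys)))\<bar> \<le> 3 * cut_const r + 1"
proof -
  obtain w where w: "\<forall>u. False # u \<notin> subtree_at w (bst ys)" "[] \<in> subtree_at w (bst ys)"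
     "subtree_at w (bst (filter (\<lambda>y. Min (set ys) < y) ys)) = subtree_at [True] (subtree_at w (bst ys))"
     "prune_at w (bst (filter (\<lambda>y. Min (set ys) < y) ys)) = prune_at w (bst ys)"
    using bst_delete_min[OF assms] by auto
  let ?S = "subtree_at w (bst ys)"
  have fS: "finite ?S"
    by (rule finite_imageD[where f="(@) w"], rule finite_subset[OF _ finite_bst[of ys]])
       (auto simp: subtree_at_def inj_on_def)
  have e: "prune_at [True] ?S = {[]}" 
  proof -
    have "u = []" if "u \<in> ?S" "\<not> prefix [True] u" for u
    proof (cases u)
      case (Cons a v)
      then show ?thesis using that w(1) by (cases a) auto
    qed simp
    then show ?thesis using w(2) by (auto simp: prune_at_def)
  qed
  show ?thesis
    using iso_count_cut[OF finite_bst, of r H ys w] iso_count_cut[OF fS, of r H "[True]"]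
      iso_count_cut[OF finite_bst, of r H "filter (\<lambda>y. Min (set ys) < y) ys" w]
      iso_count_singleton[of r H "[]"]
    unfolding w(3,4) e cut_const_def[symmetric] by linarith
qed

text \<open>The entries below \<open>M\<close> are removed one at a time, always the current
  minimum.\<close>

lemma iso_count_bst_delete_below:
  assumes "distinct ys" "M \<notin> set ys"
  shows "\<bar>int (iso_count r H (bst ys)) - int (iso_count r H (bst (filter (\<lambda>y. M < y) ys)))\<bar>
    \<le> (3 * cut_const r + 1) * int (length (filter (\<lambda>y. y < M) ys))"
  using assms
proof (induction "length (filter (\<lambda>y. y < M) ys)" arbitrary: ys)
  case 0
  then have "filter (\<lambda>y. M < y) ys = ys" by (auto simp: filter_id_conv filter_empty_conv) (metis linorder_neqE)
  then show ?case using cut_const_nonneg[of r] by simp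
next
  case (Suc k)
  define m where "m = Min (set ys)"
  let ?z = "filter (\<lambda>y. m < y) ys"
  have ne: "ys \<noteq> []" using Suc by auto
  obtain y where y: "y \<in> set ys" "y < M" using Suc(2) by (metis filter_False length_0_conv nat.distinct(1))
  have m: "m \<in> set ys" "\<And>y. y \<in> set ys \<Longrightarrow> m \<le> y" using ne unfolding m_def by auto
  have mM: "m < M" using m(2)[OF y(1)] y(2) by simp
  have f1: "filter (\<lambda>y. M < y) ?z = filter (\<lambda>y. M < y) ys"
    using mM by (auto intro: filter_cong)
  have rm: "?z = remove1 m ys"
    using Suc(3) m by (subst distinct_remove1_removeAll) (auto simp: removeAll_filter_not_eq order_less_le intro!: filter_cong)
  have "filter (\<lambda>y. y < M) ?z = remove1 m (filter (\<lambda>y. y < M) ys)"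
    unfolding rm using mM by (simp add: filter_remove1)
  then have len: "length (filter (\<lambda>y. y < M) ?z) = k"
    using Suc(2) m mM by (simp add: length_remove1)
  have "\<bar>int (iso_count r H (bst ?z)) - int (iso_count r H (bst (filter (\<lambda>y. M < y) ys)))\<bar>
    \<le> (3 * cut_const r + 1) * int k"
    using Suc(1)[of ?z] len Suc(3,4) unfolding f1 by auto
  then show ?case using iso_count_bst_delete_min[OF ne Suc(3), of r H] Suc(2)
    unfolding m_def[symmetric] by (simp flip: Suc(2) add: algebra_simps)
qed

text \<open>One cut separates the entries above the maximum. Each low entry of \<open>ys\<close>
  costs \<open>cut_const r + 1\<close> when it is inserted behind \<open>xs\<close> and
  \<open>3 * cut_const r + 1\<close> when it is deleted from \<open>ys\<close>; the constant in
  front is the sum of the two.\<close>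

lemma iso_count_bst_append:
  assumes "xs \<noteq> []" "distinct (xs @ ys)"
  shows "\<bar>int (iso_count r H (bst (xs @ ys))) - int (iso_count r H (bst xs)) - int (iso_count r H (bst ys))\<bar>
    \<le> (4 * cut_const r + 2) * (1 + int (length (filter (\<lambda>y. y < Max (set xs)) ys)))"
proof -
  let ?M = "Max (set xs)"
  let ?l = "filter (\<lambda>y. y < ?M) ys" and ?g = "filter (\<lambda>y. ?M < y) ys"
  have M: "?M \<notin> set ys" using assms by (metis List.finite_set Max_in distinct_append disjoint_iff set_empty)
  have d: "distinct xs" "distinct ys" "distinct (xs @ ?l)" using assms(2) by auto
  obtain w where w: "subtree_at w (bst (xs @ ys)) = bst ?g" "prune_at w (bst (xs @ ys)) = bst (xs @ ?l)"
    using bst_append[OF assms(1) d(1) M] by auto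
  show ?thesis
    using iso_count_cut[OF finite_bst, of r H "xs @ ys" w] iso_count_bst_append_le[OF d(3), of r H]
      iso_count_bst_delete_below[OF d(2) M, of r H] cut_const_nonneg[of r]
    unfolding w cut_const_def[symmetric] by (simp add: algebra_simps)
qed

section \<open>The law of the infinite Bernoulli model\<close>

lemma card_less_enumerate:
  fixes A :: "nat set"
  assumes "infinite A"
  shows "card {y \<in> A. y < enumerate A n} = n"
proof -
  have "{y \<in> A. y < enumerate A n} = enumerate A ` {..<n}"
  proof (intro set_eqI iffI)
    fix y assume y: "y \<in> {y \<in> A. y < enumerate A n}"
    then have "y \<in> range (enumerate A)" using range_enumerate[OF assms] by simp
    then show "y \<in> enumerate A ` {..<n}" using y assms by auto
  next
    fix y assume "y \<in> enumerate A ` {..<n}"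
    then show "y \<in> {y \<in> A. y < enumerate A n}" using assms enumerate_in_set[OF assms] by auto
  qed
  moreover have "inj_on (enumerate A) {..<n}" using inj_enumerate[OF assms] by (rule inj_on_subset) simp
  ultimately show ?thesis by (simp add: card_image)
qed

lemma enumerate_card_less:
  fixes A :: "nat set"
  assumes "infinite A" "x \<in> A"
  shows "enumerate A (card {y \<in> A. y < x}) = x"
proof -
  obtain n where "enumerate A n = x" using assms by (metis enumerate_Ex)
  then show ?thesis using card_less_enumerate[OF assms(1), of n] by simp
qed

lemma enumerate_image:
  fixes f :: "nat \<Rightarrow> nat"
  assumes "strict_mono f" "infinite B"
  shows "enumerate (f ` B) n = f (enumerate B n)"
proof -
  have inj: "inj f" using assms(1) by (rule strict_mono_imp_inj_on)
  have inf: "infinite (f ` B)" using assms(2) inj by (meson finite_imageD inj_on_subset subset_UNIV)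
  have eq: "{y \<in> f ` B. y < f (enumerate B n)} = f ` {y \<in> B. y < enumerate B n}"
    using assms(1) by (auto simp: strict_mono_less)
  have "card (f ` {y \<in> B. y < enumerate B n}) = n"
    using card_less_enumerate[OF assms(2)] inj by (subst card_image) (auto intro: inj_on_subset)
  then show ?thesis
    using enumerate_card_less[OF inf, of "f (enumerate B n)"] assms(2) unfolding eq by (auto simp: enumerate_in_set)
qed

definition free_enum :: "nat set \<Rightarrow> nat \<Rightarrow> nat" where
  "free_enum S k = enumerate (- insert 0 S) k"

lemma infinite_free: "finite (S::nat set) \<Longrightarrow> infinite (- insert 0 S)"
  by (metis finite_compl finite_insert infinite_UNIV_nat)

lemma free_enum_in: "finite S \<Longrightarrow> free_enum S k \<notin> S \<and> 0 < free_enum S k"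
  unfolding free_enum_def using enumerate_in_set[OF infinite_free, of S k] by auto

lemma strict_mono_free_enum: "finite S \<Longrightarrow> strict_mono (free_enum S)"
  unfolding free_enum_def[abs_def] by (rule strict_mono_enumerate[OF infinite_free])

lemma free_below_eq: "{y \<in> - insert 0 (S::nat set). y < x} = {y. 0 < y \<and> y \<notin> S \<and> y < x}"
  by auto

lemma card_less_free_enum: "finite S \<Longrightarrow> card {y. 0 < y \<and> y \<notin> S \<and> y < free_enum S k} = k"
  using card_less_enumerate[OF infinite_free, of S k] unfolding free_enum_def free_below_eq .

lemma free_enum_card_less:
  "finite S \<Longrightarrow> 0 < x \<Longrightarrow> x \<notin> S \<Longrightarrow> free_enum S (card {y. 0 < y \<and> y \<notin> S \<and> y < x}) = x"
  using enumerate_card_less[OF infinite_free, of S x] unfolding free_enum_def free_below_eq by simp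

text \<open>The sites left free by \<open>S\<close> form a copy of the positive integers, and
  occupying \<open>Z\<close> in the copy occupies its image in the original. The shift
  \<open>z - 1\<close> turns a positive integer into an index of the enumeration, which starts at
  0.\<close>

lemma free_enum_free_enum:
  assumes "finite S" "finite Z" "0 \<notin> Z"
  shows "free_enum (S \<union> (\<lambda>z. free_enum S (z - 1)) ` Z) g = free_enum S (free_enum Z g - 1)"
proof -
  define f where "f = free_enum S"
  define P where "P = (\<lambda>z. z - 1) ` Z"
  have f: "strict_mono f" unfolding f_def by (rule strict_mono_free_enum[OF assms(1)])
  have inj: "inj f" using f by (rule strict_mono_imp_inj_on)
  have rng: "range f = - insert 0 S" unfolding f_def free_enum_def[abs_def]
    by (rule range_enumerate[OF infinite_free[OF assms(1)]])
  have infP: "infinite (- P)" unfolding P_def using assms(2)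
    by (metis finite_compl finite_imageI infinite_UNIV_nat)
  have "- insert 0 (S \<union> f ` P) = range f - f ` P" unfolding rng by auto
  also have "\<dots> = f ` (- P)" using inj by (auto simp: inj_def)
  finally have 1: "- insert 0 (S \<union> f ` P) = f ` (- P)" .
  have 2: "- insert 0 Z = Suc ` (- P)"
  proof (intro set_eqI iffI)
    fix x assume "x \<in> - insert 0 Z"
    then obtain y where y: "x = Suc y" "Suc y \<notin> Z" by (cases x) auto
    have "y \<notin> P"
    proof
      assume "y \<in> P"
      then obtain z where "z \<in> Z" "y = z - 1" unfolding P_def by auto
      moreover then have "z \<noteq> 0" using assms(3) by metis
      ultimately show False using y(2) by simp
    qed
    then show "x \<in> Suc ` (- P)" using y(1) by simp
  next
    fix x assume "x \<in> Suc ` (- P)"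
    then obtain y where "x = Suc y" "y \<notin> P" by auto
    then show "x \<in> - insert 0 Z" unfolding P_def by (force simp: image_iff)
  qed
  have "free_enum Z g = Suc (enumerate (- P) g)"
    unfolding free_enum_def 2 by (rule enumerate_image[OF _ infP]) (auto simp: strict_mono_def)
  moreover have "free_enum (S \<union> f ` P) g = f (enumerate (- P) g)"
    unfolding free_enum_def 1 by (rule enumerate_image[OF f infP])
  moreover have "f ` P = (\<lambda>z. free_enum S (z - 1)) ` Z" by (auto simp: P_def f_def)
  ultimately show ?thesis by (simp add: f_def)
qed

primrec Ipmf :: "real \<Rightarrow> nat \<Rightarrow> nat list pmf" where
  "Ipmf q 0 = return_pmf []"
| "Ipmf q (Suc n) = bind_pmf (Ipmf q n)
     (\<lambda>xs. map_pmf (\<lambda>g. xs @ [free_enum (set xs) g]) (geometric_pmf (1 - q)))"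

lemma set_Ipmf: "xs \<in> set_pmf (Ipmf q n) \<Longrightarrow> length xs = n \<and> distinct xs \<and> 0 \<notin> set xs"
proof (induction n arbitrary: xs)
  case (Suc n)
  then obtain ys g where ys: "ys \<in> set_pmf (Ipmf q n)" "xs = ys @ [free_enum (set ys) g]" by auto
  then show ?case using Suc.IH[OF ys(1)] free_enum_in[of "set ys" g] by auto
qed simp

definition lift_free :: "nat list \<Rightarrow> nat list \<Rightarrow> nat list" where
  "lift_free xs zs = map (\<lambda>z. free_enum (set xs) (z - 1)) zs"

text \<open>Renewal of the greedy choice: by \<open>free_enum_free_enum\<close> the continuation
  after \<open>n\<close> steps is an independent fresh sequence, transported to the sites that are
  still free. The variance estimate takes its independence from here.\<close>

lemma Ipmf_add:
  "Ipmf q (n + m) = map_pmf (\<lambda>(xs, zs). xs @ lift_free xs zs) (pair_pmf (Ipmf q n) (Ipmf q m))"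
proof (induction m)
  case 0
  show ?case by (simp add: pair_return_pmf2 map_pmf_comp lift_free_def)
next
  case (Suc m)
  let ?G = "geometric_pmf (1 - q)"
  have "Ipmf q (n + Suc m) = bind_pmf (Ipmf q n) (\<lambda>xs. bind_pmf (Ipmf q m) (\<lambda>zs. bind_pmf ?G
      (\<lambda>g. return_pmf (xs @ lift_free xs zs @ [free_enum (set (xs @ lift_free xs zs)) g]))))"
    by (simp add: Suc.IH pair_pmf_def map_pmf_def bind_assoc_pmf bind_return_pmf)
  also have "\<dots> = bind_pmf (Ipmf q n) (\<lambda>xs. bind_pmf (Ipmf q m) (\<lambda>zs. bind_pmf ?G
      (\<lambda>g. return_pmf (xs @ lift_free xs (zs @ [free_enum (set zs) g])))))"
  proof (intro bind_pmf_cong refl)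
    fix xs zs g assume "zs \<in> set_pmf (Ipmf q m)"
    then have "0 \<notin> set zs" using set_Ipmf by blast
    then show "return_pmf (xs @ lift_free xs zs @ [free_enum (set (xs @ lift_free xs zs)) g]) =
        return_pmf (xs @ lift_free xs (zs @ [free_enum (set zs) g]))"
      using free_enum_free_enum[of "set xs" "set zs" g] by (simp add: lift_free_def)
  qed
  also have "\<dots> = map_pmf (\<lambda>(xs, zs). xs @ lift_free xs zs) (pair_pmf (Ipmf q n) (Ipmf q (Suc m)))"
    by (simp add: pair_pmf_def map_pmf_def bind_assoc_pmf bind_return_pmf)
  finally show ?case .
qed

text \<open>The total number of zeros inspected by the greedy choice of \<^term>\<open>xs\<close>.\<close>
definition cost :: "nat list \<Rightarrow> nat" where
  "cost xs = (\<Sum>k<length xs. card {y. 0 < y \<and> y \<notin> set (take k xs) \<and> y < xs ! k})"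

lemma cost_snoc: "cost (xs @ [x]) = cost xs + card {y. 0 < y \<and> y \<notin> set xs \<and> y < x}"
  by (auto simp: cost_def nth_append intro!: sum.cong)

text \<open>A word determines how many free sites are skipped at each step, because
  \<open>free_enum\<close> is injective, so its probability is one product of geometric
  weights.\<close>

lemma pmf_Ipmf:
  assumes "0 \<le> q" "q < 1"
  shows "distinct xs \<Longrightarrow> 0 \<notin> set xs \<Longrightarrow> pmf (Ipmf q (length xs)) xs = (1 - q) ^ length xs * q ^ cost xs"
proof (induction xs rule: rev_induct)
  case Nil
  then show ?case by (simp add: cost_def)
next
  case (snoc x xs)
  let ?G = "geometric_pmf (1 - q)"
  let ?g = "card {y. 0 < y \<and> y \<notin> set xs \<and> y < x}"
  have x: "free_enum (set xs) ?g = x" using snoc by (intro free_enum_card_less) auto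
  have "pmf (Ipmf q (length (xs @ [x]))) (xs @ [x]) =
    (\<integral>ys. pmf (map_pmf (\<lambda>g. ys @ [free_enum (set ys) g]) ?G) (xs @ [x]) \<partial>Ipmf q (length xs))"
    by (simp add: pmf_bind)
  also have "\<dots> = (\<Sum>ys\<in>{xs}. pmf (map_pmf (\<lambda>g. ys @ [free_enum (set ys) g]) ?G) (xs @ [x]) * pmf (Ipmf q (length xs)) ys)"
    by (rule integral_measure_pmf_real) (auto simp: pmf_eq_0_set_pmf)
  finally have 1: "pmf (Ipmf q (length (xs @ [x]))) (xs @ [x]) =
    pmf (map_pmf (\<lambda>g. xs @ [free_enum (set xs) g]) ?G) (xs @ [x]) * pmf (Ipmf q (length xs)) xs" by simp
  have "pmf (map_pmf (\<lambda>g. xs @ [free_enum (set xs) g]) ?G) (xs @ [free_enum (set xs) ?g]) = pmf ?G ?g"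
    by (rule pmf_map_inj') (use strict_mono_free_enum[of "set xs"] in \<open>auto simp: inj_def strict_mono_eq\<close>)
  then show ?case using snoc assms x unfolding 1 by (simp add: cost_snoc power_add)
qed

text \<open>Domination on singletons gives domination on every set and on its complement; as both
  masses are one, equality is forced. A lower bound for cylinders is therefore enough to identify
  the law of \<open>Ilist\<close>.\<close>

lemma measure_pmf_eqI_ge:
  fixes N :: "'a::countable measure"
  assumes "prob_space N" "sets N = UNIV" and ge: "\<And>x. pmf p x \<le> measure N {x}"
  shows "N = measure_pmf p"
proof -
  interpret prob_space N by fact
  have le: "emeasure p A \<le> emeasure N A" for A
  proof -
    have "emeasure p A = (\<integral>\<^sup>+x. emeasure p {x} \<partial>count_space A)"
      by (rule emeasure_countable_singleton) auto
    also have "\<dots> \<le> (\<integral>\<^sup>+x. emeasure N {x} \<partial>count_space A)"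
      by (intro nn_integral_mono) (auto simp: emeasure_pmf_single emeasure_eq_measure ge)
    also have "\<dots> = emeasure N A"
      by (rule emeasure_countable_singleton[symmetric]) (use assms(2) in auto)
    finally show ?thesis .
  qed
  have le': "measure p A \<le> measure N A" for A
    using le[of A] by (simp add: emeasure_eq_measure measure_pmf.emeasure_eq_measure)
  show ?thesis
  proof (rule measure_eqI)
    fix A assume "A \<in> sets N"
    have sp: "space N = UNIV" using assms(2) sets_eq_imp_space_eq[of N "count_space UNIV"] by simp
    have "measure N (- A) = 1 - measure N A" "measure p (- A) = 1 - measure p A"
      using prob_compl[of A] measure_pmf.prob_compl[of A p] assms(2) sp by (auto simp: Compl_eq_Diff_UNIV)
    then have "measure N A = measure p A" using le'[of A] le'[of "- A"] by linarith
    then show "emeasure N A = emeasure p A" by (simp add: emeasure_eq_measure measure_pmf.emeasure_eq_measure)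
  qed (use assms in simp)
qed

lemma prob_space_bern_field: "prob_space (bern_field q)"
  unfolding bern_field_def by (intro prob_space_PiM measure_pmf.prob_space_axioms)

lemma space_bern_field [simp]: "space (bern_field q) = UNIV"
  by (simp add: bern_field_def space_PiM)

lemma measurable_bern_component [measurable]: "(\<lambda>B. B c) \<in> bern_field q \<rightarrow>\<^sub>M count_space UNIV"
proof -
  have "(\<lambda>B. B c) \<in> bern_field q \<rightarrow>\<^sub>M measure_pmf (bernoulli_pmf (1 - q))"
    unfolding bern_field_def by (rule measurable_component_singleton) simp
  then show ?thesis by (simp cong: measurable_cong_sets)
qed

lemma measurable_Ilist [measurable]: "(\<lambda>B. Ilist B n) \<in> bern_field q \<rightarrow>\<^sub>M count_space UNIV"
proof (induction n)
  case (Suc n)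
  note [measurable] = Suc
  have [measurable]: "(\<lambda>B. LEAST j. 1 \<le> j \<and> j \<notin> set (Ilist B n) \<and> B (Suc n, j)) \<in> bern_field q \<rightarrow>\<^sub>M count_space UNIV"
    by measurable
  have "(\<lambda>B. xs @ [LEAST j. 1 \<le> j \<and> j \<notin> set (Ilist B n) \<and> B (Suc n, j)]) \<in> bern_field q \<rightarrow>\<^sub>M count_space UNIV" for xs
    by (rule measurable_compose[of _ _ _ "\<lambda>y. xs @ [y]"]) measurable
  from measurable_compose_countable[OF this Suc] show ?case by simp
qed simp

lemma Ilist_cylinder:
  assumes "distinct xs" "0 \<notin> set xs"
    and B: "\<And>k j. k < length xs \<Longrightarrow> 0 < j \<Longrightarrow> j \<notin> set (take k xs) \<Longrightarrow> j \<le> xs ! k \<Longrightarrow> B (Suc k, j) \<longleftrightarrow> j = xs ! k"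
  shows "k \<le> length xs \<Longrightarrow> Ilist B k = take k xs"
proof (induction k)
  case (Suc k)
  have k: "k < length xs" using Suc by simp
  have pos: "0 < xs ! k" using k assms(2) by (metis gr0I nth_mem)
  have nin: "xs ! k \<notin> set (take k xs)"
    using k assms(1) by (auto simp: in_set_conv_nth nth_eq_iff_index_eq)
  have "(LEAST j. 1 \<le> j \<and> j \<notin> set (take k xs) \<and> B (Suc k, j)) = xs ! k"
  proof (rule Least_equality)
    show "1 \<le> xs ! k \<and> xs ! k \<notin> set (take k xs) \<and> B (Suc k, xs ! k)" using pos nin B[OF k pos nin] by auto
    show "xs ! k \<le> j" if "1 \<le> j \<and> j \<notin> set (take k xs) \<and> B (Suc k, j)" for j
      using B[OF k, of j] that by (cases "j \<le> xs ! k") auto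
  qed
  then show ?case using Suc k by (simp add: take_Suc_conv_app_nth)
qed simp

text \<open>The cylinder of inspected entries is contained in the event and has exactly the stated
  probability; \<open>cost xs\<close> counts its failures.\<close>

lemma measure_Ilist_ge:
  assumes q: "0 \<le> q" "q < 1" and xs: "distinct xs" "0 \<notin> set xs"
  shows "(1 - q) ^ length xs * q ^ cost xs \<le> measure (bern_field q) {B. Ilist B (length xs) = xs}"
proof -
  interpret prob_space "bern_field q" by (rule prob_space_bern_field)
  interpret P: product_prob_space "\<lambda>_. measure_pmf (bernoulli_pmf (1 - q))" "UNIV :: (nat \<times> nat) set"
    by unfold_locales
  define D where "D k = {y. 0 < y \<and> y \<notin> set (take k xs) \<and> y \<le> xs ! k}" for k
  \<comment> \<open>The inspected coordinates. Rows are numbered from 1 and positions in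
    \<open>xs\<close> from 0, hence \<open>Suc\<close> and \<open>i - 1\<close>.\<close>
  define J where "J = (SIGMA i:Suc ` {..<length xs}. D (i - 1))"
  define A where "A = (\<lambda>(i, j). {j = xs ! (i - 1)})"
  have finD: "finite (D k)" for k unfolding D_def by (rule finite_subset[of _ "{..xs ! k}"]) auto
  have finJ: "finite J" unfolding J_def using finD by auto
  let ?C = "prod_emb UNIV (\<lambda>_. measure_pmf (bernoulli_pmf (1 - q))) J (Pi\<^sub>E J A)"
  have C: "?C = {B. \<forall>c\<in>J. B c \<in> A c}"
    by (simp add: prod_emb_def vimage_def restrict_PiE_iff Pi_def Ball_def)
  have m: "measure (bern_field q) ?C = (\<Prod>c\<in>J. measure (bernoulli_pmf (1 - q)) (A c))"
    unfolding bern_field_def by (rule P.measure_PiM_emb) (use finJ in auto)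
  also have "\<dots> = (\<Prod>i\<in>Suc ` {..<length xs}. \<Prod>j\<in>D (i - 1). if j = xs ! (i - 1) then 1 - q else q)"
  proof -
    have "(\<Prod>c\<in>J. measure (bernoulli_pmf (1 - q)) (A c)) = (\<Prod>(i, j)\<in>J. if j = xs ! (i - 1) then 1 - q else q)"
      using q by (intro prod.cong) (auto simp: A_def measure_pmf_single)
    then show ?thesis unfolding J_def using finD by (subst prod.Sigma) auto
  qed
  also have "\<dots> = (\<Prod>k<length xs. \<Prod>j\<in>D k. if j = xs ! k then 1 - q else q)"
    by (subst prod.reindex) auto
  also have "\<dots> = (\<Prod>k<length xs. (1 - q) * q ^ card {y. 0 < y \<and> y \<notin> set (take k xs) \<and> y < xs ! k})"
  proof (rule prod.cong[OF refl])
    fix k assume k: "k \<in> {..<length xs}"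
    have pos: "0 < xs ! k" using k xs(2) by (metis gr0I nth_mem lessThan_iff)
    have nin: "xs ! k \<notin> set (take k xs)"
      using k xs(1) by (auto simp: in_set_conv_nth nth_eq_iff_index_eq)
    have D: "D k = insert (xs ! k) {y. 0 < y \<and> y \<notin> set (take k xs) \<and> y < xs ! k}" (is "_ = insert _ ?L")
      using pos nin by (auto simp: D_def)
    have "finite ?L" by (rule finite_subset[of _ "{..xs ! k}"]) auto
    then have "(\<Prod>j\<in>D k. if j = xs ! k then 1 - q else q) = (1 - q) * (\<Prod>j\<in>?L. if j = xs ! k then 1 - q else q)"
      unfolding D by (subst prod.insert) auto
    also have "(\<Prod>j\<in>?L. if j = xs ! k then 1 - q else q) = (\<Prod>j\<in>?L. q)" by (rule prod.cong) auto
    finally show "(\<Prod>j\<in>D k. if j = xs ! k then 1 - q else q) = (1 - q) * q ^ card ?L" by simp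
  qed
  also have "\<dots> = (1 - q) ^ length xs * q ^ cost xs"
    by (simp add: prod.distrib power_sum cost_def)
  finally have "measure (bern_field q) ?C = (1 - q) ^ length xs * q ^ cost xs" .
  moreover have "?C \<subseteq> {B. Ilist B (length xs) = xs}"
  proof
    fix B assume "B \<in> ?C"
    then have B: "\<forall>c\<in>J. B c \<in> A c" unfolding C by simp
    have "Ilist B (length xs) = take (length xs) xs"
    proof (rule Ilist_cylinder[OF xs])
      fix k j assume "k < length xs" "0 < j" "j \<notin> set (take k xs)" "j \<le> xs ! k"
      then have "(Suc k, j) \<in> J" by (auto simp: J_def D_def)
      with B show "B (Suc k, j) \<longleftrightarrow> j = xs ! k" by (auto simp: A_def)
    qed simp
    then show "B \<in> {B. Ilist B (length xs) = xs}" by simp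
  qed
  moreover have "{B. Ilist B (length xs) = xs} \<in> sets (bern_field q)"
  proof -
    have "(\<lambda>B. Ilist B (length xs)) -` {xs} \<inter> space (bern_field q) \<in> sets (bern_field q)"
      by (rule measurable_sets[OF measurable_Ilist]) simp
    then show ?thesis by (simp add: vimage_def)
  qed
  ultimately show ?thesis using finite_measure_mono by metis
qed

lemma distr_Ilist:
  assumes q: "0 \<le> q" "q < 1"
  shows "distr (bern_field q) (count_space UNIV) (\<lambda>B. Ilist B n) = measure_pmf (Ipmf q n)"
proof (rule measure_pmf_eqI_ge)
  interpret prob_space "bern_field q" by (rule prob_space_bern_field)
  show "prob_space (distr (bern_field q) (count_space UNIV) (\<lambda>B. Ilist B n))"
    by (rule prob_space_distr) measurable
  fix xs
  show "pmf (Ipmf q n) xs \<le> measure (distr (bern_field q) (count_space UNIV) (\<lambda>B. Ilist B n)) {xs}"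
  proof (cases "xs \<in> set_pmf (Ipmf q n)")
    case True
    then have xs: "length xs = n" "distinct xs" "0 \<notin> set xs" using set_Ipmf by blast+
    then show ?thesis using measure_Ilist_ge[OF q xs(2,3)] pmf_Ipmf[OF q xs(2,3)]
      by (subst measure_distr) (auto simp: vimage_def)
  next
    case False
    then have "pmf (Ipmf q n) xs = 0" by (simp add: set_pmf_iff)
    then show ?thesis by simp
  qed
qed simp

lemma AE_Ilist:
  assumes "0 \<le> q" "q < 1"
  shows "AE B in bern_field q. \<forall>n. length (Ilist B n) = n \<and> distinct (Ilist B n) \<and> 0 \<notin> set (Ilist B n)"
proof (subst AE_all_countable, rule allI)
  fix n
  have "AE xs in distr (bern_field q) (count_space UNIV) (\<lambda>B. Ilist B n). length xs = n \<and> distinct xs \<and> 0 \<notin> set xs"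
    unfolding distr_Ilist[OF assms] by (auto simp: AE_measure_pmf_iff dest: set_Ipmf)
  then show "AE B in bern_field q. length (Ilist B n) = n \<and> distinct (Ilist B n) \<and> 0 \<notin> set (Ilist B n)"
    by (subst (asm) AE_distr_iff) auto
qed

section \<open>Concentration\<close>

definition holes :: "nat list \<Rightarrow> nat" where
  "holes xs = card {y. 0 < y \<and> y \<notin> set xs \<and> (\<exists>x\<in>set xs. y < x)}"

lemma finite_holes: "finite {y. 0 < y \<and> y \<notin> set xs \<and> (\<exists>x\<in>set xs. y < (x::nat))}"
  by (rule finite_subset[of _ "\<Union>x\<in>set xs. {..<x}"]) auto

text \<open>A value below the current maximum fills a hole. A new maximum leaves as holes only free
  values below itself, and there are \<open>g\<close> of them.\<close>

lemma holes_snoc: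
  "holes (xs @ [free_enum (set xs) g]) \<le> g \<or> Suc (holes (xs @ [free_enum (set xs) g])) \<le> holes xs"
proof -
  let ?x = "free_enum (set xs) g"
  let ?H = "{y. 0 < y \<and> y \<notin> set (xs @ [?x]) \<and> (\<exists>x\<in>set (xs @ [?x]). y < x)}"
  let ?Old = "{y. 0 < y \<and> y \<notin> set xs \<and> (\<exists>x\<in>set xs. y < x)}"
  show ?thesis
  proof (cases "\<exists>z\<in>set xs. ?x < z")
    case True
    then have "insert ?x ?H \<subseteq> ?Old" using free_enum_in[of "set xs" g] by (auto intro: less_trans)
    then have "card (insert ?x ?H) \<le> card ?Old" by (rule card_mono[OF finite_holes])
    moreover have "card (insert ?x ?H) = Suc (card ?H)"
      by (rule card_insert_disjoint[OF finite_holes[of "xs @ [?x]"]]) simp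
    ultimately show ?thesis unfolding holes_def by simp
  next
    case False
    then have "?H \<subseteq> {y. 0 < y \<and> y \<notin> set xs \<and> y < ?x}" by force
    then have "card ?H \<le> card {y. 0 < y \<and> y \<notin> set xs \<and> y < ?x}"
      by (rule card_mono[rotated]) (rule finite_subset[of _ "{..<?x}"], auto)
    then show ?thesis unfolding holes_def by (simp add: card_less_free_enum)
  qed
qed

lemma nn_integral_geometric_power:
  assumes "0 \<le> q" "q < 1" "0 \<le> t" "t * q < 1"
  shows "(\<integral>\<^sup>+g. ennreal (t ^ g) \<partial>geometric_pmf (1 - q)) = ennreal ((1 - q) / (1 - t * q))"
proof -
  have p: "0 < 1 - q" "1 - q \<le> 1" using assms by auto
  have "(\<integral>\<^sup>+g. ennreal (t ^ g) \<partial>geometric_pmf (1 - q)) = (\<Sum>g. ennreal ((1 - q) * (t * q) ^ g))"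
    unfolding nn_integral_measure_pmf nn_integral_count_space_nat
  proof (rule suminf_cong)
    fix g
    have "pmf (geometric_pmf (1 - q)) g * t ^ g = (1 - q) * (t * q) ^ g"
      using p by (simp add: power_mult_distrib)
    then show "ennreal (pmf (geometric_pmf (1 - q)) g) * ennreal (t ^ g) = ennreal ((1 - q) * (t * q) ^ g)"
      using assms(3) by (simp only: ennreal_mult[symmetric] pmf_nonneg zero_le_power)
  qed
  also have "(\<lambda>g. (1 - q) * (t * q) ^ g) sums ((1 - q) * (1 / (1 - t * q)))"
    using assms by (intro sums_mult geometric_sums) (auto simp: abs_mult)
  then have "(\<Sum>g. ennreal ((1 - q) * (t * q) ^ g)) = ennreal ((1 - q) * (1 / (1 - t * q)))"
    using assms by (intro suminf_ennreal_eq) auto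
  finally show ?thesis by simp
qed

text \<open>By \<open>holes_snoc\<close> the number of holes drops by one or is replaced by at most
  a geometric number, so the exponential moment obeys \<open>m' <= m / t + c\<close>. The bound is a
  supersolution of this recursion that also dominates the initial value 1.\<close>

lemma nn_integral_power_holes:
  assumes q: "0 \<le> q" "q < 1" and t: "1 < t" "t * q < 1"
  shows "(\<integral>\<^sup>+xs. ennreal (t ^ holes xs) \<partial>Ipmf q n) \<le> ennreal (((1 - q) / (1 - t * q) + 1) * (t / (t - 1)))"
proof (induction n)
  define c where "c = (1 - q) / (1 - t * q)"
  have c: "0 \<le> c" using assms by (auto simp: c_def)
  define A where "A = (c + 1) * (t / (t - 1))"
  have tt: "1 \<le> t / (t - 1)" using t by (simp add: field_simps)
  have A1: "1 \<le> A" unfolding A_def using mult_mono[of 1 "c + 1" 1 "t / (t - 1)"] c tt by simp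
  have A2: "A / t + c \<le> A"
  proof -
    have "A / t = (c + 1) / (t - 1)" using t by (simp add: A_def)
    moreover have "A = (c + 1) + (c + 1) / (t - 1)" using t unfolding A_def by (simp add: field_simps)
    ultimately show ?thesis by simp
  qed
  {
    case 0
    then show ?case using A1 unfolding A_def c_def by (simp add: holes_def)
  next
    case (Suc n)
    have "(\<integral>\<^sup>+xs. ennreal (t ^ holes xs) \<partial>Ipmf q (Suc n)) =
      (\<integral>\<^sup>+xs. \<integral>\<^sup>+g. ennreal (t ^ holes (xs @ [free_enum (set xs) g])) \<partial>geometric_pmf (1 - q) \<partial>Ipmf q n)"
      by simp
    also have "\<dots> \<le> (\<integral>\<^sup>+xs. \<integral>\<^sup>+g. ennreal (t ^ holes xs) * ennreal (1 / t) + ennreal (t ^ g) \<partial>geometric_pmf (1 - q) \<partial>Ipmf q n)"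
    proof (intro nn_integral_mono)
      fix xs g
      let ?h = "holes (xs @ [free_enum (set xs) g])"
      have "t ^ ?h \<le> t ^ holes xs * (1 / t) + t ^ g"
        using holes_snoc[of xs g]
      proof
        assume "?h \<le> g"
        then have "t ^ ?h \<le> t ^ g" using t by (intro power_increasing) auto
        then show ?thesis using t by (simp add: add_increasing)
      next
        assume "Suc ?h \<le> holes xs"
        then have "t ^ Suc ?h \<le> t ^ holes xs" using t by (intro power_increasing) auto
        then have "t ^ ?h \<le> t ^ holes xs * (1 / t)" using t by (simp add: field_simps)
        then show ?thesis using t by (simp add: add_increasing2)
      qed
      then show "ennreal (t ^ ?h) \<le> ennreal (t ^ holes xs) * ennreal (1 / t) + ennreal (t ^ g)"
        using t by (simp add: ennreal_mult[symmetric] ennreal_plus[symmetric] ennreal_leI del: ennreal_plus)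
    qed
    also have "\<dots> = (\<integral>\<^sup>+xs. ennreal (t ^ holes xs) \<partial>Ipmf q n) * ennreal (1 / t) + ennreal c"
      using nn_integral_geometric_power[OF q _ t(2)] t
      by (simp add: nn_integral_add nn_integral_multc c_def measure_pmf.emeasure_space_1)
    also have "\<dots> \<le> ennreal A * ennreal (1 / t) + ennreal c"
      using Suc unfolding A_def c_def by (intro add_right_mono mult_right_mono) auto
    also have "\<dots> = ennreal (A / t + c)"
      using t A1 c by (simp add: ennreal_mult[symmetric] ennreal_plus[symmetric] del: ennreal_plus)
    also have "\<dots> \<le> ennreal A" using A2 by (rule ennreal_leI)
    finally show ?case unfolding A_def c_def .
  }
qed

lemma holes_second_moment:
  assumes q: "0 \<le> q" "q < 1"
  obtains D where "0 \<le> D" "\<And>n. (\<integral>\<^sup>+xs. ennreal ((1 + real (holes xs))\<^sup>2) \<partial>Ipmf q n) \<le> ennreal D"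
proof -
  \<comment> \<open>The geometric moment is finite for \<open>t * q < 1\<close>, and the recursion
    contracts for \<open>t > 1\<close>. This choice meets both conditions, including at
    \<open>q = 0\<close>.\<close>
  define t where "t = 2 / (1 + q)"
  have t: "1 < t" "t * q < 1" using q by (auto simp: t_def field_simps)
  define s where "s = sqrt t"
  have s: "1 < s" "s\<^sup>2 = t" using t by (auto simp: s_def)
  define d where "d = min 1 (s - 1)"
  have d: "0 < d" "d \<le> 1" "d \<le> s - 1" using s by (auto simp: d_def)
  define A where "A = ((1 - q) / (1 - t * q) + 1) * (t / (t - 1))"
  have A: "0 \<le> A" using t q by (auto simp: A_def intro!: mult_nonneg_nonneg add_nonneg_nonneg)
  \<comment> \<open>Bernoulli's inequality bounds \<open>s ^ k\<close> below by a multiple of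
    \<open>1 + k\<close>; squaring returns to \<open>t ^ k\<close>.\<close>
  have bound: "(1 + real k)\<^sup>2 \<le> (1 / d\<^sup>2) * t ^ k" for k
  proof -
    have "d * (1 + real k) \<le> 1 + real k * (s - 1)"
      using d mult_mono[of d 1 1 1] mult_left_mono[of d "s - 1" "real k"] by (simp add: algebra_simps)
    also have "\<dots> \<le> s ^ k" using Bernoulli_inequality[of "s - 1" k] s by simp
    finally have "(d * (1 + real k))\<^sup>2 \<le> (s ^ k)\<^sup>2" using d by (intro power_mono) auto
    also have "(s ^ k)\<^sup>2 = t ^ k" using s(2) by (metis power_mult mult.commute)
    finally have "d\<^sup>2 * (1 + real k)\<^sup>2 \<le> t ^ k" by (simp only: power_mult_distrib)
    then show ?thesis using d(1) by (simp add: pos_le_divide_eq mult.commute)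
  qed
  show ?thesis
  proof (rule that[of "(1 / d\<^sup>2) * A"])
    fix n
    have "(\<integral>\<^sup>+xs. ennreal ((1 + real (holes xs))\<^sup>2) \<partial>Ipmf q n) \<le> (\<integral>\<^sup>+xs. ennreal (1 / d\<^sup>2) * ennreal (t ^ holes xs) \<partial>Ipmf q n)"
      using bound t by (intro nn_integral_mono) (simp add: ennreal_mult[symmetric] ennreal_leI)
    also have "\<dots> = ennreal (1 / d\<^sup>2) * (\<integral>\<^sup>+xs. ennreal (t ^ holes xs) \<partial>Ipmf q n)"
      by (rule nn_integral_cmult) simp
    also have "\<dots> \<le> ennreal (1 / d\<^sup>2) * ennreal A"
      using nn_integral_power_holes[OF q t, of n] unfolding A_def by (intro mult_left_mono) auto
    also have "\<dots> = ennreal ((1 / d\<^sup>2) * A)" using A by (simp add: ennreal_mult[symmetric])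
    finally show "(\<integral>\<^sup>+xs. ennreal ((1 + real (holes xs))\<^sup>2) \<partial>Ipmf q n) \<le> ennreal ((1 / d\<^sup>2) * A)" .
  qed (use A in auto)
qed

section \<open>The variance of the ball count\<close>

definition bst_count :: "nat \<Rightarrow> 'h set \<times> ('h \<times> 'h) set \<times> 'h \<Rightarrow> 'a::linorder list \<Rightarrow> real" where
  "bst_count r H xs = real (iso_count r H (bst xs))"

lemma bst_count_bounds:
  assumes "distinct xs" shows "0 \<le> bst_count r H xs" "bst_count r H xs \<le> real (length xs)"
proof -
  have "iso_count r H (bst xs) \<le> card (bst xs)"
    unfolding iso_count_def by (rule card_mono[OF finite_bst]) auto
  then show "bst_count r H xs \<le> real (length xs)" using card_bst[OF assms] by (simp add: bst_count_def)
qed (simp add: bst_count_def)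

lemma bst_count_add:
  assumes xs: "xs \<in> set_pmf (Ipmf q n)" and zs: "zs \<in> set_pmf (Ipmf q m)"
  shows "\<bar>bst_count r H (xs @ lift_free xs zs) - bst_count r H xs - bst_count r H zs\<bar>
    \<le> real_of_int (4 * cut_const r + 2) * (1 + real (holes xs))"
proof -
  have v: "distinct xs" "0 \<notin> set xs" "distinct zs" "0 \<notin> set zs" using xs zs set_Ipmf by blast+
  let ?f = "\<lambda>z. free_enum (set xs) (z - 1)"
  have sm: "strict_mono_on (set zs) ?f"
  proof (rule strict_mono_onI)
    fix a b assume "a \<in> set zs" "b \<in> set zs" "a < b"
    moreover then have "a \<noteq> 0" using v(4) by metis
    ultimately have "a - 1 < b - 1" by simp
    then show "?f a < ?f b" using strict_mono_free_enum[of "set xs"] by (simp add: strict_mono_less)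
  qed
  have l: "bst (lift_free xs zs) = bst zs" unfolding lift_free_def by (rule bst_map_strict_mono[OF sm])
  have dl: "distinct (lift_free xs zs)"
    unfolding lift_free_def using v(3) strict_mono_on_imp_inj_on[OF sm] by (simp add: distinct_map)
  have d: "distinct (xs @ lift_free xs zs)"
    using v(1) dl free_enum_in[of "set xs"] by (auto simp: lift_free_def)
  have c: "0 \<le> 4 * cut_const r + 2" using cut_const_nonneg[of r] by simp
  show ?thesis
  proof (cases "xs = []")
    case True
    then have "bst_count r H (xs @ lift_free xs zs) - bst_count r H xs - bst_count r H zs = 0"
      using l by (simp add: bst_count_def iso_count_def)
    then show ?thesis using c by (auto intro!: mult_nonneg_nonneg)
  next
    case False
    let ?L = "filter (\<lambda>y. y < Max (set xs)) (lift_free xs zs)"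
    have "length ?L = card (set ?L)" using dl by (intro distinct_card[symmetric] distinct_filter)
    also have "\<dots> \<le> holes xs" unfolding holes_def
    proof (rule card_mono[OF finite_holes], rule subsetI)
      fix y assume y: "y \<in> set ?L"
      then have "0 < y" "y \<notin> set xs" using free_enum_in[of "set xs"] by (auto simp: lift_free_def)
      moreover have "Max (set xs) \<in> set xs" using False by (intro Max_in) auto
      ultimately show "y \<in> {y. 0 < y \<and> y \<notin> set xs \<and> (\<exists>x\<in>set xs. y < x)}" using y by auto
    qed
    finally have len: "int (length ?L) \<le> int (holes xs)" by simp
    have "\<bar>int (iso_count r H (bst (xs @ lift_free xs zs))) - int (iso_count r H (bst xs)) - int (iso_count r H (bst zs))\<bar>
       \<le> (4 * cut_const r + 2) * (1 + int (holes xs))"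
      using order_trans[OF iso_count_bst_append[OF False d, of r H] mult_left_mono[OF _ c]] len unfolding l by simp
    then have "real_of_int \<bar>int (iso_count r H (bst (xs @ lift_free xs zs))) - int (iso_count r H (bst xs)) - int (iso_count r H (bst zs))\<bar>
       \<le> real_of_int ((4 * cut_const r + 2) * (1 + int (holes xs)))" by (simp only: of_int_le_iff)
    then show ?thesis unfolding bst_count_def by simp
  qed
qed

definition count_mean :: "real \<Rightarrow> nat \<Rightarrow> 'h set \<times> ('h \<times> 'h) set \<times> 'h \<Rightarrow> nat \<Rightarrow> real" where
  "count_mean q r H n = (\<integral>xs. bst_count r H xs \<partial>Ipmf q n)"

definition count_var :: "real \<Rightarrow> nat \<Rightarrow> 'h set \<times> ('h \<times> 'h) set \<times> 'h \<Rightarrow> nat \<Rightarrow> real" where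
  "count_var q r H n = (\<integral>xs. (bst_count r H xs - count_mean q r H n)\<^sup>2 \<partial>Ipmf q n)"

lemma integrable_bst_count:
  "integrable (Ipmf q n) (bst_count r H)" "integrable (Ipmf q n) (\<lambda>xs. (bst_count r H xs - c)\<^sup>2)"
proof -
  show "integrable (Ipmf q n) (bst_count r H)"
    by (rule measure_pmf.integrable_const_bound[of _ "real n"])
       (auto simp: AE_measure_pmf_iff dest!: set_Ipmf intro!: bst_count_bounds simp: bst_count_bounds(1) abs_of_nonneg)
  show "integrable (Ipmf q n) (\<lambda>xs. (bst_count r H xs - c)\<^sup>2)"
  proof (rule measure_pmf.integrable_const_bound[of _ "(real n + \<bar>c\<bar>)\<^sup>2"])
    show "AE xs in Ipmf q n. norm ((bst_count r H xs - c)\<^sup>2) \<le> (real n + \<bar>c\<bar>)\<^sup>2"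
    proof (unfold AE_measure_pmf_iff, rule ballI)
      fix xs assume "xs \<in> set_pmf (Ipmf q n)"
      then have "0 \<le> bst_count r H xs" "bst_count r H xs \<le> real n" using set_Ipmf bst_count_bounds by blast+
      then have "\<bar>bst_count r H xs - c\<bar> \<le> real n + \<bar>c\<bar>" by linarith
      then show "norm ((bst_count r H xs - c)\<^sup>2) \<le> (real n + \<bar>c\<bar>)\<^sup>2"
        by (simp add: abs_le_square_iff[symmetric])
    qed
  qed simp
qed

text \<open>Variance plus squared bias. Dropping the bias allows a concatenation to be centred at
  the sum of the two means instead of its own mean.\<close>

lemma count_shift:
  "(\<integral>xs. (bst_count r H xs - c)\<^sup>2 \<partial>Ipmf q n) = count_var q r H n + (count_mean q r H n - c)\<^sup>2"
proof -
  define m where "m = count_mean q r H n"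
  have "(\<integral>xs. (bst_count r H xs - c)\<^sup>2 \<partial>Ipmf q n) =
    (\<integral>xs. (bst_count r H xs - m)\<^sup>2 + ((2 * (m - c)) * bst_count r H xs + ((m - c)\<^sup>2 - 2 * (m - c) * m)) \<partial>Ipmf q n)"
    by (rule Bochner_Integration.integral_cong) (auto simp: power2_eq_square algebra_simps)
  also have "\<dots> = count_var q r H n + (2 * (m - c) * m + ((m - c)\<^sup>2 - 2 * (m - c) * m))"
    unfolding count_var_def m_def[symmetric]
    by (subst Bochner_Integration.integral_add)
       (auto simp: integrable_bst_count m_def count_mean_def)
  finally show ?thesis unfolding m_def by simp
qed

lemma count_var_nonneg: "0 \<le> count_var q r H n"
  unfolding count_var_def by (intro integral_nonneg_AE) simp

text \<open>The two words are independent, so the squared sum of their centred counts integrates to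
  the sum of the variances. The gluing error contributes through the second moment \<open>D\<close>
  of the holes.\<close>

lemma count_var_add:
  assumes D: "0 \<le> D" "\<And>n. (\<integral>\<^sup>+xs. ennreal ((1 + real (holes xs))\<^sup>2) \<partial>Ipmf q n) \<le> ennreal D"
  shows "count_var q r H (n + m) \<le> 11/10 * (count_var q r H n + count_var q r H m)
    + 11 * (real_of_int (4 * cut_const r + 2))\<^sup>2 * D"
proof -
  define C where "C = real_of_int (4 * cut_const r + 2)"
  define F where "F = (bst_count r H :: nat list \<Rightarrow> real)"
  define a where "a = count_mean q r H n"
  define b where "b = count_mean q r H m"
  define Vn where "Vn = count_var q r H n"
  define Vm where "Vm = count_var q r H m"
  have V0: "0 \<le> Vn" "0 \<le> Vm" by (simp_all add: Vn_def Vm_def count_var_nonneg)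
  \<comment> \<open>For fixed \<open>xs\<close> the term \<open>F xs - a\<close> only shifts the
    centre for \<open>zs\<close>, so \<open>count_shift\<close> yields a variance plus a square and
    no cross term survives.\<close>
  have inner: "(\<integral>\<^sup>+zs. ennreal (11/10 * ((F xs - a) + (F zs - b))\<^sup>2 + e) \<partial>Ipmf q m) = ennreal (11/10 * ((F xs - a)\<^sup>2 + Vm) + e)"
    if "0 \<le> e" for xs e
  proof -
    have eq: "(F xs - a) + (F zs - b) = F zs - (b - (F xs - a))" for zs by simp
    have int: "integrable (Ipmf q m) (\<lambda>zs. ((F xs - a) + (F zs - b))\<^sup>2)"
      unfolding eq unfolding F_def by (rule integrable_bst_count)
    have "(\<integral>zs. ((F xs - a) + (F zs - b))\<^sup>2 \<partial>Ipmf q m) = Vm + (F xs - a)\<^sup>2"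
      unfolding eq unfolding F_def count_shift Vm_def b_def by simp
    then have "(\<integral>zs. 11/10 * ((F xs - a) + (F zs - b))\<^sup>2 + e \<partial>Ipmf q m) = 11/10 * ((F xs - a)\<^sup>2 + Vm) + e"
      using int by (subst Bochner_Integration.integral_add) auto
    then show ?thesis using int that by (subst nn_integral_eq_integral) auto
  qed
  have "ennreal (count_var q r H (n + m)) \<le> ennreal (\<integral>xs. (F xs - (a + b))\<^sup>2 \<partial>Ipmf q (n + m))"
    unfolding F_def count_shift by (intro ennreal_leI) simp
  also have "\<dots> = (\<integral>\<^sup>+xs. ennreal ((F xs - (a + b))\<^sup>2) \<partial>Ipmf q (n + m))"
    unfolding F_def by (rule nn_integral_eq_integral[symmetric]) (auto simp: integrable_bst_count)
  also have "\<dots> = (\<integral>\<^sup>+xs. \<integral>\<^sup>+zs. ennreal ((F (xs @ lift_free xs zs) - (a + b))\<^sup>2) \<partial>Ipmf q m \<partial>Ipmf q n)"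
    by (simp add: Ipmf_add nn_integral_pair_pmf')
  also have "\<dots> \<le> (\<integral>\<^sup>+xs. \<integral>\<^sup>+zs. ennreal (11/10 * ((F xs - a) + (F zs - b))\<^sup>2 + 11 * (C * (1 + real (holes xs)))\<^sup>2) \<partial>Ipmf q m \<partial>Ipmf q n)"
  proof (rule nn_integral_mono_AE, unfold AE_measure_pmf_iff, rule ballI, rule nn_integral_mono_AE,
      unfold AE_measure_pmf_iff, rule ballI)
    fix xs zs assume xz: "xs \<in> set_pmf (Ipmf q n)" "zs \<in> set_pmf (Ipmf q m)"
    define u where "u = (F xs - a) + (F zs - b)"
    define e where "e = F (xs @ lift_free xs zs) - F xs - F zs"
    have e: "\<bar>e\<bar> \<le> C * (1 + real (holes xs))"
      unfolding e_def F_def C_def by (rule bst_count_add[OF xz])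
    then have e2: "e\<^sup>2 \<le> (C * (1 + real (holes xs)))\<^sup>2" by (rule power2_le_iff_abs_le[THEN iffD2, rotated]) (use e in linarith)
    \<comment> \<open>This is \<open>2 u e <= u^2 / 10 + 10 e^2\<close>. The weight 10 keeps the
      loss in the main term at 11/10, which the growth lemma can afford.\<close>
    have "0 \<le> (u - 10 * e)\<^sup>2" by simp
    then have "(u + e)\<^sup>2 \<le> 11/10 * u\<^sup>2 + 11 * e\<^sup>2" by (simp add: power2_eq_square algebra_simps)
    also have "u + e = F (xs @ lift_free xs zs) - (a + b)" by (simp add: u_def e_def)
    finally show "ennreal ((F (xs @ lift_free xs zs) - (a + b))\<^sup>2) \<le>
      ennreal (11/10 * ((F xs - a) + (F zs - b))\<^sup>2 + 11 * (C * (1 + real (holes xs)))\<^sup>2)"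
      using e2 unfolding u_def by (intro ennreal_leI) linarith
  qed
  also have "\<dots> = (\<integral>\<^sup>+xs. ennreal (11/10 * ((F xs - a)\<^sup>2 + Vm) + 11 * (C * (1 + real (holes xs)))\<^sup>2) \<partial>Ipmf q n)"
    by (subst inner) auto
  also have "\<dots> = (\<integral>\<^sup>+xs. ennreal (11/10 * ((F xs - a)\<^sup>2 + Vm)) + ennreal (11 * C\<^sup>2) * ennreal ((1 + real (holes xs))\<^sup>2) \<partial>Ipmf q n)"
    using V0 by (intro nn_integral_cong) (simp add: ennreal_mult[symmetric] ennreal_plus[symmetric] power_mult_distrib mult_ac del: ennreal_plus)
  also have "\<dots> = (\<integral>\<^sup>+xs. ennreal (11/10 * ((F xs - a)\<^sup>2 + Vm)) \<partial>Ipmf q n) + ennreal (11 * C\<^sup>2) * (\<integral>\<^sup>+xs. ennreal ((1 + real (holes xs))\<^sup>2) \<partial>Ipmf q n)"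
    by (simp add: nn_integral_add nn_integral_cmult)
  also have "\<dots> \<le> ennreal (11/10 * (Vn + Vm)) + ennreal (11 * C\<^sup>2) * ennreal D"
  proof (intro add_mono mult_left_mono D)
    have int: "integrable (Ipmf q n) (\<lambda>xs. (F xs - a)\<^sup>2)" unfolding F_def by (rule integrable_bst_count)
    have "(\<integral>\<^sup>+xs. ennreal (11/10 * ((F xs - a)\<^sup>2 + Vm)) \<partial>Ipmf q n) = ennreal (\<integral>xs. 11/10 * ((F xs - a)\<^sup>2 + Vm) \<partial>Ipmf q n)"
      using int V0 by (intro nn_integral_eq_integral) auto
    also have "(\<integral>xs. 11/10 * ((F xs - a)\<^sup>2 + Vm) \<partial>Ipmf q n) = 11/10 * (Vn + Vm)"
      using int by (simp add: Vn_def count_var_def F_def a_def)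
    finally show "(\<integral>\<^sup>+xs. ennreal (11/10 * ((F xs - a)\<^sup>2 + Vm)) \<partial>Ipmf q n) \<le> ennreal (11/10 * (Vn + Vm))" by simp
  qed simp
  also have "\<dots> = ennreal (11/10 * (Vn + Vm) + 11 * C\<^sup>2 * D)"
    using V0 D(1) by (simp add: ennreal_mult[symmetric] ennreal_plus[symmetric] del: ennreal_plus)
  finally show ?thesis
    using V0 D(1) unfolding Vn_def Vm_def C_def by (subst (asm) ennreal_le_iff) auto
qed

text \<open>Strong induction by halving: for \<open>n >= 2\<close> the larger half satisfies
  \<open>3 * b <= 2 * n\<close>, so the factor \<open>sqrt (real b)\<close> gains
  \<open>sqrt (2/3)\<close> against the loss 11/10.\<close>

lemma nearly_subadditive_growth:
  fixes V :: "nat \<Rightarrow> real"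
  assumes V0: "V 0 = 0" and V: "\<And>n m. V (n + m) \<le> 11/10 * (V n + V m) + D"
  shows "V n \<le> (\<bar>V 1\<bar> + 10 * \<bar>D\<bar>) * (real n * sqrt (real n))"
proof (induction n rule: less_induct)
  case (less n)
  define K where "K = \<bar>V 1\<bar> + 10 * \<bar>D\<bar>"
  have K: "0 \<le> K" "V 1 \<le> K" "D \<le> K / 10" by (auto simp: K_def)
  consider "n = 0" | "n = 1" | "2 \<le> n" by linarith
  then show ?case unfolding K_def[symmetric]
  proof cases
    case 3
    define a where "a = n div 2"
    define b where "b = n - a"
    have ab: "a + b = n" "a \<le> b" "a < n" "b < n" "3 * b \<le> 2 * n" using 3 by (auto simp: a_def b_def)
    have "V n \<le> 11/10 * (V a + V b) + D" using V[of a b] ab by simp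
    also have "\<dots> \<le> 11/10 * (K * (real a * sqrt (real a)) + K * (real b * sqrt (real b))) + D"
      using less.IH[OF ab(3)] less.IH[OF ab(4)] unfolding K_def by simp
    also have "\<dots> \<le> 11/10 * (K * (real a * sqrt (real b)) + K * (real b * sqrt (real b))) + D"
      using K ab by (auto intro!: mult_left_mono)
    also have "\<dots> = 11/10 * K * real n * sqrt (real b) + D"
      using ab(1) by (simp flip: ab(1) add: algebra_simps)
    \<comment> \<open>The square of 9/11 lies just above 2/3, so the two factors multiply to 9/10.
      The remaining tenth absorbs \<open>D\<close>, which is why \<open>K\<close> contains ten times
      the modulus of \<open>D\<close>.\<close>
    also have "\<dots> \<le> 11/10 * K * real n * (9/11 * sqrt (real n)) + D"
    proof -
      have "sqrt (real b) \<le> sqrt ((9/11)\<^sup>2 * real n)" 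
        using ab(5) by (intro real_sqrt_le_mono) (simp add: power2_eq_square)
      also have "\<dots> = 9/11 * sqrt (real n)" by (simp add: real_sqrt_mult)
      finally have "sqrt (real b) \<le> 9/11 * sqrt (real n)" .
      then show ?thesis using mult_left_mono[of "sqrt (real b)" "9/11 * sqrt (real n)" "11/10 * K * real n"] K by simp
    qed
    also have "\<dots> \<le> 9/10 * (K * (real n * sqrt (real n))) + K / 10 * (real n * sqrt (real n))"
    proof -
      have "1 \<le> real n * sqrt (real n)" using 3 mult_mono[of 1 "real n" 1 "sqrt (real n)"] by simp
      then have "K / 10 \<le> K / 10 * (real n * sqrt (real n))" using K mult_left_mono[of 1 _ "K / 10"] by simp
      then show ?thesis using K(3) by simp
    qed
    finally show "V n \<le> K * (real n * sqrt (real n))" by simp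
  qed (use V0 K in auto)
qed

lemma count_var_growth:
  assumes q: "0 \<le> q" "q < 1"
  obtains K where "0 \<le> K" "\<And>n. count_var q r H n \<le> K * (real n * sqrt (real n))"
proof -
  obtain D where D: "0 \<le> D" "\<And>n. (\<integral>\<^sup>+xs. ennreal ((1 + real (holes xs))\<^sup>2) \<partial>Ipmf q n) \<le> ennreal D"
    using holes_second_moment[OF q] by blast
  define D' where "D' = 11 * (real_of_int (4 * cut_const r + 2))\<^sup>2 * D"
  have "count_var q r H 0 = 0" by (simp add: count_var_def count_mean_def)
  from nearly_subadditive_growth[of "count_var q r H" D', OF this]
  show ?thesis using count_var_add[OF D, of r H] that[of "\<bar>count_var q r H 1\<bar> + 10 * \<bar>D'\<bar>"]
    unfolding D'_def by simp
qed

section \<open>From the variance bound to almost sure convergence\<close>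

lemma bern_integral_Ilist:
  fixes g :: "nat list \<Rightarrow> real"
  assumes "0 \<le> q" "q < 1"
  shows "(\<integral>B. g (Ilist B n) \<partial>bern_field q) = (\<integral>xs. g xs \<partial>Ipmf q n)"
  unfolding distr_Ilist[OF assms, symmetric] by (rule integral_distr[symmetric]) auto

lemma bern_integrable_Ilist:
  fixes g :: "nat list \<Rightarrow> real"
  assumes "0 \<le> q" "q < 1" "integrable (Ipmf q n) g"
  shows "integrable (bern_field q) (\<lambda>B. g (Ilist B n))"
  using assms(3) unfolding distr_Ilist[OF assms(1,2), symmetric] by (subst (asm) integrable_distr_eq) auto

lemma floor_fourth_root: "\<exists>k. k ^ 4 \<le> n \<and> n < (Suc k) ^ 4"
proof (induction n)
  case 0
  then show ?case by (intro exI[of _ 0]) simp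
next
  case (Suc n)
  then obtain k where k: "k ^ 4 \<le> n" "n < (Suc k) ^ 4" by auto
  show ?case
  proof (cases "Suc n < (Suc k) ^ 4")
    case True
    then show ?thesis using k by (intro exI[of _ k]) simp
  next
    case False
    then have "Suc n = (Suc k) ^ 4" using k by simp
    moreover have "(Suc k) ^ 4 < (Suc (Suc k)) ^ 4" by (rule power_strict_mono) auto
    ultimately show ?thesis by (intro exI[of _ "Suc k"]) simp
  qed
qed

lemma lipschitz_abs_diff_le:
  fixes x :: "nat \<Rightarrow> real"
  assumes "\<And>n. \<bar>x (Suc n) - x n\<bar> \<le> L"
  shows "\<bar>x (n + d) - x n\<bar> \<le> L * real d"
proof (induction d)
  case (Suc d)
  then show ?case using assms[of "n + d"] by (simp add: algebra_simps)
qed simp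

text \<open>Between consecutive fourth powers \<open>x\<close> moves by at most \<open>L\<close>
  times their gap. The gap is of smaller order than the powers themselves, since
  \<open>(1 + 1 / k) ^ 4\<close> tends to 1.\<close>

lemma tendsto_zero_interpolate:
  fixes x :: "nat \<Rightarrow> real"
  assumes L: "\<And>n. \<bar>x (Suc n) - x n\<bar> \<le> L"
    and lim: "(\<lambda>k. x (k ^ 4) / real (k ^ 4)) \<longlonglongrightarrow> 0"
  shows "(\<lambda>n. x n / real n) \<longlonglongrightarrow> 0"
proof (rule LIMSEQ_I)
  fix e :: real assume e: "0 < e"
  have L0: "0 \<le> L" using L[of 0] by linarith
  have "(\<lambda>k. \<bar>x (k ^ 4) / real (k ^ 4)\<bar> + L * ((1 + 1 / real k) ^ 4 - 1)) \<longlonglongrightarrow> \<bar>0\<bar> + L * ((1 + 0) ^ 4 - 1)"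
    by (intro tendsto_intros lim lim_1_over_n tendsto_rabs)
  then have "eventually (\<lambda>k. \<bar>x (k ^ 4) / real (k ^ 4)\<bar> + L * ((1 + 1 / real k) ^ 4 - 1) < e) sequentially"
    using e by (intro order_tendstoD(2)) auto
  then obtain k0 where k0: "\<And>k. k \<ge> k0 \<Longrightarrow> \<bar>x (k ^ 4) / real (k ^ 4)\<bar> + L * ((1 + 1 / real k) ^ 4 - 1) < e"
    unfolding eventually_sequentially by auto
  show "\<exists>N. \<forall>n\<ge>N. norm (x n / real n - 0) < e"
  proof (intro exI allI impI)
    fix n assume n: "(Suc k0) ^ 4 \<le> n"
    obtain k where k: "k ^ 4 \<le> n" "n < (Suc k) ^ 4" using floor_fourth_root by blast
    have "(Suc k0) ^ 4 < (Suc k) ^ 4" using n k by simp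
    then have "Suc k0 < Suc k" by (rule power_less_imp_less_base) simp
    then have kk: "k0 < k" by simp
    then have kpos: "0 < real k" by simp
    have np: "0 < real n" using k kk by (metis gr0I le_zero_eq not_less_zero of_nat_0_less_iff power_eq_0_iff)
    have nk: "real (k ^ 4) \<le> real n" using k(1) by (rule of_nat_mono)
    have k4: "0 < real (k ^ 4)" using kpos by simp
    have d: "\<bar>x n - x (k ^ 4)\<bar> \<le> L * real (n - k ^ 4)"
      using lipschitz_abs_diff_le[of x, OF L, of "k ^ 4" "n - k ^ 4"] k by simp
    have "real (n - k ^ 4) \<le> real (Suc k ^ 4) - real (k ^ 4)" using k by linarith
    also have "\<dots> = real (k ^ 4) * ((1 + 1 / real k) ^ 4 - 1)"
    proof -
      have "real (k ^ 4) * (1 + 1 / real k) ^ 4 = (real k * (1 + 1 / real k)) ^ 4"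
        by (simp add: power_mult_distrib)
      also have "real k * (1 + 1 / real k) = real (Suc k)" using kpos by (simp add: field_simps)
      finally show ?thesis by (simp add: right_diff_distrib)
    qed
    finally have d2: "L * real (n - k ^ 4) \<le> L * (real (k ^ 4) * ((1 + 1 / real k) ^ 4 - 1))"
      using L0 by (rule mult_left_mono)
    have "\<bar>x n / real n\<bar> \<le> \<bar>x n\<bar> / real (k ^ 4)"
      using nk k4 np by (simp add: abs_divide frac_le)
    also have "\<dots> \<le> (\<bar>x (k ^ 4)\<bar> + L * (real (k ^ 4) * ((1 + 1 / real k) ^ 4 - 1))) / real (k ^ 4)"
      using d d2 k4 by (intro divide_right_mono) linarith+
    also have "\<dots> = \<bar>x (k ^ 4) / real (k ^ 4)\<bar> + L * ((1 + 1 / real k) ^ 4 - 1)"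
      using k4 by (simp add: add_divide_distrib)
    also have "\<dots> < e" using k0[of k] kk by simp
    finally show "norm (x n / real n - 0) < e" by simp
  qed
qed

text \<open>At \<open>n = k ^ 4\<close> the Chebyshev bound is a multiple of
  \<open>sqrt n / n\<close>, that is of \<open>1 / k^2\<close>, which is summable. Appending one
  entry changes the count by a bounded amount, hence also its mean; this is the Lipschitz condition
  of the interpolation.\<close>

lemma AE_bst_count_centered:
  assumes q: "0 \<le> q" "q < 1"
  shows "AE B in bern_field q. (\<lambda>n. (bst_count r H (Ilist B n) - count_mean q r H n) / real n) \<longlonglongrightarrow> 0"
proof -
  interpret prob_space "bern_field q" by (rule prob_space_bern_field)
  define F where "F n B = bst_count r H (Ilist B n)" for n B
  define \<mu> where "\<mu> n = count_mean q r H n" for n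
  obtain K where K: "0 \<le> K" "\<And>n. count_var q r H n \<le> K * (real n * sqrt (real n))"
    using count_var_growth[OF q, of r H] by blast
  have intF: "integrable (bern_field q) (F n)" for n
    unfolding F_def[abs_def] by (rule bern_integrable_Ilist[OF q integrable_bst_count(1)])
  have measF [measurable]: "F n \<in> borel_measurable (bern_field q)" for n
    using intF by (rule borel_measurable_integrable)
  have eF: "expectation (F n) = \<mu> n" for n
    unfolding F_def \<mu>_def count_mean_def by (rule bern_integral_Ilist[OF q])
  have vF: "variance (F n) = count_var q r H n" for n
    unfolding eF unfolding F_def \<mu>_def count_var_def by (rule bern_integral_Ilist[OF q])
  have sqF: "integrable (bern_field q) (\<lambda>B. (F n B)\<^sup>2)" for n
    using bern_integrable_Ilist[OF q integrable_bst_count(2)[where c=0 and r=r and H=H and n=n]] unfolding F_def by simp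
  define c where "c = real_of_int (cut_const r + 1)"
  have step: "\<bar>F (Suc n) B - F n B\<bar> \<le> c" if "\<forall>n. distinct (Ilist B n)" for n B
  proof -
    have "\<exists>x. Ilist B (Suc n) = Ilist B n @ [x] \<and> x \<notin> set (Ilist B n)"
      using that[rule_format, of "Suc n"] by simp
    then obtain x where x: "Ilist B (Suc n) = Ilist B n @ [x]" "x \<notin> set (Ilist B n)" by blast
    have "real_of_int \<bar>int (iso_count r H (bst (Ilist B n @ [x]))) - int (iso_count r H (bst (Ilist B n)))\<bar> \<le> c"
      unfolding c_def of_int_le_iff by (rule iso_count_bst_snoc[OF x(2)])
    then show ?thesis unfolding F_def bst_count_def x(1) by simp
  qed
  have AEd: "AE B in bern_field q. \<forall>n. distinct (Ilist B n)"
    using AE_Ilist[OF q] by eventually_elim auto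
  have step\<mu>: "\<bar>\<mu> (Suc n) - \<mu> n\<bar> \<le> c" for n
  proof -
    have "\<mu> (Suc n) - \<mu> n = expectation (\<lambda>B. F (Suc n) B - F n B)"
      unfolding eF[symmetric] by (rule Bochner_Integration.integral_diff[symmetric]) (rule intF)+
    also have "\<bar>\<dots>\<bar> \<le> expectation (\<lambda>B. \<bar>F (Suc n) B - F n B\<bar>)"
      by (rule integral_abs_bound)
    also have "\<dots> \<le> expectation (\<lambda>B. c)"
    proof (rule integral_mono_AE)
      show "AE B in bern_field q. \<bar>F (Suc n) B - F n B\<bar> \<le> c" using AEd by eventually_elim (rule step)
    qed (use intF in auto)
    finally show ?thesis using prob_space by simp
  qed
  have AEk: "AE B in bern_field q. eventually (\<lambda>k. \<bar>F (k ^ 4) B - \<mu> (k ^ 4)\<bar> < inverse (real (Suc j)) * real (k ^ 4)) sequentially"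
    for j :: nat
  proof -
    let ?e = "inverse (real (Suc j))"
    \<comment> \<open>Indexed by \<open>Suc k\<close> so that no event sits at \<open>n = 0\<close>,
      where the threshold would vanish.\<close>
    define A where "A k = {B \<in> space (bern_field q). ?e * real (Suc k ^ 4) \<le> \<bar>F (Suc k ^ 4) B - expectation (F (Suc k ^ 4))\<bar>}" for k
    have A: "A k \<in> sets (bern_field q)" for k unfolding A_def by measurable
    have bd: "prob (A k) \<le> K / ?e\<^sup>2 * (inverse ((real (Suc k))\<^sup>2))" for k
    proof -
      have s: "sqrt (real (Suc k ^ 4)) = (real (Suc k))\<^sup>2"
        by (rule real_sqrt_unique) (auto simp: power_mult[symmetric])
      have n0: "0 < real (Suc k ^ 4)" by simp
      have "prob (A k) \<le> variance (F (Suc k ^ 4)) / (?e * real (Suc k ^ 4))\<^sup>2"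
        unfolding A_def by (rule Chebyshev_inequality[OF measF sqF]) simp
      also have "\<dots> \<le> (K * (real (Suc k ^ 4) * sqrt (real (Suc k ^ 4)))) / (?e * real (Suc k ^ 4))\<^sup>2"
        unfolding vF by (intro divide_right_mono K) simp
      also have "\<dots> = K / ?e\<^sup>2 * (sqrt (real (Suc k ^ 4)) / real (Suc k ^ 4))"
        using n0 by (simp only: power_mult_distrib power2_eq_square) (simp add: field_simps)
      also have "sqrt (real (Suc k ^ 4)) / real (Suc k ^ 4) = inverse ((real (Suc k))\<^sup>2)"
      proof -
        have "real (Suc k ^ 4) = (real (Suc k))\<^sup>2 * (real (Suc k))\<^sup>2" by (simp add: power_add[symmetric])
        then show ?thesis unfolding s by (simp add: field_simps)
      qed
      finally show ?thesis .
    qed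
    have "summable (\<lambda>k. prob (A k))"
    proof (rule summable_comparison_test')
      have "summable (\<lambda>n. inverse ((real n)\<^sup>2))" using inverse_power_summable[of 2, where 'a=real] by simp
      then have "summable (\<lambda>k. inverse ((real (Suc k))\<^sup>2))" by (subst summable_Suc_iff)
      then show "summable (\<lambda>k. K / ?e\<^sup>2 * (inverse ((real (Suc k))\<^sup>2)))" by (rule summable_mult)
      show "norm (prob (A k)) \<le> K / ?e\<^sup>2 * (inverse ((real (Suc k))\<^sup>2))" if "0 \<le> k" for k using bd[of k] by simp
    qed
    from borel_cantelli_AE1[OF A _ this]
    have "AE B in bern_field q. eventually (\<lambda>k. B \<in> space (bern_field q) - A k) sequentially"
      by (simp add: emeasure_eq_measure)
    then show ?thesis
    proof eventually_elim
      case (elim B)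
      then have "eventually (\<lambda>k. \<bar>F (Suc k ^ 4) B - \<mu> (Suc k ^ 4)\<bar> < ?e * real (Suc k ^ 4)) sequentially"
        by eventually_elim (auto simp: A_def eF not_le)
      then show ?case by (subst (asm) eventually_sequentially_Suc)
    qed
  qed
  then have "AE B in bern_field q. \<forall>j. eventually (\<lambda>k. \<bar>F (k ^ 4) B - \<mu> (k ^ 4)\<bar> < inverse (real (Suc j)) * real (k ^ 4)) sequentially"
    by (subst AE_all_countable) auto
  with AEd show ?thesis
  proof eventually_elim
    case (elim B)
    have lim: "(\<lambda>k. (F (k ^ 4) B - \<mu> (k ^ 4)) / real (k ^ 4)) \<longlonglongrightarrow> 0"
    proof (rule tendstoI)
      fix e :: real assume "0 < e"
      then obtain j where j: "inverse (real (Suc j)) < e" using reals_Archimedean by blast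
      have "eventually (\<lambda>k. \<bar>F (k ^ 4) B - \<mu> (k ^ 4)\<bar> < inverse (real (Suc j)) * real (k ^ 4)) sequentially"
        using elim(2) by blast
      then show "eventually (\<lambda>k. dist ((F (k ^ 4) B - \<mu> (k ^ 4)) / real (k ^ 4)) 0 < e) sequentially"
        using eventually_gt_at_top[of 0]
      proof eventually_elim
        case (elim k)
        then have "0 < real (k ^ 4)" by simp
        then have "\<bar>F (k ^ 4) B - \<mu> (k ^ 4)\<bar> / real (k ^ 4) < inverse (real (Suc j))"
          using elim(1) by (simp only: pos_divide_less_eq)
        then show ?case using j by (simp add: dist_real_def abs_divide)
      qed
    qed
    have "(\<lambda>n. (F n B - \<mu> n) / real n) \<longlonglongrightarrow> 0"
    proof (rule tendsto_zero_interpolate[OF _ lim])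
      show "\<bar>F (Suc n) B - \<mu> (Suc n) - (F n B - \<mu> n)\<bar> \<le> 2 * c" for n
        using step[OF elim(1), of n] step\<mu>[of n] by linarith
    qed
    then show ?case unfolding F_def \<mu>_def .
  qed
qed

section \<open>Relative order and inversions\<close>

fun inv_count :: "'a::linorder list \<Rightarrow> nat" where
  "inv_count [] = 0"
| "inv_count (x # xs) = length (filter (\<lambda>y. y < x) xs) + inv_count xs"

definition pattern :: "'a::linorder list \<Rightarrow> nat list" where
  "pattern xs = map (\<lambda>x. card {y \<in> set xs. y \<le> x}) xs"

lemma Pi_list_pattern: "Pi_list B n = pattern (Ilist B n)"
  by (simp add: Pi_list_def pattern_def)

lemma length_pattern [simp]: "length (pattern xs) = length xs"
  by (simp add: pattern_def)

lemma inv_count_map: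
  fixes f :: "'a::linorder \<Rightarrow> 'b::linorder"
  shows "strict_mono_on (set xs) f \<Longrightarrow> inv_count (map f xs) = inv_count xs"
proof (induction xs)
  case (Cons x xs)
  have "filter (\<lambda>y. f y < f x) xs = filter (\<lambda>y. y < x) xs"
    using Cons.prems by (intro filter_cong) (auto simp: strict_mono_on_less)
  moreover have "strict_mono_on (set xs) f" using Cons.prems by (auto simp: strict_mono_on_def)
  ultimately show ?case using Cons.IH by (simp add: filter_map o_def)
qed simp

lemma inv_count_snoc: "inv_count (xs @ [x]) = inv_count xs + length (filter (\<lambda>y. x < y) xs)"
  by (induction xs) auto

text \<open>Reversing positions and values at once keeps inversions inversions. This symmetry makes
  the reflected half of the two-sided sequence comparable with \<open>Ilist\<close>.\<close>

lemma inv_count_rev_map: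
  fixes f :: "'a::linorder \<Rightarrow> 'b::linorder"
  assumes "\<And>x y. x \<in> set xs \<Longrightarrow> y \<in> set xs \<Longrightarrow> f x < f y \<longleftrightarrow> y < x"
  shows "inv_count (rev (map f xs)) = inv_count xs"
  using assms
proof (induction xs)
  case (Cons x xs)
  have "length (filter (\<lambda>y. f x < y) (rev (map f xs))) = length (filter (\<lambda>y. f x < f y) xs)"
    by (simp add: rev_map[symmetric] filter_map o_def rev_filter[symmetric])
  also have "filter (\<lambda>y. f x < f y) xs = filter (\<lambda>y. y < x) xs"
    using Cons.prems by (intro filter_cong) auto
  finally show ?case using Cons by (simp add: inv_count_snoc)
qed simp

lemma inv_count_sorted: "sorted xs \<Longrightarrow> inv_count xs = 0"
  by (induction xs) (auto simp: filter_empty_conv)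

lemma strict_mono_on_rank:
  "finite A \<Longrightarrow> strict_mono_on A (\<lambda>x::'a::linorder. card {y \<in> A. y \<le> x})"
  by (rule strict_mono_onI, rule psubset_card_mono) (auto simp: psubset_eq set_eq_iff not_le[symmetric] intro: order_trans less_imp_le)

lemma inv_count_pattern [simp]: "inv_count (pattern xs) = inv_count xs"
  unfolding pattern_def by (rule inv_count_map[OF strict_mono_on_rank]) simp

lemma bst_pattern [simp]: "bst (pattern xs) = bst xs"
  unfolding pattern_def by (rule bst_map_strict_mono[OF strict_mono_on_rank]) simp

lemma distinct_pattern: "distinct xs \<Longrightarrow> distinct (pattern xs)"
  unfolding pattern_def
  using strict_mono_on_imp_inj_on[OF strict_mono_on_rank[of "set xs"]] by (simp add: distinct_map)

lemma set_pattern: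
  assumes "distinct xs" shows "set (pattern xs) = {1..length xs}"
proof (rule card_subset_eq)
  show "set (pattern xs) \<subseteq> {1..length xs}"
  proof
    fix k assume "k \<in> set (pattern xs)"
    then obtain x where x: "x \<in> set xs" "k = card {y \<in> set xs. y \<le> x}" by (auto simp: pattern_def)
    have "card {x} \<le> k" unfolding x(2) by (rule card_mono) (use x in auto)
    moreover have "k \<le> card (set xs)" unfolding x(2) by (rule card_mono) auto
    ultimately show "k \<in> {1..length xs}" using assms by (simp add: distinct_card)
  qed
  show "card (set (pattern xs)) = card {1..length xs}"
    using distinct_card[OF distinct_pattern[OF assms]] by simp
qed simp

lemma pattern_map:
  fixes f :: "'a::linorder \<Rightarrow> 'b::linorder"
  assumes "strict_mono_on (set xs) f"
  shows "pattern (map f xs) = pattern xs"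
proof -
  have "card {y \<in> f ` set xs. y \<le> f x} = card {y \<in> set xs. y \<le> x}" if "x \<in> set xs" for x
  proof -
    have "{y \<in> f ` set xs. y \<le> f x} = f ` {y \<in> set xs. y \<le> x}"
      using assms that by (auto simp: strict_mono_on_leD strict_mono_on_less_eq)
    moreover have "inj_on f {y \<in> set xs. y \<le> x}"
      using strict_mono_on_imp_inj_on[OF assms] by (rule inj_on_subset) auto
    ultimately show ?thesis by (simp add: card_image)
  qed
  then show ?thesis by (simp add: pattern_def)
qed

lemma pattern_id:
  assumes "set p = {1..n}" shows "pattern p = p"
proof -
  have "card {y \<in> {1..n}. y \<le> x} = x" if "x \<in> {1..n}" for x
  proof -
    have "{y \<in> {1..n}. y \<le> x} = {1..x}" using that by auto
    then show ?thesis by simp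
  qed
  then show ?thesis unfolding pattern_def assms by (intro map_idI) (use assms in auto)
qed

lemma pattern_inj:
  assumes "set xs = set ys" "pattern xs = pattern ys" shows "xs = ys"
proof -
  have "inj_on (\<lambda>x. card {y \<in> set xs. y \<le> x}) (set xs \<union> set ys)"
    using strict_mono_on_imp_inj_on[OF strict_mono_on_rank[of "set xs"]] assms(1) by simp
  then have "map (\<lambda>x. card {y \<in> set xs. y \<le> x}) xs = map (\<lambda>x. card {y \<in> set xs. y \<le> x}) ys \<longleftrightarrow> xs = ys"
    by (rule inj_on_map_eq_map)
  then show ?thesis using assms unfolding pattern_def by simp
qed

lemma card_below_plus_smaller:
  assumes "distinct xs" "0 \<notin> set xs"
  shows "card {y. 0 < y \<and> y \<notin> set xs \<and> y < (x::nat)} + length (filter (\<lambda>y. y < x) xs) = x - 1"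
proof -
  have "length (filter (\<lambda>y. y < x) xs) = card (set (filter (\<lambda>y. y < x) xs))"
    using assms by (intro distinct_card[symmetric] distinct_filter)
  moreover have "card {y. 0 < y \<and> y \<notin> set xs \<and> y < x} + card (set (filter (\<lambda>y. y < x) xs)) =
     card ({y. 0 < y \<and> y \<notin> set xs \<and> y < x} \<union> set (filter (\<lambda>y. y < x) xs))"
    by (rule card_Un_disjoint[symmetric]) (auto intro: finite_subset[of _ "{..<x}"])
  moreover have "{y. 0 < y \<and> y \<notin> set xs \<and> y < x} \<union> set (filter (\<lambda>y. y < x) xs) = {1..<x}"
  proof (intro set_eqI iffI)
    fix y assume "y \<in> {y. 0 < y \<and> y \<notin> set xs \<and> y < x} \<union> set (filter (\<lambda>y. y < x) xs)"
    moreover have "y \<in> set xs \<Longrightarrow> y \<noteq> 0" using assms(2) by (cases "y = 0") auto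
    ultimately show "y \<in> {1..<x}" by auto
  qed auto
  ultimately show ?thesis by simp
qed

text \<open>Two counts at an entry \<open>x\<close> in position \<open>k\<close>: the values below
  \<open>x\<close> are free or used earlier, and the \<open>k\<close> earlier entries are smaller or
  larger than \<open>x\<close>. Eliminating the earlier smaller ones shows that \<open>cost\<close>
  minus \<open>inv_count\<close> depends only on the set of values.\<close>

lemma cost_inv_count:
  "distinct xs \<Longrightarrow> 0 \<notin> set xs \<Longrightarrow> cost xs + (\<Sum>k<length xs. k) = inv_count xs + (\<Sum>x\<leftarrow>xs. x - 1)"
proof (induction xs rule: rev_induct)
  case (snoc x xs)
  have "length xs = length (filter (\<lambda>y. x < y) xs) + length (filter (\<lambda>y. y < x) xs)"
  proof -
    have "filter (\<lambda>y. y < x) xs = filter (\<lambda>y. \<not> x < y) xs"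
      using snoc.prems(1) by (intro filter_cong) (auto simp: not_less order_less_le)
    then show ?thesis by (simp add: sum_length_filter_compl)
  qed
  moreover have "card {y. 0 < y \<and> y \<notin> set xs \<and> y < x} + length (filter (\<lambda>y. y < x) xs) = x - 1"
    using snoc.prems by (intro card_below_plus_smaller) auto
  moreover have "cost xs + (\<Sum>k<length xs. k) = inv_count xs + (\<Sum>x\<leftarrow>xs. x - 1)" using snoc by simp
  ultimately show ?case by (simp only: cost_snoc inv_count_snoc length_append_singleton sum.lessThan_Suc
      map_append sum_list_append list.map sum_list_simps)
qed (simp add: cost_def)

lemma cost_sort:
  assumes "distinct xs" "0 \<notin> set xs"
  shows "cost xs = inv_count xs + cost (sort xs)"
proof -
  have "(\<Sum>x\<leftarrow>sort xs. x - 1) = (\<Sum>x\<leftarrow>xs. x - 1)"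
    by (simp flip: sum_mset_sum_list)
  then show ?thesis
    using cost_inv_count[OF assms] cost_inv_count[of "sort xs"] assms inv_count_sorted[of "sort xs"] by simp
qed

text \<open>Words with pattern \<open>p\<close> correspond to their sorted rearrangements, and by
  \<open>cost_sort\<close> the two probabilities differ by the factor
  \<open>q ^ inv_count p\<close>. Summing over sorted words gives the Mallows law, with the
  probability of being sorted in the place of \<open>1 / Z\<close>.\<close>

lemma prob_pattern:
  assumes q: "0 \<le> q" "q < 1" and p: "distinct p" "set p = {1..n}"
  shows "measure (Ipmf q n) {xs. pattern xs = p} = q ^ inv_count p * measure (Ipmf q n) {xs. sorted xs}"
proof -
  have lp: "length p = n" using distinct_card[OF p(1)] p(2) by simp
  define V where "V = {xs::nat list. length xs = n \<and> distinct xs \<and> 0 \<notin> set xs}"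
  define A where "A = {xs \<in> V. pattern xs = p}"
  define S where "S = {xs \<in> V. sorted xs}"
  \<comment> \<open>\<open>f ys\<close> puts the values of the sorted word \<open>ys\<close> into
    the order prescribed by \<open>p\<close>, whose entries are ranks starting at 1.\<close>
  define f where "f ys = map (\<lambda>k. ys ! (k - 1)) p" for ys :: "nat list"
  have sub: "set_pmf (Ipmf q n) \<subseteq> V" using set_Ipmf unfolding V_def by blast
  have f: "f ys \<in> A \<and> sort (f ys) = ys \<and> set (f ys) = set ys" if "ys \<in> S" for ys
  proof -
    have ys: "length ys = n" "distinct ys" "0 \<notin> set ys" "sorted ys" using that by (auto simp: S_def V_def)
    have sm: "strict_mono_on (set p) (\<lambda>k. ys ! (k - 1))"
    proof (rule strict_mono_onI)
      fix a b assume "a \<in> set p" "b \<in> set p" "a < b"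
      then have "a - 1 < b - 1" "b - 1 < length ys" using p(2) ys(1) by auto
      then show "ys ! (a - 1) < ys ! (b - 1)" using ys by (simp add: sorted_wrt_nth_less strict_sorted_iff)
    qed
    have set: "set (f ys) = set ys"
    proof -
      have "set (f ys) = (\<lambda>k. ys ! (k - 1)) ` Suc ` {..<n}"
        unfolding f_def using p(2) by (simp add: image_Suc_lessThan)
      also have "\<dots> = (!) ys ` {..<n}" by (simp add: image_image)
      finally show ?thesis using ys(1) by (auto simp: set_conv_nth)
    qed
    have d: "distinct (f ys)" unfolding f_def using p(1) strict_mono_on_imp_inj_on[OF sm] by (simp add: distinct_map)
    have "pattern (f ys) = p" unfolding f_def pattern_map[OF sm] by (rule pattern_id[OF p(2)])
    moreover have "sort (f ys) = ys"
      using set d ys by (intro properties_for_sort) (auto simp: set_eq_iff_mset_eq_distinct[symmetric])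
    ultimately show ?thesis using set d ys lp by (auto simp: A_def V_def f_def)
  qed
  have bij: "bij_betw f S A"
  proof (rule bij_betw_byWitness[where f'=sort])
    show "\<forall>ys\<in>S. sort (f ys) = ys" "f ` S \<subseteq> A" using f by auto
    show "\<forall>xs\<in>A. f (sort xs) = xs"
    proof
      fix xs assume xs: "xs \<in> A"
      then have "sort xs \<in> S" by (auto simp: A_def S_def V_def)
      from f[OF this] have fs: "f (sort xs) \<in> A" "set (f (sort xs)) = set (sort xs)" by auto
      show "f (sort xs) = xs"
      proof (rule pattern_inj)
        show "set (f (sort xs)) = set xs" using fs(2) by simp
        show "pattern (f (sort xs)) = pattern xs" using fs(1) xs by (simp add: A_def)
      qed
    qed
    show "sort ` A \<subseteq> S" by (auto simp: A_def S_def V_def)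
  qed
  have w: "pmf (Ipmf q n) (f ys) = q ^ inv_count p * pmf (Ipmf q n) ys" if "ys \<in> S" for ys
  proof -
    have v: "f ys \<in> V" "ys \<in> V" using f[OF that] that by (auto simp: A_def S_def)
    have i: "inv_count (f ys) = inv_count p" using f[OF that] inv_count_pattern[of "f ys"] by (auto simp: A_def)
    show ?thesis
      using v pmf_Ipmf[OF q, of "f ys"] pmf_Ipmf[OF q, of ys] cost_sort[of "f ys"] f[OF that] i
      unfolding V_def by (simp add: power_add)
  qed
  have "measure (Ipmf q n) {xs. pattern xs = p} = measure (Ipmf q n) A"
    by (rule measure_pmf.finite_measure_eq_AE) (use sub in \<open>auto simp: AE_measure_pmf_iff A_def\<close>)
  also have "\<dots> = infsetsum (\<lambda>ys. pmf (Ipmf q n) (f ys)) S"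
    unfolding measure_pmf_conv_infsetsum by (rule infsetsum_reindex_bij_betw[OF bij, symmetric])
  also have "\<dots> = infsetsum (\<lambda>ys. q ^ inv_count p * pmf (Ipmf q n) ys) S"
    by (rule infsetsum_cong) (use w in auto)
  also have "\<dots> = q ^ inv_count p * infsetsum (pmf (Ipmf q n)) S"
    by (rule infsetsum_cmult_right) (rule pmf_abs_summable)
  also have "infsetsum (pmf (Ipmf q n)) S = measure (Ipmf q n) S" by (rule measure_pmf_conv_infsetsum[symmetric])
  also have "\<dots> = measure (Ipmf q n) {xs. sorted xs}"
    by (rule measure_pmf.finite_measure_eq_AE) (use sub in \<open>auto simp: AE_measure_pmf_iff S_def\<close>)
  finally show ?thesis .
qed

text \<open>Pairs of a \<open>True\<close> before a \<open>False\<close>. Read as a lattice path,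
  the word bounds a partition of this size.\<close>

fun area :: "bool list \<Rightarrow> nat" where
  "area [] = 0"
| "area (s # ss) = (if s then length (filter Not ss) else 0) + area ss"

text \<open>An inversion has both entries above \<open>t\<close>, both at most \<open>t\<close>, or
  an entry above \<open>t\<close> standing before one that is at most \<open>t\<close>. Every pair
  of the last kind is an inversion, and \<open>area\<close> counts these.\<close>

lemma inv_count_split:
  fixes t :: "'a::linorder"
  shows "inv_count xs = inv_count (filter (\<lambda>x. t < x) xs) + inv_count (filter (\<lambda>x. x \<le> t) xs) + area (map (\<lambda>x. t < x) xs)"
proof (induction xs)
  case (Cons x xs)
  have *: "length (filter (\<lambda>y. y < x) xs) = length (filter (\<lambda>y. y < x) (filter (\<lambda>x. t < x) xs)) + length (filter (\<lambda>x. x \<le> t) xs)"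
    if "t < x"
    using that by (induction xs) auto
  have **: "filter (\<lambda>y. y < x) (filter (\<lambda>x. x \<le> t) xs) = filter (\<lambda>y. y < x) xs" if "x \<le> t"
    using that by (auto intro!: filter_cong)
  have n: "length (filter Not (map (\<lambda>x. t < x) xs)) = length (filter (\<lambda>x. x \<le> t) xs)"
    by (simp add: filter_map o_def not_less)
  show ?case
  proof (cases "t < x")
    case True
    have "inv_count (filter (\<lambda>x. t < x) (x # xs)) = length (filter (\<lambda>y. y < x) (filter (\<lambda>x. t < x) xs)) + inv_count (filter (\<lambda>x. t < x) xs)"
      "inv_count (filter (\<lambda>x. x \<le> t) (x # xs)) = inv_count (filter (\<lambda>x. x \<le> t) xs)"
      "area (map (\<lambda>x. t < x) (x # xs)) = length (filter (\<lambda>x. x \<le> t) xs) + area (map (\<lambda>x. t < x) xs)"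
      using True n by simp_all
    then show ?thesis using Cons.IH *[OF True] unfolding inv_count.simps by linarith
  next
    case False
    then have "inv_count (filter (\<lambda>x. x \<le> t) (x # xs)) = length (filter (\<lambda>y. y < x) xs) + inv_count (filter (\<lambda>x. x \<le> t) xs)"
      "inv_count (filter (\<lambda>x. t < x) (x # xs)) = inv_count (filter (\<lambda>x. t < x) xs)"
      "area (map (\<lambda>x. t < x) (x # xs)) = area (map (\<lambda>x. t < x) xs)"
      using ** by (simp_all add: not_less)
    then show ?thesis using Cons.IH unfolding inv_count.simps by linarith
  qed
qed simp

lemma list_eq_by_split:
  assumes "map P xs = map P ys" "filter P xs = filter P ys" "filter (\<lambda>x. \<not> P x) xs = filter (\<lambda>x. \<not> P x) ys"
  shows "xs = ys"
proof -
  have "length xs = length ys" using assms(1) map_eq_imp_length_eq by blast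
  then show ?thesis using assms by (induction xs ys rule: list_induct2) (auto split: if_splits)
qed

text \<open>Ranks below the cut are unaffected by the entries above it, and ranks above it are
  raised by \<open>b\<close>. By \<open>list_eq_by_split\<close> the three parts determine the
  pattern.\<close>

lemma pattern_split:
  fixes t :: "'a::linorder"
  assumes "distinct xs"
  defines "b \<equiv> length (filter (\<lambda>x. x \<le> t) xs)"
  shows "map (\<lambda>k. b < k) (pattern xs) = map (\<lambda>x. t < x) xs"
    and "filter (\<lambda>k. b < k) (pattern xs) = map (\<lambda>k. k + b) (pattern (filter (\<lambda>x. t < x) xs))"
    and "filter (\<lambda>k. k \<le> b) (pattern xs) = pattern (filter (\<lambda>x. x \<le> t) xs)"
proof -
  have b: "b = card {y \<in> set xs. y \<le> t}"
    unfolding b_def using distinct_card[of "filter (\<lambda>x. x \<le> t) xs"] assms(1) by simp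
  let ?r = "\<lambda>x. card {y \<in> set xs. y \<le> x}"
  have hi: "?r x = card {y \<in> set xs. t < y \<and> y \<le> x} + b \<and> b < ?r x" if "x \<in> set xs" "t < x" for x
  proof -
    have "{y \<in> set xs. y \<le> x} = {y \<in> set xs. t < y \<and> y \<le> x} \<union> {y \<in> set xs. y \<le> t}"
      using that by auto
    then have "?r x = card {y \<in> set xs. t < y \<and> y \<le> x} + b"
      unfolding b by (simp only:) (rule card_Un_disjoint, auto)
    moreover have "0 < card {y \<in> set xs. t < y \<and> y \<le> x}" using that by (auto simp: card_gt_0_iff)
    ultimately show ?thesis by simp
  qed
  have lo: "?r x = card {y \<in> set xs. y \<le> t \<and> y \<le> x} \<and> ?r x \<le> b" if "x \<in> set xs" "x \<le> t" for x
  proof -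
    have "{y \<in> set xs. y \<le> x} = {y \<in> set xs. y \<le> t \<and> y \<le> x}" using that by auto
    moreover have "?r x \<le> b" unfolding b by (rule card_mono) (use that in auto)
    ultimately show ?thesis by simp
  qed
  have iff: "b < ?r x \<longleftrightarrow> t < x" if "x \<in> set xs" for x
    using hi[OF that] lo[OF that] by (cases "t < x") (auto simp: not_less)
  show "map (\<lambda>k. b < k) (pattern xs) = map (\<lambda>x. t < x) xs"
    unfolding pattern_def using iff by simp
  have "filter (\<lambda>k. b < k) (pattern xs) = map ?r (filter (\<lambda>x. t < x) xs)"
    unfolding pattern_def filter_map o_def using iff by (intro arg_cong[where f="map ?r"] filter_cong) auto
  also have "\<dots> = map (\<lambda>k. k + b) (pattern (filter (\<lambda>x. t < x) xs))"
    unfolding pattern_def using hi by (auto simp: conj_assoc)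
  finally show "filter (\<lambda>k. b < k) (pattern xs) = map (\<lambda>k. k + b) (pattern (filter (\<lambda>x. t < x) xs))" .
  have "filter (\<lambda>k. k \<le> b) (pattern xs) = map ?r (filter (\<lambda>x. x \<le> t) xs)"
    unfolding pattern_def filter_map o_def using iff by (intro arg_cong[where f="map ?r"] filter_cong) (auto simp: not_less[symmetric])
  also have "\<dots> = pattern (filter (\<lambda>x. x \<le> t) xs)"
    unfolding pattern_def using lo by (auto simp: conj_assoc)
  finally show "filter (\<lambda>k. k \<le> b) (pattern xs) = pattern (filter (\<lambda>x. x \<le> t) xs)" .
qed

lemma pattern_rev_map:
  fixes f :: "'a::linorder \<Rightarrow> 'b::linorder"
  assumes d: "distinct xs" and f: "\<And>x y. x \<in> set xs \<Longrightarrow> y \<in> set xs \<Longrightarrow> f x < f y \<longleftrightarrow> y < x"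
  shows "pattern (rev (map f xs)) = rev (map (\<lambda>k. length xs + 1 - k) (pattern xs))"
proof -
  have inj: "inj_on f (set xs)"
  proof (rule inj_onI)
    fix x y assume "x \<in> set xs" "y \<in> set xs" "f x = f y"
    then show "x = y" using f[of x y] f[of y x] by (cases x y rule: linorder_cases) auto
  qed
  have "card {y \<in> f ` set xs. y \<le> f x} = length xs + 1 - card {y \<in> set xs. y \<le> x}" if x: "x \<in> set xs" for x
  proof -
    have "{y \<in> f ` set xs. y \<le> f x} = f ` {y \<in> set xs. x \<le> y}"
      using f x by (auto simp: not_less[symmetric])
    then have "card {y \<in> f ` set xs. y \<le> f x} = card {y \<in> set xs. x \<le> y}"
      using inj by (simp add: card_image inj_on_subset)
    moreover have "card {y \<in> set xs. x \<le> y} + card {y \<in> set xs. y \<le> x} = length xs + 1"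
    proof -
      have "card ({y \<in> set xs. x \<le> y} \<union> {y \<in> set xs. y \<le> x}) + card ({y \<in> set xs. x \<le> y} \<inter> {y \<in> set xs. y \<le> x})
         = card {y \<in> set xs. x \<le> y} + card {y \<in> set xs. y \<le> x}"
        by (rule card_Un_Int[symmetric]) auto
      moreover have "{y \<in> set xs. x \<le> y} \<union> {y \<in> set xs. y \<le> x} = set xs" by auto
      moreover have "{y \<in> set xs. x \<le> y} \<inter> {y \<in> set xs. y \<le> x} = {x}" using x by auto
      ultimately show ?thesis using distinct_card[OF d] by simp
    qed
    ultimately show ?thesis by simp
  qed
  then show ?thesis by (simp add: pattern_def rev_map)
qed

section \<open>The right spine of a binary search tree\<close>

text \<open>The left-to-right maxima, written with the recursion of the right spine so that
  \<open>recs\<close> and \<open>bst\<close> unfold together.\<close>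

function recs :: "'a::linorder list \<Rightarrow> 'a list" where
  "recs [] = []"
| "recs (x # xs) = x # recs (filter (\<lambda>y. x < y) xs)"
  by pat_completeness auto
termination
  by (relation "Wellfounded.measure (\<lambda>xs. length xs)") (auto simp: le_imp_less_Suc)

lemma set_recs: "set (recs xs) \<subseteq> set xs"
  by (induction xs rule: recs.induct) auto

lemma sorted_recs: "sorted_wrt (<) (recs xs)"
proof (induction xs rule: recs.induct)
  case (2 x xs)
  then show ?case using set_recs[of "filter (\<lambda>y. x < y) xs"] by auto
qed simp

lemma recs_map:
  fixes f :: "'a::linorder \<Rightarrow> 'b::linorder"
  assumes "strict_mono_on (set xs) f"
  shows "recs (map f xs) = map f (recs xs)"
  using assms
proof (induction xs rule: recs.induct)
  case (2 x xs)
  have e: "filter (\<lambda>y. f x < y) (map f xs) = map f (filter (\<lambda>y. x < y) xs)"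
    unfolding filter_map o_def using 2(2)
    by (intro arg_cong[where f="map f"] filter_cong) (auto simp: strict_mono_on_less)
  have "strict_mono_on (set (filter (\<lambda>y. x < y) xs)) f" using 2(2) by (auto simp: strict_mono_on_def)
  then show ?case using 2(1) by (simp add: e del: filter_map)
qed simp

lemma recs_dominate: "x \<in> set xs \<Longrightarrow> \<exists>y\<in>set (recs xs). x \<le> y"
proof (induction xs rule: recs.induct)
  case (2 z zs)
  show ?case
  proof (cases "x \<le> z")
    case False
    then have "x \<in> set (filter (\<lambda>y. z < y) zs)" using 2(2) by auto
    then show ?thesis using 2(1) by auto
  qed auto
qed simp

lemma spine_bst: "replicate k True \<in> bst xs \<longleftrightarrow> k < length (recs xs)"
proof (induction k arbitrary: xs)
  case 0
  then show ?case by (cases xs) auto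
next
  case (Suc k)
  then show ?case by (cases xs) auto
qed

text \<open>The left subtree of a spine node receives the entries between two consecutive records.
  Their positions take care of themselves: the first entry above record \<open>k - 1\<close> is
  record \<open>k\<close>, so all others come later. The first block has no lower limit.\<close>

lemma spine_branch_bst:
  "replicate k True @ False # w \<in> bst xs \<longleftrightarrow>
    k < length (recs xs) \<and> w \<in> bst (filter (\<lambda>y. y < recs xs ! k \<and> (0 < k \<longrightarrow> recs xs ! (k - 1) < y)) xs)"
proof (induction k arbitrary: xs)
  case 0
  then show ?case by (cases xs) auto
next
  case (Suc k)
  show ?case
  proof (cases xs)
    case (Cons x xs')
    let ?z = "filter (\<lambda>y. x < y) xs'"
    have f: "filter (\<lambda>y. y < recs xs ! Suc k \<and> (0 < Suc k \<longrightarrow> recs xs ! (Suc k - 1) < y)) xs =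
          filter (\<lambda>y. y < recs ?z ! k \<and> (0 < k \<longrightarrow> recs ?z ! (k - 1) < y)) ?z" if k: "k < length (recs ?z)"
    proof (cases k)
      case 0
      then show ?thesis by (auto simp: Cons conj_commute intro!: filter_cong)
    next
      case (Suc l)
      then have "l < length (recs ?z)" using k by simp
      then have "recs ?z ! l \<in> set (recs ?z)" by (rule nth_mem)
      then have "recs ?z ! l \<in> set ?z" using set_recs by blast
      then have "x < recs ?z ! l" by simp
      then show ?thesis using Suc by (auto simp: Cons intro!: filter_cong)
    qed
    have step: "replicate (Suc k) True @ False # w \<in> bst xs \<longleftrightarrow> replicate k True @ False # w \<in> bst ?z"
      by (auto simp: Cons)
    have len: "Suc k < length (recs xs) \<longleftrightarrow> k < length (recs ?z)" by (simp add: Cons)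
    show ?thesis
    proof (cases "k < length (recs ?z)")
      case True
      show ?thesis unfolding step len f[OF True] Suc.IH[of ?z] ..
    next
      case False
      then show ?thesis unfolding step len Suc.IH[of ?z] by blast
    qed
  qed simp
qed

definition spine_block :: "nat \<Rightarrow> bool list set" where
  "spine_block s = {v. length (takeWhile id v) = s}"

lemma spine_block_eq: "spine_block s = {replicate s True} \<union> range (\<lambda>w. replicate s True @ False # w)"
proof -
  have "length (takeWhile id v) = s \<longleftrightarrow> v = replicate s True \<or> (\<exists>w. v = replicate s True @ False # w)" for v
  proof (induction v arbitrary: s)
    case Nil
    then show ?case by (cases s) auto
  next
    case (Cons a v)
    then show ?case by (cases s; cases a) auto
  qed
  then show ?thesis unfolding spine_block_def by auto
qed

definition block_ratio :: "nat \<Rightarrow> 'h set \<times> ('h \<times> 'h) set \<times> 'h \<Rightarrow> nat \<Rightarrow> bool list set \<Rightarrow> real" where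
  "block_ratio r H s T =
     real (card {v \<in> T \<inter> spine_block s. rooted_iso (ball_graph r (T, edgesT T) v) H})
     / real (card (T \<inter> spine_block s))"

text \<open>The average over the spine block that contains the smallest entry above \<open>t\<close>.\<close>
definition level_ratio :: "nat \<Rightarrow> 'h set \<times> ('h \<times> 'h) set \<times> 'h \<Rightarrow> 'a::linorder \<Rightarrow> 'a list \<Rightarrow> real" where
  "level_ratio r H t xs = block_ratio r H (length (filter (\<lambda>y. y \<le> t) (recs xs))) (bst xs)"

lemma block_ratio_bounds: "0 \<le> block_ratio r H s T" "finite T \<Longrightarrow> block_ratio r H s T \<le> 1"
proof -
  assume "finite T"
  then have "card {v \<in> T \<inter> spine_block s. rooted_iso (ball_graph r (T, edgesT T) v) H} \<le> card (T \<inter> spine_block s)"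
    by (intro card_mono) auto
  then show "block_ratio r H s T \<le> 1" unfolding block_ratio_def by (auto simp: divide_le_eq_1)
qed (simp add: block_ratio_def)

lemma nth_le_iff_count:
  fixes R :: "'a::linorder list"
  assumes "sorted_wrt (<) R" "i < length R"
  shows "R ! i \<le> t \<longleftrightarrow> i < length (filter (\<lambda>y. y \<le> t) R)"
  using assms
proof (induction R arbitrary: i)
  case (Cons x R)
  show ?case
  proof (cases "x \<le> t")
    case True
    then show ?thesis using Cons by (cases i) auto
  next
    case False
    then have "filter (\<lambda>y. y \<le> t) (x # R) = []" using Cons.prems by (force simp: filter_empty_conv)
    moreover have "t < (x # R) ! i" using False Cons.prems by (cases i) (auto simp: not_le dest!: nth_mem intro: less_trans)
    ultimately show ?thesis by simp
  qed
qed simp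

lemma card_bst_spine_block:
  assumes "distinct xs" "s < length (recs xs)"
  shows "card (bst xs \<inter> spine_block s) =
    Suc (length (filter (\<lambda>y. y < recs xs ! s \<and> (0 < s \<longrightarrow> recs xs ! (s - 1) < y)) xs))"
proof -
  let ?f = "filter (\<lambda>y. y < recs xs ! s \<and> (0 < s \<longrightarrow> recs xs ! (s - 1) < y)) xs"
  have "bst xs \<inter> spine_block s = insert (replicate s True) ((\<lambda>w. replicate s True @ False # w) ` bst ?f)"
    unfolding spine_block_eq using spine_bst[of s xs] spine_branch_bst[of s _ xs] assms(2) by auto
  moreover have "card ((\<lambda>w. replicate s True @ False # w) ` bst ?f) = length ?f"
    using card_bst[of ?f] assms(1) by (subst card_image) (auto simp: inj_on_def)
  moreover have "replicate s True \<notin> (\<lambda>w. replicate s True @ False # w) ` bst ?f" by auto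
  ultimately show ?thesis by (simp add: finite_bst)
qed

text \<open>Block \<open>k\<close> has one node for each value above record \<open>k - 1\<close> and
  up to record \<open>k\<close>, and equally many levels \<open>b\<close> lead to it. So each block
  average is added as often as the block has nodes, which restores the number of counted
  nodes.\<close>

lemma bst_count_eq_sum_level_ratio:
  fixes p :: "nat list"
  assumes p: "distinct p" "set p = {1..N}"
  shows "bst_count r H p = (\<Sum>b<N. level_ratio r H b p)"
proof -
  define T where "T = bst p"
  define R where "R = recs p"
  define m where "m = length R"
  define s where "s b = length (filter (\<lambda>y. y \<le> b) R)" for b :: nat
  define cnt where "cnt k = card {v \<in> T \<inter> spine_block k. rooted_iso (ball_graph r (T, edgesT T) v) H}" for k
  have finT: "finite T" unfolding T_def by (rule finite_bst)
  have sR: "sorted_wrt (<) R" unfolding R_def by (rule sorted_recs)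
  have Rp: "set R \<subseteq> {1..N}" unfolding R_def using set_recs[of p] p(2) by simp
  have sm: "s b < m" if "b < N" for b
  proof -
    have "N \<in> set p" using that p(2) by auto
    then obtain y where "y \<in> set R" "N \<le> y" unfolding R_def using recs_dominate by blast
    then have "\<not> y \<le> b" using that by simp
    then show ?thesis unfolding s_def m_def using \<open>y \<in> set R\<close> length_filter_less[of y R] by auto
  qed
  have c: "card {b \<in> {..<N}. s b = k} = card (T \<inter> spine_block k) \<and> 0 < card (T \<inter> spine_block k)" if k: "k < m" for k
  proof -
    \<comment> \<open>Level \<open>b\<close> stands for the value \<open>b + 1\<close>, so the
      levels of a block start at the preceding record, or at 0 for the first block.\<close>
    define lo where "lo = (if k = 0 then 0 else R ! (k - 1))"
    have kR: "R ! k \<in> {1..N}" using k Rp unfolding m_def by (meson nth_mem subsetD)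
    have lok: "lo < R ! k"
      using kR k sR unfolding lo_def m_def by (auto simp: sorted_wrt_iff_nth_less)
    have sb: "s b = k \<longleftrightarrow> lo \<le> b \<and> b < R ! k" if "b < N" for b
    proof -
      have "R ! k \<le> b \<longleftrightarrow> k < s b"
        using nth_le_iff_count[OF sR, of k b] k unfolding m_def s_def by simp
      then have "\<not> b < R ! k \<longleftrightarrow> \<not> s b \<le> k" by (simp add: not_less not_le)
      then have "b < R ! k \<longleftrightarrow> s b \<le> k" by blast
      moreover have "lo \<le> b \<longleftrightarrow> k \<le> s b"
        using nth_le_iff_count[OF sR, of "k - 1" b] k unfolding m_def s_def lo_def by (cases k) auto
      ultimately show ?thesis by auto
    qed
    have "{b \<in> {..<N}. s b = k} = {lo..<R ! k}"
    proof (intro set_eqI iffI)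
      fix b assume "b \<in> {b \<in> {..<N}. s b = k}"
      then show "b \<in> {lo..<R ! k}" using sb[of b] by simp
    next
      fix b assume "b \<in> {lo..<R ! k}"
      moreover then have "b < N" using kR by simp
      ultimately show "b \<in> {b \<in> {..<N}. s b = k}" using sb[of b] by simp
    qed
    moreover have "card (T \<inter> spine_block k) = Suc (R ! k - lo - 1)"
    proof -
      let ?f = "filter (\<lambda>y. y < R ! k \<and> (0 < k \<longrightarrow> R ! (k - 1) < y)) p"
      have "length ?f = card (set ?f)" using p(1) by (intro distinct_card[symmetric] distinct_filter)
      also have "set ?f = {lo<..<R ! k}" using kR p(2) unfolding lo_def by auto
      finally show ?thesis using card_bst_spine_block[OF p(1), of k] k unfolding T_def R_def m_def by simp
    qed
    ultimately show ?thesis using lok by simp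
  qed
  have "(\<Sum>b<N. level_ratio r H b p) = (\<Sum>b<N. real (cnt (s b)) / real (card (T \<inter> spine_block (s b))))"
    unfolding level_ratio_def block_ratio_def cnt_def s_def T_def R_def ..
  also have "\<dots> = (\<Sum>k<m. \<Sum>b\<in>{b \<in> {..<N}. s b = k}. real (cnt (s b)) / real (card (T \<inter> spine_block (s b))))"
    by (rule sum.group[symmetric]) (use sm in auto)
  also have "\<dots> = (\<Sum>k<m. real (cnt k))"
  proof (rule sum.cong[OF refl])
    fix k assume "k \<in> {..<m}"
    then have ck: "card {b \<in> {..<N}. s b = k} = card (T \<inter> spine_block k)" "0 < card (T \<inter> spine_block k)" using c by auto
    have "(\<Sum>b\<in>{b \<in> {..<N}. s b = k}. real (cnt (s b)) / real (card (T \<inter> spine_block (s b)))) =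
      (\<Sum>b\<in>{b \<in> {..<N}. s b = k}. real (cnt k) / real (card (T \<inter> spine_block k)))"
      by (rule sum.cong) auto
    also have "\<dots> = real (card {b \<in> {..<N}. s b = k}) * (real (cnt k) / real (card (T \<inter> spine_block k)))"
      by (rule sum_constant)
    also have "\<dots> = real (cnt k)" unfolding ck(1) using ck(2) by simp
    finally show "(\<Sum>b\<in>{b \<in> {..<N}. s b = k}. real (cnt (s b)) / real (card (T \<inter> spine_block (s b)))) = real (cnt k)" .
  qed
  also have "\<dots> = real (card (\<Union>k<m. {v \<in> T \<inter> spine_block k. rooted_iso (ball_graph r (T, edgesT T) v) H}))"
    unfolding cnt_def using finT
    by (subst card_UN_disjoint) (auto simp: spine_block_def)
  also have "(\<Union>k<m. {v \<in> T \<inter> spine_block k. rooted_iso (ball_graph r (T, edgesT T) v) H}) =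
     {v \<in> T. rooted_iso (ball_graph r (T, edgesT T) v) H}"
  proof -
    have "\<exists>k<m. v \<in> spine_block k" if "v \<in> T" for v
    proof -
      obtain k where v: "v \<in> spine_block k" by (simp add: spine_block_def)
      then have "v = replicate k True \<or> (\<exists>w. v = replicate k True @ False # w)" unfolding spine_block_eq by blast
      then have "k < m" using that spine_bst[of k p] spine_branch_bst[of k _ p] unfolding T_def m_def R_def by blast
      then show ?thesis using v by blast
    qed
    then show ?thesis by auto
  qed
  finally show ?thesis unfolding bst_count_def iso_count_def T_def by simp
qed

lemma level_ratio_pattern:
  assumes "distinct xs"
  shows "level_ratio r H (length (filter (\<lambda>x. x \<le> t) xs)) (pattern xs) = level_ratio r H t xs"
proof -
  let ?r = "\<lambda>x. card {y \<in> set xs. y \<le> x}"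
  have "recs (pattern xs) = map ?r (recs xs)"
    unfolding pattern_def by (rule recs_map[OF strict_mono_on_rank]) simp
  moreover have "?r x \<le> length (filter (\<lambda>x. x \<le> t) xs) \<longleftrightarrow> x \<le> t" if "x \<in> set xs" for x
  proof -
    have b: "length (filter (\<lambda>x. x \<le> t) xs) = card {y \<in> set xs. y \<le> t}"
      using distinct_card[of "filter (\<lambda>x. x \<le> t) xs"] assms(1) by simp
    show ?thesis
    proof (cases "x \<le> t")
      case True
      then have "?r x \<le> card {y \<in> set xs. y \<le> t}" by (intro card_mono) auto
      then show ?thesis using True b by simp
    next
      case False
      then have "card {y \<in> set xs. y \<le> t} < ?r x" using that by (intro psubset_card_mono) auto
      then show ?thesis using False b by simp
    qed
  qed
  then have "length (filter (\<lambda>y. y \<le> length (filter (\<lambda>x. x \<le> t) xs)) (map ?r (recs xs))) = length (filter (\<lambda>y. y \<le> t) (recs xs))"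
    using set_recs[of xs] by (auto simp: filter_map o_def intro!: arg_cong[where f=length] filter_cong)
  ultimately show ?thesis unfolding level_ratio_def by simp
qed

section \<open>Records of two-sided sequences\<close>

definition rec_enum :: "(int \<Rightarrow> int) \<Rightarrow> (int \<Rightarrow> int) \<Rightarrow> bool" where
  "rec_enum \<sigma> \<rho> \<longleftrightarrow> strict_mono \<rho> \<and> range \<rho> = record_indices \<sigma> \<and> \<sigma> (\<rho> 0) \<le> 0 \<and> 0 < \<sigma> (\<rho> 1)"

text \<open>Exactly the condition for \<open>rec_enum\<close> to be solvable, but with quantifiers
  over integers only. This makes it a measurable event, whereas the unknown in
  \<open>rec_enum\<close> ranges over an uncountable set.\<close>

definition two_sided_records :: "(int \<Rightarrow> int) \<Rightarrow> bool" where
  "two_sided_records \<sigma> \<longleftrightarrow>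
     (\<forall>n. \<exists>p\<in>record_indices \<sigma>. p < n) \<and> (\<forall>n. \<exists>p\<in>record_indices \<sigma>. n < p) \<and>
     (\<exists>p\<in>record_indices \<sigma>. \<sigma> p \<le> 0) \<and> (\<exists>p\<in>record_indices \<sigma>. 0 < \<sigma> p)"

lemma record_less_iff:
  assumes "p \<in> record_indices \<sigma>" "p' \<in> record_indices \<sigma>"
  shows "\<sigma> p < \<sigma> p' \<longleftrightarrow> p < p'"
  using assms unfolding record_indices_def by (cases p p' rule: linorder_cases) force+

lemma rec_enum_exists:
  assumes "two_sided_records \<sigma>" shows "\<exists>\<rho>. rec_enum \<sigma> \<rho>"
proof -
  let ?R = "record_indices \<sigma>"
  obtain p1 pp where p1: "p1 \<in> ?R" "\<sigma> p1 \<le> 0" and pp: "pp \<in> ?R" "0 < \<sigma> pp"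
    using assms unfolding two_sided_records_def by blast
  \<comment> \<open>Records increase in position and value together, so the nonpositive records from
    \<open>p1\<close> on stop before \<open>pp\<close>. The last of them becomes
    \<open>\<rho> 0\<close>.\<close>
  define Z where "Z = {p \<in> ?R. \<sigma> p \<le> 0 \<and> p1 \<le> p}"
  have "Z \<subseteq> {p1..pp}"
  proof
    fix p assume "p \<in> Z"
    then have "p \<in> ?R" "\<sigma> p < \<sigma> pp" "p1 \<le> p" using pp unfolding Z_def by auto
    then show "p \<in> {p1..pp}" using record_less_iff[of p \<sigma> pp] pp by simp
  qed
  then have finZ: "finite Z" by (rule finite_subset) simp
  have p1Z: "p1 \<in> Z" using p1 by (simp add: Z_def)
  define p0 where "p0 = Max Z"
  have p0: "p0 \<in> ?R" "\<sigma> p0 \<le> 0" "p1 \<le> p0" using Max_in[OF finZ] p1Z unfolding p0_def Z_def by blast+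
  have above: "0 < \<sigma> p" if "p \<in> ?R" "p0 < p" for p
  proof (rule ccontr)
    assume "\<not> 0 < \<sigma> p"
    then have "p \<in> Z" using that p0 by (simp add: Z_def)
    then show False using Max_ge[OF finZ, of p] that unfolding p0_def by simp
  qed
  define A where "A = {n::nat. p0 + 1 + int n \<in> ?R}"
  define A' where "A' = {n::nat. p0 - int n \<in> ?R}"
  have infA: "infinite A" unfolding infinite_nat_iff_unbounded
  proof
    fix m
    obtain p where "p \<in> ?R" "p0 + 1 + int m < p" using assms unfolding two_sided_records_def by blast
    then show "\<exists>n>m. n \<in> A" unfolding A_def by (intro exI[of _ "nat (p - p0 - 1)"]) auto
  qed
  have infA': "infinite A'" unfolding infinite_nat_iff_unbounded
  proof
    fix m
    obtain p where "p \<in> ?R" "p < p0 - int m" using assms unfolding two_sided_records_def by blast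
    then show "\<exists>n>m. n \<in> A'" unfolding A'_def by (intro exI[of _ "nat (p0 - p)"]) auto
  qed
  have e0: "enumerate A' 0 = 0"
    unfolding enumerate_0 by (rule Least_equality) (use p0 in \<open>auto simp: A'_def\<close>)
  \<comment> \<open>\<open>A\<close> measures offsets upwards from \<open>p0 + 1\<close> and is
    entered at index 1. \<open>A'\<close> measures offsets downwards from \<open>p0\<close> and
    contains 0, so index 0 is \<open>p0\<close>.\<close>
  define \<rho> where "\<rho> k = (if 1 \<le> k then p0 + 1 + int (enumerate A (nat (k - 1))) else p0 - int (enumerate A' (nat (- k))))" for k
  have "strict_mono \<rho>"
  proof (rule strict_monoI)
    fix x y :: int assume xy: "x < y"
    consider "1 \<le> x" | "x < 1" "1 \<le> y" | "y < 1" by linarith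
    then show "\<rho> x < \<rho> y"
    proof cases
      case 1
      then have "nat (x - 1) < nat (y - 1)" using xy by simp
      then have "enumerate A (nat (x - 1)) < enumerate A (nat (y - 1))" by (rule enumerate_mono[OF _ infA])
      then show ?thesis using 1 xy unfolding \<rho>_def by simp
    next
      case 2
      then show ?thesis unfolding \<rho>_def by simp
    next
      case 3
      then have "nat (- y) < nat (- x)" using xy by simp
      then have "enumerate A' (nat (- y)) < enumerate A' (nat (- x))" by (rule enumerate_mono[OF _ infA'])
      then show ?thesis using 3 xy unfolding \<rho>_def by simp
    qed
  qed
  moreover have "range \<rho> = ?R"
  proof (intro set_eqI iffI)
    fix p assume "p \<in> range \<rho>"
    then obtain k where "p = \<rho> k" by blast
    then show "p \<in> ?R" using enumerate_in_set[OF infA, of "nat (k - 1)"] enumerate_in_set[OF infA', of "nat (- k)"]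
      unfolding \<rho>_def A_def A'_def by auto
  next
    fix p assume p: "p \<in> ?R"
    show "p \<in> range \<rho>"
    proof (cases "p0 < p")
      case True
      then have "nat (p - p0 - 1) \<in> A" using p unfolding A_def by simp
      then obtain m where "enumerate A m = nat (p - p0 - 1)" using enumerate_Ex[OF infA] by blast
      then have "\<rho> (int m + 1) = p" using True unfolding \<rho>_def by simp
      then show ?thesis by blast
    next
      case False
      then have "nat (p0 - p) \<in> A'" using p unfolding A'_def by simp
      then obtain m where "enumerate A' m = nat (p0 - p)" using enumerate_Ex[OF infA'] by blast
      then have "\<rho> (- int m) = p" using False unfolding \<rho>_def by simp
      then show ?thesis by blast
    qed
  qed
  moreover have "\<rho> 0 = p0" unfolding \<rho>_def by (simp add: e0)
  moreover have "0 < \<sigma> (\<rho> 1)"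
  proof (rule above)
    show "\<rho> 1 \<in> ?R" using \<open>range \<rho> = ?R\<close> by blast
    show "p0 < \<rho> 1" unfolding \<rho>_def by simp
  qed
  ultimately show ?thesis unfolding rec_enum_def using p0(2) by blast
qed

text \<open>This description by membership in \<open>record_indices\<close>, like its companions for
  the predecessor and for index 0, serves twice: for uniqueness by induction over the integers and
  for the measurability of each single record.\<close>

lemma rec_enum_next:
  assumes "rec_enum \<sigma> \<rho>"
  shows "\<rho> (k + 1) = z \<longleftrightarrow> z \<in> record_indices \<sigma> \<and> \<rho> k < z \<and> (\<forall>w. \<rho> k < w \<longrightarrow> w < z \<longrightarrow> w \<notin> record_indices \<sigma>)"
proof -
  have sm: "strict_mono \<rho>" and rg: "range \<rho> = record_indices \<sigma>" using assms unfolding rec_enum_def by auto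
  have a: "\<rho> (k + 1) \<in> record_indices \<sigma>" "\<rho> k < \<rho> (k + 1)" using rg sm by (auto simp: strict_mono_less)
  have b: "w \<notin> record_indices \<sigma>" if w: "\<rho> k < w" "w < \<rho> (k + 1)" for w
  proof
    assume "w \<in> record_indices \<sigma>"
    then obtain j where "w = \<rho> j" using rg by blast
    then show False using w sm by (simp add: strict_mono_less)
  qed
  show ?thesis
  proof
    assume "\<rho> (k + 1) = z"
    then show "z \<in> record_indices \<sigma> \<and> \<rho> k < z \<and> (\<forall>w. \<rho> k < w \<longrightarrow> w < z \<longrightarrow> w \<notin> record_indices \<sigma>)" using a b by blast
  next
    assume z: "z \<in> record_indices \<sigma> \<and> \<rho> k < z \<and> (\<forall>w. \<rho> k < w \<longrightarrow> w < z \<longrightarrow> w \<notin> record_indices \<sigma>)"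
    show "\<rho> (k + 1) = z"
    proof (cases "\<rho> (k + 1)" z rule: linorder_cases)
      case less
      then show ?thesis using z a by blast
    next
      case greater
      then show ?thesis using z b by blast
    qed simp
  qed
qed

lemma rec_enum_prev:
  assumes "rec_enum \<sigma> \<rho>"
  shows "\<rho> (k - 1) = z \<longleftrightarrow> z \<in> record_indices \<sigma> \<and> z < \<rho> k \<and> (\<forall>w. z < w \<longrightarrow> w < \<rho> k \<longrightarrow> w \<notin> record_indices \<sigma>)"
proof
  have sm: "strict_mono \<rho>" and rg: "range \<rho> = record_indices \<sigma>" using assms unfolding rec_enum_def by auto
  assume "\<rho> (k - 1) = z"
  moreover have "\<rho> (k - 1) \<in> record_indices \<sigma>" "\<rho> (k - 1) < \<rho> k" using rg sm by (auto simp: strict_mono_less)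
  ultimately show "z \<in> record_indices \<sigma> \<and> z < \<rho> k \<and> (\<forall>w. z < w \<longrightarrow> w < \<rho> k \<longrightarrow> w \<notin> record_indices \<sigma>)"
    using rec_enum_next[OF assms, of "k - 1" "\<rho> k"] by auto
next
  have sm: "strict_mono \<rho>" and rg: "range \<rho> = record_indices \<sigma>" using assms unfolding rec_enum_def by auto
  assume z: "z \<in> record_indices \<sigma> \<and> z < \<rho> k \<and> (\<forall>w. z < w \<longrightarrow> w < \<rho> k \<longrightarrow> w \<notin> record_indices \<sigma>)"
  then obtain j where j: "z = \<rho> j" using rg by blast
  have "\<rho> (j + 1) = \<rho> k" using rec_enum_next[OF assms, of j "\<rho> k"] z rg unfolding j by auto
  then have "j + 1 = k" using sm by (simp add: strict_mono_eq)
  then show "\<rho> (k - 1) = z" using j by auto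
qed

lemma rec_enum_zero:
  assumes "rec_enum \<sigma> \<rho>"
  shows "\<rho> 0 = z \<longleftrightarrow> z \<in> record_indices \<sigma> \<and> \<sigma> z \<le> 0 \<and> (\<forall>w. z < w \<longrightarrow> w \<in> record_indices \<sigma> \<longrightarrow> 0 < \<sigma> w)"
proof -
  have sm: "strict_mono \<rho>" and rg: "range \<rho> = record_indices \<sigma>" and s: "\<sigma> (\<rho> 0) \<le> 0" "0 < \<sigma> (\<rho> 1)"
    using assms unfolding rec_enum_def by auto
  have a: "0 < \<sigma> w" if w: "\<rho> 0 < w" "w \<in> record_indices \<sigma>" for w
  proof -
    obtain j where j: "w = \<rho> j" using w rg by blast
    then have "1 \<le> j" using w sm by (simp add: strict_mono_less)
    then have "\<rho> 1 \<le> w" using sm j by (simp add: strict_mono_less_eq)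
    moreover have "\<rho> 1 \<in> record_indices \<sigma>" using rg by blast
    ultimately show ?thesis using s record_less_iff[of "\<rho> 1" \<sigma> w] w by (cases "\<rho> 1 = w") auto
  qed
  show ?thesis
  proof
    assume "\<rho> 0 = z"
    then show "z \<in> record_indices \<sigma> \<and> \<sigma> z \<le> 0 \<and> (\<forall>w. z < w \<longrightarrow> w \<in> record_indices \<sigma> \<longrightarrow> 0 < \<sigma> w)"
      using a s rg by blast
  next
    assume z: "z \<in> record_indices \<sigma> \<and> \<sigma> z \<le> 0 \<and> (\<forall>w. z < w \<longrightarrow> w \<in> record_indices \<sigma> \<longrightarrow> 0 < \<sigma> w)"
    have r0: "\<rho> 0 \<in> record_indices \<sigma>" using rg by blast
    show "\<rho> 0 = z"
    proof (cases "\<rho> 0" z rule: linorder_cases)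
      case less
      then have "0 < \<sigma> z" using a z by blast
      then show ?thesis using z by simp
    next
      case greater
      then have "0 < \<sigma> (\<rho> 0)" using z r0 by blast
      then show ?thesis using s by simp
    qed simp
  qed
qed

lemma rec_enum_unique:
  assumes "rec_enum \<sigma> \<rho>" "rec_enum \<sigma> \<rho>'" shows "\<rho> = \<rho>'"
proof
  fix k
  show "\<rho> k = \<rho>' k"
  proof (induction k rule: int_induct[where k=0])
    case base
    show ?case using rec_enum_zero[OF assms(1), of "\<rho>' 0"] rec_enum_zero[OF assms(2), of "\<rho>' 0"] by simp
  next
    case (step1 i)
    show ?case using rec_enum_next[OF assms(1), of i "\<rho>' (i + 1)"] rec_enum_next[OF assms(2), of i "\<rho>' (i + 1)"] step1 by simp
  next
    case (step2 i)
    show ?case using rec_enum_prev[OF assms(1), of i "\<rho>' (i - 1)"] rec_enum_prev[OF assms(2), of i "\<rho>' (i - 1)"] step2 by simp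
  qed
qed

lemma rec_enum_two_sided:
  assumes "rec_enum \<sigma> \<rho>" shows "two_sided_records \<sigma>"
proof -
  have sm: "strict_mono \<rho>" and rg: "range \<rho> = record_indices \<sigma>" and s: "\<sigma> (\<rho> 0) \<le> 0" "0 < \<sigma> (\<rho> 1)"
    using assms unfolding rec_enum_def by auto
  have up: "\<rho> 0 + int n \<le> \<rho> (int n)" for n
  proof (induction n)
    case (Suc n)
    have "\<rho> (int n) < \<rho> (int (Suc n))" using sm by (simp add: strict_mono_less)
    then show ?case using Suc by simp
  qed simp
  have down: "\<rho> (- int n) \<le> \<rho> 0 - int n" for n
  proof (induction n)
    case (Suc n)
    have "\<rho> (- int (Suc n)) < \<rho> (- int n)" using sm by (simp add: strict_mono_less)
    then show ?case using Suc by simp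
  qed simp
  have "\<exists>p\<in>record_indices \<sigma>. p < n" for n
  proof -
    have "\<rho> (- int (nat (\<rho> 0 - n + 1))) < n" using down[of "nat (\<rho> 0 - n + 1)"] by (cases "0 \<le> \<rho> 0 - n + 1") auto
    then show ?thesis using rg by blast
  qed
  moreover have "\<exists>p\<in>record_indices \<sigma>. n < p" for n
  proof -
    have "n < \<rho> (int (nat (n - \<rho> 0 + 1)))" using up[of "nat (n - \<rho> 0 + 1)"] by (cases "0 \<le> n - \<rho> 0 + 1") auto
    then show ?thesis using rg by blast
  qed
  ultimately show ?thesis unfolding two_sided_records_def using s rg by blast
qed

lemma std_records_eq: "std_records \<sigma> = (THE \<rho>. rec_enum \<sigma> \<rho>)"
  unfolding std_records_def rec_enum_def ..

lemma rec_enum_std_records: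
  assumes "two_sided_records \<sigma>" shows "rec_enum \<sigma> (std_records \<sigma>)"
proof -
  have "\<exists>!\<rho>. rec_enum \<sigma> \<rho>"
    by (rule ex_ex1I[OF rec_enum_exists[OF assms]]) (rule rec_enum_unique)
  then show ?thesis unfolding std_records_eq by (rule theI')
qed

text \<open>A failed description is \<open>THE\<close> of the constantly false predicate, one fixed
  though unknown function. Hence \<open>std_records\<close> is constant off the good event.\<close>

lemma std_records_undefined:
  assumes "\<not> two_sided_records \<sigma>" shows "std_records \<sigma> = (THE \<rho>. False)"
proof -
  have "rec_enum \<sigma> = (\<lambda>\<rho>. False)" using rec_enum_two_sided[of \<sigma>] assms by blast
  then show ?thesis unfolding std_records_eq by simp
qed

section \<open>Admissible sequences\<close>

text \<open>Among the nonpositive indices only finitely many have positive values by admissibility,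
  and only finitely many have values in \<open>{t..0}\<close> by injectivity.\<close>

lemma admissible_bounded_left:
  assumes "admissible \<sigma>" shows "\<exists>i0. \<forall>i<i0. \<sigma> i < t"
proof -
  have inj: "inj \<sigma>" and fin: "finite {i::int. i < 1 \<and> \<sigma> i \<ge> 1}" using assms unfolding admissible_def by auto
  have "finite (\<sigma> -` {t..0})" by (rule finite_vimageI[OF _ inj]) simp
  then have "finite ({i. i < 1 \<and> \<sigma> i \<ge> 1} \<union> \<sigma> -` {t..0})" using fin by simp
  then obtain l where l: "\<And>i. i \<in> {i. i < 1 \<and> \<sigma> i \<ge> 1} \<union> \<sigma> -` {t..0} \<Longrightarrow> l \<le> i"
    using bdd_below_finite unfolding bdd_below_def by metis
  have "\<sigma> i < t" if "i < min l 1" for i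
  proof (rule ccontr)
    assume "\<not> \<sigma> i < t"
    then have "i \<in> {i. i < 1 \<and> \<sigma> i \<ge> 1} \<union> \<sigma> -` {t..0}" using that by auto
    then show False using l that by force
  qed
  then show ?thesis by blast
qed

text \<open>Otherwise all positive indices, up to finitely many, would be mapped injectively into
  the finite set \<open>{1..t}\<close>.\<close>

lemma admissible_unbounded:
  assumes "admissible \<sigma>" shows "\<exists>i. t < \<sigma> i"
proof (rule ccontr)
  assume "\<not> ?thesis"
  then have le: "\<sigma> i \<le> t" for i by (simp add: not_less)
  have inj: "inj \<sigma>" and fin: "finite {i::int. i \<ge> 1 \<and> \<sigma> i < 1}" using assms unfolding admissible_def by auto
  have "finite (\<sigma> -` {1..t})" by (rule finite_vimageI[OF _ inj]) simp
  moreover have "{1::int..} \<subseteq> {i. i \<ge> 1 \<and> \<sigma> i < 1} \<union> \<sigma> -` {1..t}" using le by auto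
  ultimately have "finite {1::int..}" using fin finite_subset by blast
  then show False using infinite_Ici by blast
qed

text \<open>Far to the left all values are below \<open>\<sigma> n\<close>, so the supremum over the
  positions up to \<open>n\<close> is attained, and the place where it is attained is a
  record.\<close>

lemma admissible_record_below:
  assumes "admissible \<sigma>" shows "\<exists>p\<in>record_indices \<sigma>. p \<le> n \<and> (\<forall>k\<le>n. \<sigma> k \<le> \<sigma> p)"
proof -
  have inj: "inj \<sigma>" using assms unfolding admissible_def by auto
  obtain i0 where i0: "\<forall>i<i0. \<sigma> i < \<sigma> n" using admissible_bounded_left[OF assms] by blast
  have ni: "i0 \<le> n" using i0 by force
  have fin: "finite (\<sigma> ` {i0..n})" "\<sigma> ` {i0..n} \<noteq> {}" using ni by auto
  obtain p where p: "p \<in> {i0..n}" "\<sigma> p = Max (\<sigma> ` {i0..n})" using Max_in[OF fin] by (metis imageE)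
  have le: "\<sigma> k \<le> \<sigma> p" if "k \<le> n" for k
  proof (cases "k < i0")
    case True
    then have "\<sigma> k < \<sigma> n" using i0 by blast
    also have "\<sigma> n \<le> \<sigma> p" unfolding p(2) by (rule Max_ge) (use ni in auto)
    finally show ?thesis by simp
  next
    case False
    then show ?thesis unfolding p(2) by (intro Max_ge) (use that in auto)
  qed
  have "\<sigma> k < \<sigma> p" if "k < p" for k
  proof -
    have "\<sigma> k \<le> \<sigma> p" using le that p by simp
    moreover have "\<sigma> k \<noteq> \<sigma> p" using inj that by (auto dest: injD)
    ultimately show ?thesis by simp
  qed
  then have "p \<in> record_indices \<sigma>" unfolding record_indices_def by simp
  then show ?thesis using p le by auto
qed

lemma admissible_two_sided_records:
  assumes "admissible \<sigma>" shows "two_sided_records \<sigma>"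
proof -
  let ?R = "record_indices \<sigma>"
  have below: "\<exists>p\<in>?R. p < n" for n using admissible_record_below[OF assms, of "n - 1"] by force
  have above: "\<exists>p\<in>?R. n < p \<and> t < \<sigma> p" for n t
  proof -
    obtain p0 where p0: "\<forall>k\<le>n. \<sigma> k \<le> \<sigma> p0" using admissible_record_below[OF assms, of n] by blast
    obtain i where i: "max t (\<sigma> p0) < \<sigma> i" using admissible_unbounded[OF assms] by blast
    obtain p where p: "p \<in> ?R" "\<forall>k\<le>i. \<sigma> k \<le> \<sigma> p" using admissible_record_below[OF assms, of i] by blast
    have si: "\<sigma> i \<le> \<sigma> p" using p by blast
    have "n < p"
    proof (rule ccontr)
      assume "\<not> n < p"
      then have "\<sigma> p \<le> \<sigma> p0" using p0 by simp
      then show False using i si by simp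
    qed
    moreover have "t < \<sigma> p" using i si by simp
    ultimately show ?thesis using p(1) by blast
  qed
  have "\<exists>p\<in>?R. \<sigma> p \<le> 0"
  proof -
    obtain i0 where "\<forall>i<i0. \<sigma> i < 1" using admissible_bounded_left[OF assms] by blast
    moreover obtain p where "p \<in> ?R" "p < i0" using below by blast
    ultimately show ?thesis by force
  qed
  then show ?thesis unfolding two_sided_records_def using below above by blast
qed

section \<open>Local convergence of windows to the redwood tree\<close>

lemma recs_snoc: "recs (xs @ [x]) = recs xs @ (if \<forall>y\<in>set xs. y < x then [x] else [])"
proof (induction xs rule: recs.induct)
  case (2 z zs)
  show ?case
  proof (cases "z < x")
    case True
    have "(\<forall>y\<in>set (filter (\<lambda>y. z < y) zs). y < x) \<longleftrightarrow> (\<forall>y\<in>set zs. y < x)"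
      using True by (auto simp: not_less)
    then show ?thesis using 2 True by simp
  qed simp
qed simp

lemma set_recs_nth: "set (recs xs) = {xs ! i |i. i < length xs \<and> (\<forall>j<i. xs ! j < xs ! i)}"
proof (induction xs rule: rev_induct)
  case (snoc x xs)
  have "(\<forall>y\<in>set xs. y < x) \<longleftrightarrow> (\<forall>j<length xs. xs ! j < x)" by (auto simp: set_conv_nth)
  then have C: "set (if \<forall>y\<in>set xs. y < x then [x] else []) = (if \<forall>j<length xs. xs ! j < x then {x} else {})" by simp
  have AB: "{(xs @ [x]) ! i |i. i < length (xs @ [x]) \<and> (\<forall>j<i. (xs @ [x]) ! j < (xs @ [x]) ! i)} =
    {xs ! i |i. i < length xs \<and> (\<forall>j<i. xs ! j < xs ! i)} \<union> (if \<forall>j<length xs. xs ! j < x then {x} else {})"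
    (is "?A = ?B \<union> ?C")
  proof (intro set_eqI iffI)
    fix y assume "y \<in> ?A"
    then obtain i where i: "y = (xs @ [x]) ! i" "i < Suc (length xs)" "\<forall>j<i. (xs @ [x]) ! j < (xs @ [x]) ! i" by auto
    show "y \<in> ?B \<union> ?C"
    proof (cases "i < length xs")
      case True
      then have "y = xs ! i" "\<forall>j<i. xs ! j < xs ! i" using i by (auto simp: nth_append)
      then show ?thesis using True by blast
    next
      case False
      then have "i = length xs" using i by simp
      then have "y = x" "\<forall>j<length xs. xs ! j < x" using i by (auto simp: nth_append)
      then show ?thesis by simp
    qed
  next
    fix y assume "y \<in> ?B \<union> ?C"
    then show "y \<in> ?A"
    proof
      assume "y \<in> ?B"
      then obtain i where i: "y = xs ! i" "i < length xs" "\<forall>j<i. xs ! j < xs ! i" by auto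
      then have "y = (xs @ [x]) ! i" "\<forall>j<i. (xs @ [x]) ! j < (xs @ [x]) ! i" by (auto simp: nth_append)
      then show ?thesis using i(2) by auto
    next
      assume "y \<in> ?C"
      then have "y = x" "\<forall>j<length xs. xs ! j < x" by (auto split: if_splits)
      then have "y = (xs @ [x]) ! length xs" "\<forall>j<length xs. (xs @ [x]) ! j < (xs @ [x]) ! length xs" by (auto simp: nth_append)
      then show ?thesis by (auto intro!: exI[of _ "length xs"])
    qed
  qed
  show ?case unfolding recs_snoc set_append snoc.IH C AB ..
qed simp

lemma set_recs_window:
  fixes \<sigma> :: "int \<Rightarrow> int"
  shows "set (recs (map \<sigma> [l..h])) = {\<sigma> i |i. l \<le> i \<and> i \<le> h \<and> (\<forall>k. l \<le> k \<longrightarrow> k < i \<longrightarrow> \<sigma> k < \<sigma> i)}"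
proof (intro set_eqI iffI)
  fix y assume "y \<in> set (recs (map \<sigma> [l..h]))"
  then obtain n where n: "n < nat (h - l + 1)" "y = map \<sigma> [l..h] ! n" "\<forall>j<n. map \<sigma> [l..h] ! j < map \<sigma> [l..h] ! n"
    unfolding set_recs_nth by auto
  have nn: "map \<sigma> [l..h] ! j = \<sigma> (l + int j)" if "j \<le> n" for j
    using that n(1) by (simp add: nth_upto)
  have "\<sigma> k < \<sigma> (l + int n)" if "l \<le> k" "k < l + int n" for k
  proof -
    have "nat (k - l) < n" using that by simp
    then have "\<sigma> (l + int (nat (k - l))) < \<sigma> (l + int n)" using n(3) nn[of "nat (k - l)"] nn[of n] by auto
    then show ?thesis using that by simp
  qed
  then show "y \<in> {\<sigma> i |i. l \<le> i \<and> i \<le> h \<and> (\<forall>k. l \<le> k \<longrightarrow> k < i \<longrightarrow> \<sigma> k < \<sigma> i)}"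
    using n(1,2) nn[of n] by (intro CollectI exI[of _ "l + int n"]) auto
next
  fix y assume "y \<in> {\<sigma> i |i. l \<le> i \<and> i \<le> h \<and> (\<forall>k. l \<le> k \<longrightarrow> k < i \<longrightarrow> \<sigma> k < \<sigma> i)}"
  then obtain i where i: "y = \<sigma> i" "l \<le> i" "i \<le> h" "\<And>k. l \<le> k \<Longrightarrow> k < i \<Longrightarrow> \<sigma> k < \<sigma> i" by blast
  define n where "n = nat (i - l)"
  have nn: "map \<sigma> [l..h] ! j = \<sigma> (l + int j)" if "j \<le> n" for j
    using that i unfolding n_def by (simp add: nth_upto)
  have li: "l + int n = i" using i by (simp add: n_def)
  have "\<forall>j<n. map \<sigma> [l..h] ! j < map \<sigma> [l..h] ! n"
  proof (intro allI impI)
    fix j assume "j < n"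
    then have "\<sigma> (l + int j) < \<sigma> i" using i(4)[of "l + int j"] li by linarith
    then show "map \<sigma> [l..h] ! j < map \<sigma> [l..h] ! n" using nn[of j] nn[of n] \<open>j < n\<close> li by simp
  qed
  moreover have "y = map \<sigma> [l..h] ! n" using nn[of n] li i(1) by simp
  moreover have "n < length (map \<sigma> [l..h])" using i by (simp add: n_def)
  ultimately show "y \<in> set (recs (map \<sigma> [l..h]))" unfolding set_recs_nth by blast
qed

lemma nth_count_less:
  fixes R :: "'a::linorder list"
  assumes "sorted_wrt (<) R" "y \<in> set R"
  shows "card {z \<in> set R. z < y} < length R \<and> R ! card {z \<in> set R. z < y} = y"
proof -
  obtain i where i: "i < length R" "R ! i = y" using assms(2) by (auto simp: in_set_conv_nth)
  have d: "distinct R" using assms(1) by (simp add: strict_sorted_iff)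
  have "{z \<in> set R. z < y} = (!) R ` {..<i}"
  proof (intro set_eqI iffI)
    fix z assume "z \<in> {z \<in> set R. z < y}"
    then obtain j where j: "j < length R" "R ! j = z" "z < y" by (auto simp: in_set_conv_nth)
    have "j < i"
    proof (rule ccontr)
      assume "\<not> j < i"
      then have "R ! i \<le> R ! j" using j(1) assms(1) by (cases "i = j") (auto simp: sorted_wrt_iff_nth_less less_imp_le)
      then show False using i j by simp
    qed
    then show "z \<in> (!) R ` {..<i}" using j by auto
  next
    fix z assume "z \<in> (!) R ` {..<i}"
    then show "z \<in> {z \<in> set R. z < y}" using i assms(1) by (auto simp: sorted_wrt_iff_nth_less)
  qed
  moreover have "inj_on ((!) R) {..<i}" using d i by (auto simp: inj_on_def nth_eq_iff_index_eq)
  ultimately have "card {z \<in> set R. z < y} = i" by (simp add: card_image)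
  then show ?thesis using i by simp
qed

lemma filter_upto_eq:
  assumes "\<And>i. P i \<Longrightarrow> l \<le> i \<and> i \<le> h"
  shows "filter P [l..h] = sorted_list_of_set {i::int. P i}"
proof -
  have fin: "finite {i. P i}" by (rule finite_subset[of _ "{l..h}"]) (use assms in auto)
  have "set (filter P [l..h]) = {i. P i}" using assms by auto
  moreover have "sorted_wrt (<) (filter P [l..h])" by (rule sorted_wrt_filter) simp
  ultimately show ?thesis using fin by (metis sorted_list_of_set.idem_if_sorted_distinct strict_sorted_iff)
qed

lemma one_pow_no_L0: "L0 \<notin> set (one_pow k)"
  by (auto simp: one_pow_def)

lemma one_pow_inj: "one_pow k = one_pow j \<longleftrightarrow> k = j"
proof
  assume eq: "one_pow k = one_pow j"
  have len: "length (one_pow i) = nat \<bar>i\<bar>" for i by (auto simp: one_pow_def)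
  have sg: "0 < i \<longleftrightarrow> L1 \<in> set (one_pow i)" for i by (auto simp: one_pow_def)
  have "nat \<bar>k\<bar> = nat \<bar>j\<bar>" "0 < k \<longleftrightarrow> 0 < j" using eq len sg by metis+
  then show "k = j" by auto
qed simp

lemma takeWhile_branch_word: "takeWhile (\<lambda>x. x \<noteq> L0) (branch_word k w) = one_pow k"
  "dropWhile (\<lambda>x. x \<noteq> L0) (branch_word k w) = L0 # map letter_of w"
proof -
  have "\<And>x. x \<in> set (one_pow k) \<Longrightarrow> x \<noteq> L0" using one_pow_no_L0[of k] by metis
  then show "takeWhile (\<lambda>x. x \<noteq> L0) (branch_word k w) = one_pow k"
    "dropWhile (\<lambda>x. x \<noteq> L0) (branch_word k w) = L0 # map letter_of w"
    unfolding branch_word_def by (simp_all add: takeWhile_append2 dropWhile_append2)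
qed

lemma branch_word_inj: "branch_word k w = branch_word j w' \<longleftrightarrow> k = j \<and> w = w'"
proof
  assume eq: "branch_word k w = branch_word j w'"
  have "one_pow k = one_pow j" using eq takeWhile_branch_word(1) by metis
  moreover have "map letter_of w = map letter_of w'" using eq takeWhile_branch_word(2) by (metis list.inject)
  moreover have "inj letter_of" by (auto simp: inj_def letter_of_def)
  ultimately show "k = j \<and> w = w'" by (simp add: one_pow_inj inj_map_eq_map)
qed simp

lemma one_pow_neq_branch_word: "one_pow k \<noteq> branch_word j w" "branch_word j w \<noteq> one_pow k"
proof -
  have "L0 \<in> set (branch_word j w)" by (simp add: branch_word_def)
  then show "one_pow k \<noteq> branch_word j w" "branch_word j w \<noteq> one_pow k" using one_pow_no_L0[of k] by metis+
qed

lemma one_pow_snoc_L0: "one_pow k @ [L0] = branch_word k []"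
  by (simp add: branch_word_def)

lemma branch_word_snoc: "branch_word k w @ [letter_of a] = branch_word k (w @ [a])"
  by (simp add: branch_word_def)

lemma Y_basic_edge_words:
  "Y_basic_edge (one_pow k) (one_pow j) \<longleftrightarrow> j = k + 1"
  "Y_basic_edge (one_pow k) (branch_word j w) \<longleftrightarrow> j = k \<and> w = []"
  "\<not> Y_basic_edge (branch_word k w) (one_pow j)"
  "Y_basic_edge (branch_word k w) (branch_word j w') \<longleftrightarrow> j = k \<and> (\<exists>a. w' = w @ [a])"
  unfolding Y_basic_edge_def one_pow_snoc_L0
  by (auto simp: one_pow_inj one_pow_neq_branch_word branch_word_inj branch_word_snoc)

text \<open>
  In the redwood tree \<open>1\<^sup>k\<close> stands for the record \<open>r\<^bsub>k+1\<^esub>\<close>: the values between \<open>\<sigma>(r\<^sub>k)\<close> and \<open>\<sigma>(r\<^bsub>k+1\<^esub>)\<close>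
  form its left subtree.  If \<open>s\<close> records of a window are nonpositive, the spine node of depth \<open>n\<close> is thus \<open>1\<^bsup>n-s\<^esup>\<close>.
\<close>
definition embed_word :: "nat \<Rightarrow> bool list \<Rightarrow> letter list" where
  "embed_word s v = (let n = length (takeWhile id v) in
     if n = length v then one_pow (int n - int s) else branch_word (int n - int s) (drop (Suc n) v))"

lemma takeWhile_id_replicate: "takeWhile id (replicate n True) = replicate n True"
  "takeWhile id (replicate n True @ False # w) = replicate n True"
  by (induction n) auto

lemma embed_word_simps:
  "embed_word s (replicate n True) = one_pow (int n - int s)"
  "embed_word s (replicate n True @ False # w) = branch_word (int n - int s) w"
  unfolding embed_word_def takeWhile_id_replicate Let_def by simp_all

lemma spine_word_cases:
  obtains (spine) n where "v = replicate n True" | (branch) n w where "v = replicate n True @ False # w"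
proof -
  have "v \<in> spine_block (length (takeWhile id v))" by (simp add: spine_block_def)
  then show ?thesis unfolding spine_block_eq using that by blast
qed

lemma spine_word_eq:
  "replicate n True = replicate m True \<longleftrightarrow> n = m"
  "replicate n True @ False # w = replicate m True @ False # w' \<longleftrightarrow> n = m \<and> w = w'"
  "replicate n True \<noteq> replicate m True @ False # w"
  "replicate m True @ False # w \<noteq> replicate n True"
proof -
  show "replicate n True = replicate m True \<longleftrightarrow> n = m" by auto
  show "replicate n True @ False # w = replicate m True @ False # w' \<longleftrightarrow> n = m \<and> w = w'"
  proof
    assume eq: "replicate n True @ False # w = replicate m True @ False # w'"
    then have "replicate n True = replicate m True" using takeWhile_id_replicate(2) by metis
    then show "n = m \<and> w = w'" using eq by auto
  qed simp
  have "False \<in> set (replicate m True @ False # w)" "False \<notin> set (replicate n True)" by auto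
  then show "replicate n True \<noteq> replicate m True @ False # w" "replicate m True @ False # w \<noteq> replicate n True" by metis+
qed

lemma embed_word_inj: "embed_word s u = embed_word s v \<longleftrightarrow> u = v"
  by (cases u rule: spine_word_cases; cases v rule: spine_word_cases)
     (simp_all only: embed_word_simps one_pow_inj branch_word_inj one_pow_neq_branch_word spine_word_eq, auto)

text \<open>Edges are preserved and reflected for all words and every shift \<open>s\<close>, so the
  window tree and the redwood tree can differ only in their vertex sets.\<close>

lemma embed_word_edge: "(\<exists>a. v = u @ [a]) \<longleftrightarrow> Y_basic_edge (embed_word s u) (embed_word s v)"
proof (cases u rule: spine_word_cases)
  case (spine n)
  have "(\<exists>a. v = u @ [a]) \<longleftrightarrow> v = u @ [True] \<or> v = u @ [False]" by (metis (full_types))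
  moreover have "u @ [True] = replicate (Suc n) True" "u @ [False] = replicate n True @ False # []"
    unfolding spine by (simp_all add: replicate_append_same)
  ultimately have ex: "(\<exists>a. v = u @ [a]) \<longleftrightarrow> v = replicate (Suc n) True \<or> v = replicate n True @ False # []"
    by simp
  show ?thesis unfolding ex
    by (cases v rule: spine_word_cases)
       (simp_all only: spine embed_word_simps Y_basic_edge_words spine_word_eq, auto)
next
  case (branch n w)
  have ex: "(\<exists>a. v = u @ [a]) \<longleftrightarrow> (\<exists>a. v = replicate n True @ False # (w @ [a]))"
    unfolding branch by simp
  show ?thesis unfolding ex
    by (cases v rule: spine_word_cases)
       (simp_all only: branch embed_word_simps Y_basic_edge_words spine_word_eq, auto)
qed

definition redwood_ratio :: "nat \<Rightarrow> 'h set \<times> ('h \<times> 'h) set \<times> 'h \<Rightarrow> letter list set \<Rightarrow> real" where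
  "redwood_ratio r H Y =
     real (card {v \<in> Y \<inter> TL_set. rooted_iso (ball_graph r (Y, edgesY Y) v) H}) / real (card (Y \<inter> TL_set))"

lemma redwood_words:
  "one_pow k \<in> redwood \<sigma>" "branch_word k w \<in> redwood \<sigma> \<longleftrightarrow> w \<in> bst (sigma_block \<sigma> k)"
  unfolding redwood_def by (auto simp: one_pow_inj branch_word_inj one_pow_neq_branch_word)

lemma redwood_cases:
  assumes "y \<in> redwood \<sigma>"
  obtains (spine) j where "y = one_pow j" | (branch) j w where "y = branch_word j w"
  using assms unfolding redwood_def by blast

lemma spine_index_snoc:
  "length (takeWhile id (u @ [a])) = length (takeWhile id u) \<or> length (takeWhile id (u @ [a])) = Suc (length (takeWhile id u))"
  by (induction u) auto

text \<open>A child keeps the number of leading 1s or raises it by one, so a walk of length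
  \<open>k\<close> moves at most \<open>k\<close> blocks away.\<close>

lemma edgesT_relpow_index:
  "(v, u) \<in> edgesT T ^^ k \<Longrightarrow> v \<in> T \<Longrightarrow> u \<in> T \<and> \<bar>int (length (takeWhile id u)) - int (length (takeWhile id v))\<bar> \<le> int k"
proof (induction k arbitrary: u)
  case (Suc k)
  then obtain z where z: "(v, z) \<in> edgesT T ^^ k" "(z, u) \<in> edgesT T" by auto
  obtain a where a: "u = z @ [a] \<or> z = u @ [a]" "u \<in> T" using z(2) unfolding edgesT_def by auto
  have "\<bar>int (length (takeWhile id u)) - int (length (takeWhile id z))\<bar> \<le> 1"
    using a(1) spine_index_snoc[of z a] spine_index_snoc[of u a] by auto
  moreover have "\<bar>int (length (takeWhile id z)) - int (length (takeWhile id v))\<bar> \<le> int k"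
    using Suc.IH[OF z(1) Suc.prems(2)] by blast
  ultimately have "\<bar>int (length (takeWhile id u)) - int (length (takeWhile id v))\<bar> \<le> int (Suc k)" by linarith
  then show ?case using a(2) by blast
qed simp

lemma embed_word_TL: "embed_word s ` spine_block s = TL_set"
proof -
  have "one_pow 0 = []" by (simp add: one_pow_def)
  then show ?thesis unfolding spine_block_eq TL_set_def
    by (simp add: embed_word_simps image_Un image_image)
qed

text \<open>\<open>W\<close> brings all values between the records \<open>- r\<close> and
  \<open>r + 1\<close> into the window, and \<open>L\<close> prevents positions left of it from
  spoiling a record in this range. The upper index is \<open>r + 1\<close> because the spine node
  with index \<open>r\<close> stands for the record \<open>r + 1\<close>. The blocks with indices
  from \<open>- r\<close> to \<open>r\<close> then agree, and a ball of radius \<open>r\<close>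
  around block 0 sees no others.\<close>

lemma window_ratio_aux:
  fixes \<sigma> :: "int \<Rightarrow> int" and r :: nat
  assumes re: "rec_enum \<sigma> (std_records \<sigma>)"
    and W: "\<And>i. \<sigma> (std_records \<sigma> (- int r)) \<le> \<sigma> i \<Longrightarrow> \<sigma> i \<le> \<sigma> (std_records \<sigma> (int r + 1)) \<Longrightarrow> l \<le> i \<and> i \<le> h"
    and L: "\<And>k. k < l \<Longrightarrow> \<sigma> k < \<sigma> (std_records \<sigma> (- int r))"
  shows "level_ratio r H 0 (map \<sigma> [l..h]) = redwood_ratio r H (redwood \<sigma>)"
proof -
  define \<rho> where "\<rho> = std_records \<sigma>"
  define g where "g k = \<sigma> (\<rho> k)" for k
  define xs where "xs = map \<sigma> [l..h]"
  define R where "R = recs xs"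
  define T where "T = bst xs"
  define Y where "Y = redwood \<sigma>"
  define s where "s = length (filter (\<lambda>y. y \<le> 0) R)"
  define idx where "idx v = length (takeWhile id v)" for v :: "bool list"
  have rg: "range \<rho> = record_indices \<sigma>" and g0: "g 0 \<le> 0" "0 < g 1" and sm\<rho>: "strict_mono \<rho>"
    using re unfolding rec_enum_def \<rho>_def g_def by auto
  have smg: "strict_mono g"
  proof (rule strict_monoI)
    fix a b :: int assume "a < b"
    then have "\<rho> a < \<rho> b" using sm\<rho> by (simp add: strict_mono_less)
    moreover have "\<rho> a \<in> record_indices \<sigma>" "\<rho> b \<in> record_indices \<sigma>" using rg by auto
    ultimately show "g a < g b" unfolding g_def using record_less_iff by blast
  qed
  have gless: "g a < g b \<longleftrightarrow> a < b" "g a \<le> g b \<longleftrightarrow> a \<le> b" "g a = g b \<longleftrightarrow> a = b" for a b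
    using smg by (auto simp: strict_mono_less strict_mono_less_eq strict_mono_eq)
  have gpos: "0 < g k \<longleftrightarrow> 1 \<le> k" for k
  proof
    assume "0 < g k"
    then have "g 0 < g k" using g0 by simp
    then show "1 \<le> k" using gless by simp
  next
    assume "1 \<le> k"
    then have "g 1 \<le> g k" using gless by simp
    then show "0 < g k" using g0 by simp
  qed
  have W': "l \<le> i \<and> i \<le> h" if "g (- int r) \<le> \<sigma> i" "\<sigma> i \<le> g (int r + 1)" for i
    using W that unfolding g_def \<rho>_def by blast
  have L': "\<sigma> k < g (- int r)" if "k < l" for k using L that unfolding g_def \<rho>_def by blast
  have setR: "set R = {\<sigma> i |i. l \<le> i \<and> i \<le> h \<and> (\<forall>k. l \<le> k \<longrightarrow> k < i \<longrightarrow> \<sigma> k < \<sigma> i)}"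
    unfolding R_def xs_def by (rule set_recs_window)
  have sR: "sorted_wrt (<) R" unfolding R_def by (rule sorted_recs)
  have dR: "distinct R" using sR by (simp add: strict_sorted_iff)
  \<comment> \<open>Window records below \<open>g (- int r)\<close> may be artefacts of the
    truncation; those from it on are true records.\<close>
  have R1: "\<exists>k. y = g k" if y: "y \<in> set R" "g (- int r) \<le> y" for y
  proof -
    obtain i where i: "y = \<sigma> i" "l \<le> i" "\<forall>k. l \<le> k \<longrightarrow> k < i \<longrightarrow> \<sigma> k < \<sigma> i" using y(1) unfolding setR by blast
    have "\<sigma> k < \<sigma> i" if "k < i" for k
    proof (cases "k < l")
      case True
      then show ?thesis using L'[of k] y(2) i(1) by simp
    next
      case False
      then show ?thesis using i(3) that by simp
    qed
    then have "i \<in> record_indices \<sigma>" unfolding record_indices_def by simp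
    then obtain k where "i = \<rho> k" using rg by blast
    then show ?thesis using i(1) by (intro exI[of _ k]) (simp add: g_def)
  qed
  have R2: "g k \<in> set R" if k: "- int r \<le> k" "k \<le> int r + 1" for k
  proof -
    have "l \<le> \<rho> k \<and> \<rho> k \<le> h" using W'[of "\<rho> k"] gless(2) k unfolding g_def[symmetric] by simp
    moreover have "\<rho> k \<in> record_indices \<sigma>" using rg by blast
    ultimately show ?thesis unfolding setR g_def record_indices_def by blast
  qed
  have scard: "s = card {y \<in> set R. y \<le> 0}"
    unfolding s_def using distinct_card[of "filter (\<lambda>y. y \<le> 0) R"] dR by simp
  have injg: "inj_on g A" for A using gless(3) by (auto simp: inj_on_def)
  \<comment> \<open>Artefacts are nonpositive, hence counted in \<open>s\<close> too. They shift the
    index of a true record and \<open>s\<close> by the same amount, so the difference is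
    right.\<close>
  have idxR: "\<exists>n. int n = int s + j \<and> n < length R \<and> R ! n = g (j + 1)" if j: "- int r - 1 \<le> j" "j \<le> int r" for j
  proof (intro exI conjI)
    let ?C = "card {y \<in> set R. y < g (j + 1)}"
    have gR: "g (j + 1) \<in> set R" using R2[of "j + 1"] j by simp
    show "?C < length R" "R ! ?C = g (j + 1)" using nth_count_less[OF sR gR] by auto
    show "int ?C = int s + j"
    proof (cases "0 \<le> j")
      case True
      have "{y \<in> set R. y < g (j + 1)} = {y \<in> set R. y \<le> 0} \<union> g ` {1..j}"
      proof (intro set_eqI iffI)
        fix y assume y: "y \<in> {y \<in> set R. y < g (j + 1)}"
        show "y \<in> {y \<in> set R. y \<le> 0} \<union> g ` {1..j}"
        proof (cases "y \<le> 0")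
          case False
          have "g (- int r) \<le> g 0" using gless(2) by simp
          then have "g (- int r) \<le> y" using False g0 by simp
          then obtain k where k: "y = g k" using R1 y by blast
          have "1 \<le> k" using False k gpos[of k] by simp
          moreover have "k < j + 1" using y k gless(1) by simp
          ultimately show ?thesis using k by auto
        qed (use y in auto)
      next
        fix y assume "y \<in> {y \<in> set R. y \<le> 0} \<union> g ` {1..j}"
        then show "y \<in> {y \<in> set R. y < g (j + 1)}"
        proof
          assume "y \<in> {y \<in> set R. y \<le> 0}"
          moreover have "0 < g (j + 1)" using gpos True by simp
          ultimately show ?thesis by simp
        next
          assume "y \<in> g ` {1..j}"
          then obtain k where "y = g k" "1 \<le> k" "k \<le> j" by auto
          then show ?thesis using R2[of k] j gless(1)[of k "j + 1"] by simp
        qed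
      qed
      moreover have "{y \<in> set R. y \<le> 0} \<inter> g ` {1..j} = {}" by (auto simp: not_less[symmetric] gpos)
      ultimately have "?C = s + card (g ` {1..j})" unfolding scard by (simp add: card_Un_disjoint)
      then show ?thesis using True by (simp add: card_image[OF injg])
    next
      case False
      have "{y \<in> set R. y \<le> 0} = {y \<in> set R. y < g (j + 1)} \<union> g ` {j + 1..0}"
      proof (intro set_eqI iffI)
        fix y assume y: "y \<in> {y \<in> set R. y \<le> 0}"
        show "y \<in> {y \<in> set R. y < g (j + 1)} \<union> g ` {j + 1..0}"
        proof (cases "y < g (j + 1)")
          case False
          have "g (- int r) \<le> g (j + 1)" using gless(2) j by simp
          then have "g (- int r) \<le> y" using False by simp
          then obtain k where k: "y = g k" using R1 y by blast
          have "k < 1" using y k gpos[of k] by simp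
          moreover have "j + 1 \<le> k" using False k gless(1)[of k "j + 1"] by simp
          ultimately show ?thesis using k by auto
        qed (use y in auto)
      next
        fix y assume "y \<in> {y \<in> set R. y < g (j + 1)} \<union> g ` {j + 1..0}"
        then show "y \<in> {y \<in> set R. y \<le> 0}"
        proof
          assume "y \<in> {y \<in> set R. y < g (j + 1)}"
          moreover have "\<not> 0 < g (j + 1)" using gpos False by simp
          ultimately show ?thesis by simp
        next
          assume "y \<in> g ` {j + 1..0}"
          then obtain k where "y = g k" "j + 1 \<le> k" "k \<le> 0" by auto
          then show ?thesis using R2[of k] j gpos[of k] by simp
        qed
      qed
      moreover have "{y \<in> set R. y < g (j + 1)} \<inter> g ` {j + 1..0} = {}" by (auto simp: gless(1))
      ultimately have "s = ?C + card (g ` {j + 1..0})" unfolding scard by (simp add: card_Un_disjoint)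
      then show ?thesis using False by (simp add: card_image[OF injg])
    qed
  qed
  have spineT: "replicate n True \<in> T" if nn: "\<bar>int n - int s\<bar> \<le> int r" for n
  proof -
    have "- int r - 1 \<le> int n - int s" "int n - int s \<le> int r" using nn by auto
    then obtain n' where n': "int n' = int s + (int n - int s)" "n' < length R" using idxR[of "int n - int s"] by blast
    then have "n' = n" by simp
    then show ?thesis using n'(2) unfolding T_def R_def spine_bst by simp
  qed
  have branchT: "replicate n True @ False # w \<in> T \<longleftrightarrow> branch_word (int n - int s) w \<in> Y"
    if n: "\<bar>int n - int s\<bar> \<le> int r" for n w
  proof -
    define j where "j = int n - int s"
    have j: "- int r \<le> j" "j \<le> int r" using n unfolding j_def by auto
    obtain n1 where "int n1 = int s + j" "n1 < length R" "R ! n1 = g (j + 1)" using idxR[of j] j by auto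
    moreover then have "n1 = n" unfolding j_def by simp
    ultimately have n1: "n < length R" "R ! n = g (j + 1)" by auto
    obtain n2 where n2: "int n2 = int s + (j - 1)" "R ! n2 = g (j - 1 + 1)" using idxR[of "j - 1"] j by auto
    have n2': "n = Suc n2" using n2(1) unfolding j_def by simp
    have "filter (\<lambda>y. y < R ! n \<and> (0 < n \<longrightarrow> R ! (n - 1) < y)) xs = filter (\<lambda>y. y < g (j + 1) \<and> g j < y) xs"
      using n1(2) n2(2) n2' by simp
    also have "\<dots> = map \<sigma> (filter (\<lambda>i. \<sigma> i < g (j + 1) \<and> g j < \<sigma> i) [l..h])"
      unfolding xs_def by (simp add: filter_map o_def)
    also have "filter (\<lambda>i. \<sigma> i < g (j + 1) \<and> g j < \<sigma> i) [l..h] = sorted_list_of_set {i. \<sigma> i < g (j + 1) \<and> g j < \<sigma> i}"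
    proof (rule filter_upto_eq)
      fix i assume i: "\<sigma> i < g (j + 1) \<and> g j < \<sigma> i"
      have "g (- int r) \<le> g j" "g (j + 1) \<le> g (int r + 1)" using gless(2) j by auto
      then show "l \<le> i \<and> i \<le> h" using W'[of i] i by simp
    qed
    also have "map \<sigma> \<dots> = sigma_block \<sigma> j"
      unfolding sigma_block_def Let_def g_def \<rho>_def by (simp add: conj_commute)
    finally have fe: "filter (\<lambda>y. y < R ! n \<and> (0 < n \<longrightarrow> R ! (n - 1) < y)) xs = sigma_block \<sigma> j" .
    have "replicate n True @ False # w \<in> T \<longleftrightarrow> w \<in> bst (sigma_block \<sigma> j)"
      unfolding T_def spine_branch_bst fe[unfolded R_def] using n1(1) unfolding R_def by simp
    then show ?thesis unfolding Y_def redwood_words j_def .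
  qed
  have TY: "v \<in> T \<longleftrightarrow> embed_word s v \<in> Y" if v: "\<bar>int (idx v) - int s\<bar> \<le> int r" for v
  proof (cases v rule: spine_word_cases)
    case (spine n)
    then have "idx v = n" by (simp add: idx_def takeWhile_id_replicate)
    then show ?thesis using spineT[of n] v unfolding spine embed_word_simps Y_def by (simp add: redwood_words)
  next
    case (branch n w)
    then have "idx v = n" by (simp add: idx_def takeWhile_id_replicate)
    then show ?thesis using branchT[of n w] v unfolding branch embed_word_simps by simp
  qed
  \<comment> \<open>Every redwood word near block 0 is hit: \<open>idxR\<close> exhibits
    \<open>s + j\<close> as a natural number, hence as a spine depth.\<close>
  have exY: "\<exists>u. y = embed_word s u \<and> int (idx u) = int s + j"
    if y: "y = one_pow j \<or> y = branch_word j w" and j: "\<bar>j\<bar> \<le> int r" for y j w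
  proof -
    have "- int r - 1 \<le> j" "j \<le> int r" using j by auto
    then obtain n where n: "int n = int s + j" using idxR[of j] by blast
    then have jn: "j = int n - int s" by simp
    have "idx (replicate n True) = n" "idx (replicate n True @ False # w) = n"
      by (simp_all add: idx_def takeWhile_id_replicate)
    then show ?thesis using y n unfolding jn embed_word_simps[symmetric] by auto
  qed
  have iso: "rooted_iso (ball_graph r (T, edgesT T) v) H \<longleftrightarrow> rooted_iso (ball_graph r (Y, edgesY Y) (embed_word s v)) H"
    if v: "v \<in> T" "v \<in> spine_block s" for v
  proof (rule ball_iso_transfer)
    have idxv: "idx v = s" using v(2) by (simp add: spine_block_def idx_def)
    have reach: "u \<in> T" "\<bar>int (idx u) - int s\<bar> \<le> int k" if "(v, u) \<in> edgesT T ^^ k" for u k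
      using edgesT_relpow_index[OF that v(1)] idxv unfolding idx_def by auto
    show "edgesT T \<subseteq> T \<times> T" by (rule edgesT_subset)
    show "edgesY Y \<subseteq> Y \<times> Y" unfolding edgesY_def by auto
    show "inj_on (embed_word s) {u. \<exists>k\<le>r. (v, u) \<in> edgesT T ^^ k}" by (auto simp: inj_on_def embed_word_inj)
    have edge: "(x, y) \<in> edgesT T \<longleftrightarrow> (embed_word s x, embed_word s y) \<in> edgesY Y"
      if "x \<in> T" "y \<in> T" "embed_word s x \<in> Y" "embed_word s y \<in> Y" for x y
      using that embed_word_edge[of y x s] embed_word_edge[of x y s] unfolding edgesT_def edgesY_def by auto
    show "(x, y) \<in> edgesT T \<longleftrightarrow> (embed_word s x, embed_word s y) \<in> edgesY Y"
      if jk: "j \<le> r" "k \<le> r" "(v, x) \<in> edgesT T ^^ j" "(v, y) \<in> edgesT T ^^ k" for j k x y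
    proof -
      have "\<bar>int (idx x) - int s\<bar> \<le> int r" "\<bar>int (idx y) - int s\<bar> \<le> int r" using reach(2)[OF jk(3)] reach(2)[OF jk(4)] jk(1,2) by auto
      then show ?thesis using edge reach(1)[OF jk(3)] reach(1)[OF jk(4)] TY by blast
    qed
    fix k u y assume k: "k < r" "(v, u) \<in> edgesT T ^^ k" "(embed_word s u, y) \<in> edgesY Y"
    have u: "u \<in> T" "\<bar>int (idx u) - int s\<bar> \<le> int k" using reach[OF k(2)] by auto
    have yY: "y \<in> Y" and uY: "embed_word s u \<in> Y" and be: "Y_basic_edge (embed_word s u) y \<or> Y_basic_edge y (embed_word s u)"
      using k(3) unfolding edgesY_def by auto
    have "\<exists>u'. y = embed_word s u' \<and> \<bar>int (idx u') - int s\<bar> \<le> int r"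
    proof -
      define m where "m = int (idx u) - int s"
      have eu: "embed_word s u = one_pow m \<or> (\<exists>w. embed_word s u = branch_word m w)"
        by (cases u rule: spine_word_cases) (auto simp: m_def idx_def takeWhile_id_replicate embed_word_simps)
      \<comment> \<open>An edge joins blocks whose indices differ by at most one, so a neighbour of
        a vertex at distance below \<open>r\<close> still has an index of modulus at most
        \<open>r\<close>.\<close>
      have "\<exists>j w. (y = one_pow j \<or> y = branch_word j w) \<and> \<bar>j - m\<bar> \<le> 1"
        using yY unfolding Y_def
      proof (cases rule: redwood_cases)
        case (spine j)
        then have "\<bar>j - m\<bar> \<le> 1" using eu be by (auto simp: Y_basic_edge_words)
        then show ?thesis using spine by blast
      next
        case (branch j w)
        then have "\<bar>j - m\<bar> \<le> 1" using eu be by (auto simp: Y_basic_edge_words)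
        then show ?thesis using branch by blast
      qed
      then obtain j w where jw: "y = one_pow j \<or> y = branch_word j w" "\<bar>j - m\<bar> \<le> 1" by blast
      then have jr: "\<bar>j\<bar> \<le> int r" using u(2) k(1) unfolding m_def by linarith
      obtain u' where "y = embed_word s u'" "int (idx u') = int s + j" using exY[OF jw(1) jr] by blast
      then show ?thesis using jr by (intro exI[of _ u']) simp
    qed
    then obtain u' where u': "y = embed_word s u'" "\<bar>int (idx u') - int s\<bar> \<le> int r" by blast
    have "u' \<in> T" using TY[OF u'(2)] yY u'(1) by simp
    then have "(u, u') \<in> edgesT T" using edge[OF u(1) _ uY] yY k(3) unfolding u'(1) by blast
    then show "\<exists>u'. (u, u') \<in> edgesT T \<and> y = embed_word s u'" using u'(1) by blast
  qed
  have blk: "v \<in> T \<longleftrightarrow> embed_word s v \<in> Y" if "v \<in> spine_block s" for v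
    using TY[of v] that by (simp add: spine_block_def idx_def)
  have img: "embed_word s ` (T \<inter> spine_block s) = Y \<inter> TL_set"
    unfolding embed_word_TL[of s, symmetric] using blk by blast
  have img2: "embed_word s ` {v \<in> T \<inter> spine_block s. rooted_iso (ball_graph r (T, edgesT T) v) H} =
     {v \<in> Y \<inter> TL_set. rooted_iso (ball_graph r (Y, edgesY Y) v) H}"
    unfolding img[symmetric] using iso by blast
  have inj: "inj_on (embed_word s) A" for A by (auto simp: inj_on_def embed_word_inj)
  have c1: "card (Y \<inter> TL_set) = card (T \<inter> spine_block s)"
    unfolding img[symmetric] by (rule card_image[OF inj])
  have c2: "card {v \<in> Y \<inter> TL_set. rooted_iso (ball_graph r (Y, edgesY Y) v) H} =
      card {v \<in> T \<inter> spine_block s. rooted_iso (ball_graph r (T, edgesT T) v) H}"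
    unfolding img2[symmetric] by (rule card_image[OF inj])
  show ?thesis
    unfolding level_ratio_def xs_def[symmetric] R_def[symmetric] s_def[symmetric] T_def[symmetric] Y_def[symmetric]
      block_ratio_def redwood_ratio_def c1 c2 ..
qed

text \<open>By injectivity only finitely many positions carry values between the two records, and
  \<open>admissible_bounded_left\<close> controls the positions far to the left. Every window beyond
  both bounds works.\<close>

lemma window_ratio:
  assumes "admissible \<sigma>"
  shows "\<exists>K::nat. \<forall>a b. K \<le> a \<longrightarrow> K \<le> b \<longrightarrow> level_ratio r H 0 (map \<sigma> [1 - int b..int a]) = redwood_ratio r H (redwood \<sigma>)"
proof -
  have inj: "inj \<sigma>" using assms by (simp add: admissible_def)
  define lo where "lo = \<sigma> (std_records \<sigma> (- int r))"
  define hi where "hi = \<sigma> (std_records \<sigma> (int r + 1))"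
  have re: "rec_enum \<sigma> (std_records \<sigma>)"
    by (rule rec_enum_std_records[OF admissible_two_sided_records[OF assms]])
  have "finite (\<sigma> -` {lo..hi})" by (rule finite_vimageI[OF _ inj]) simp
  then obtain M where M: "\<And>i. i \<in> \<sigma> -` {lo..hi} \<Longrightarrow> \<bar>i\<bar> \<le> M"
    by (metis finite_imageI imageI Max_ge)
  obtain i0 where i0: "\<forall>i<i0. \<sigma> i < lo" using admissible_bounded_left[OF assms] by blast
  define K where "K = nat (\<bar>M\<bar> + \<bar>i0\<bar> + 1)"
  show ?thesis
  proof (intro exI allI impI)
    fix a b assume ab: "K \<le> a" "K \<le> b"
    have bounds: "\<bar>M\<bar> + \<bar>i0\<bar> + 1 \<le> int a" "\<bar>M\<bar> + \<bar>i0\<bar> + 1 \<le> int b" using ab unfolding K_def by auto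
    show "level_ratio r H 0 (map \<sigma> [1 - int b..int a]) = redwood_ratio r H (redwood \<sigma>)"
    proof (rule window_ratio_aux[OF re])
      fix i assume "\<sigma> (std_records \<sigma> (- int r)) \<le> \<sigma> i" "\<sigma> i \<le> \<sigma> (std_records \<sigma> (int r + 1))"
      then have "i \<in> \<sigma> -` {lo..hi}" unfolding lo_def hi_def by simp
      then have "\<bar>i\<bar> \<le> M" by (rule M)
      then show "1 - int b \<le> i \<and> i \<le> int a" using bounds by linarith
    next
      fix k assume "k < 1 - int b"
      then have "k < i0" using bounds by linarith
      then show "\<sigma> k < \<sigma> (std_records \<sigma> (- int r))" using i0 unfolding lo_def by blast
    qed
  qed
qed

section \<open>The interleaving of positive and nonpositive values\<close>

definition is_lambda :: "(nat \<Rightarrow> nat) \<Rightarrow> (nat \<Rightarrow> nat) \<Rightarrow> bool" where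
  "is_lambda Mv lam \<longleftrightarrow> antimono lam \<and> (\<forall>i. card {j. lam j = Suc i} = Mv i) \<and> (\<exists>N. \<forall>j\<ge>N. lam j = 0)"

lemma is_lambda_finite_level:
  assumes "is_lambda Mv lam" shows "finite {j. Suc k \<le> lam j}"
proof -
  obtain N where N: "\<forall>j\<ge>N. lam j = 0" using assms unfolding is_lambda_def by blast
  have "{j. Suc k \<le> lam j} \<subseteq> {..<N}"
  proof
    fix j assume "j \<in> {j. Suc k \<le> lam j}"
    then have "lam j \<noteq> 0" by simp
    then show "j \<in> {..<N}" using N by (cases "N \<le> j") auto
  qed
  then show ?thesis by (rule finite_subset) simp
qed

lemma is_lambda_bound:
  assumes "is_lambda Mv lam" shows "lam j \<le> lam 0"
  using assms unfolding is_lambda_def antimono_def by simp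

lemma is_lambda_level_card:
  assumes "is_lambda Mv lam" "lam 0 \<le> n"
  shows "card {j. Suc k \<le> lam j} = (\<Sum>i\<in>{k..<n}. Mv i)"
proof -
  have "{j. Suc k \<le> lam j} = (\<Union>i\<in>{k..<n}. {j. lam j = Suc i})"
  proof (intro set_eqI iffI)
    fix j assume j: "j \<in> {j. Suc k \<le> lam j}"
    then obtain i where i: "lam j = Suc i" by (cases "lam j") auto
    then have "i \<in> {k..<n}" using j is_lambda_bound[OF assms(1), of j] assms(2) by simp
    then show "j \<in> (\<Union>i\<in>{k..<n}. {j. lam j = Suc i})" using i by blast
  qed auto
  also have "card \<dots> = (\<Sum>i\<in>{k..<n}. card {j. lam j = Suc i})"
  proof (rule card_UN_disjoint)
    show "\<forall>i\<in>{k..<n}. finite {j. lam j = Suc i}"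
    proof
      fix i
      show "finite {j. lam j = Suc i}"
        by (rule finite_subset[OF _ is_lambda_finite_level[OF assms(1), of i]]) auto
    qed
  qed auto
  finally show ?thesis using assms(1) unfolding is_lambda_def by simp
qed

text \<open>A level set of a nonincreasing sequence is an initial segment, hence known from its
  size. These sizes, the columns of the partition, are sums of multiplicities by
  \<open>is_lambda_level_card\<close>, which yields uniqueness.\<close>

lemma is_lambda_level_iff:
  assumes "is_lambda Mv lam"
  shows "Suc k \<le> lam j \<longleftrightarrow> j < card {j. Suc k \<le> lam j}"
proof -
  let ?A = "{j. Suc k \<le> lam j}"
  have fin: "finite ?A" by (rule is_lambda_finite_level[OF assms])
  have down: "i \<in> ?A" if "j \<in> ?A" "i \<le> j" for i j
    using assms that unfolding is_lambda_def antimono_def by (auto intro: order_trans)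
  have "?A = {..<card ?A}"
  proof (cases "?A = {}")
    case False
    define m where "m = Max ?A"
    have m: "m \<in> ?A" "\<And>i. i \<in> ?A \<Longrightarrow> i \<le> m" using Max_in[OF fin False] Max_ge[OF fin] unfolding m_def by auto
    have A: "?A = {..m}" using m down by blast
    show ?thesis unfolding A by (simp only: card_atMost lessThan_Suc_atMost)
  next
    case True
    then show ?thesis by (simp only: card.empty lessThan_0)
  qed
  then have "j \<in> ?A \<longleftrightarrow> j \<in> {..<card ?A}" by (rule arg_cong[where f="\<lambda>S. j \<in> S"])
  then show ?thesis by simp
qed

lemma is_lambda_unique:
  assumes "is_lambda Mv lam" "is_lambda Mv lam'" shows "lam = lam'"
proof
  fix j
  let ?n = "max (lam 0) (lam' 0)"
  have eq: "card {j. Suc k \<le> lam j} = card {j. Suc k \<le> lam' j}" for k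
    using is_lambda_level_card[OF assms(1), of ?n k] is_lambda_level_card[OF assms(2), of ?n k] by simp
  have "Suc k \<le> lam j \<longleftrightarrow> Suc k \<le> lam' j" for k
    using is_lambda_level_iff[OF assms(1), of k j] is_lambda_level_iff[OF assms(2), of k j] eq by simp
  note iff = this
  have "lam j \<le> lam' j" using iff[of "lam j - 1"] by (cases "lam j") auto
  moreover have "lam' j \<le> lam j" using iff[of "lam' j - 1"] by (cases "lam' j") auto
  ultimately show "lam j = lam' j" by simp
qed

primrec part_list :: "(nat \<Rightarrow> nat) \<Rightarrow> nat \<Rightarrow> nat list" where
  "part_list Mv 0 = []"
| "part_list Mv (Suc n) = replicate (Mv n) (Suc n) @ part_list Mv n"

lemma part_list_props:
  "sorted_wrt (\<ge>) (part_list Mv n)" "set (part_list Mv n) \<subseteq> {1..n}"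
  "length (filter (\<lambda>x. x = Suc i) (part_list Mv n)) = (if i < n then Mv i else 0)"
proof -
  show set: "set (part_list Mv n) \<subseteq> {1..n}" for n by (induction n) auto
  show "sorted_wrt (\<ge>) (part_list Mv n)"
  proof (induction n)
    case (Suc n)
    have "sorted_wrt (\<ge>) (replicate (Mv n) (Suc n))" by (induction "Mv n") (auto simp: sorted_wrt_iff_nth_less)
    moreover have "y \<le> Suc n" if "y \<in> set (part_list Mv n)" for y using set[of n] that by force
    ultimately show ?case using Suc by (auto simp: sorted_wrt_append)
  qed simp
  show "length (filter (\<lambda>x. x = Suc i) (part_list Mv n)) = (if i < n then Mv i else 0)"
    by (induction n) (auto simp: less_Suc_eq)
qed

lemma is_lambda_exists:
  assumes "finite {i. Mv i \<noteq> 0}" shows "\<exists>lam. is_lambda Mv lam"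
proof -
  obtain n where n: "\<And>i. Mv i \<noteq> 0 \<Longrightarrow> i < n"
    using assms unfolding finite_nat_set_iff_bounded by blast
  define L where "L = part_list Mv n"
  define lam where "lam j = (if j < length L then L ! j else 0)" for j
  have "antimono lam"
  proof (rule antimonoI)
    fix i j :: nat assume "i \<le> j"
    then show "lam j \<le> lam i"
      using part_list_props(1)[of Mv n] unfolding lam_def L_def
      by (cases "i = j") (auto simp: sorted_wrt_iff_nth_less)
  qed
  moreover have "card {j. lam j = Suc i} = Mv i" for i
  proof -
    have "{j. lam j = Suc i} = {j. j < length L \<and> L ! j = Suc i}" unfolding lam_def by auto
    then have "card {j. lam j = Suc i} = length (filter (\<lambda>x. x = Suc i) L)"
      by (simp add: length_filter_conv_card)
    also have "\<dots> = Mv i" unfolding L_def part_list_props(3) using n[of i] by auto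
    finally show ?thesis .
  qed
  moreover have "\<exists>N. \<forall>j\<ge>N. lam j = 0" by (intro exI[of _ "length L"]) (simp add: lam_def)
  ultimately show ?thesis unfolding is_lambda_def by blast
qed

lemma is_lambda_finite_support:
  assumes "is_lambda Mv lam" shows "finite {i. Mv i \<noteq> 0}"
proof (rule finite_subset)
  show "{i. Mv i \<noteq> 0} \<subseteq> {..<lam 0}"
  proof
    fix i assume "i \<in> {i. Mv i \<noteq> 0}"
    then have "card {j. lam j = Suc i} \<noteq> 0" using assms unfolding is_lambda_def by simp
    then obtain j where "lam j = Suc i" by (auto simp: card_eq_0_iff)
    then show "i \<in> {..<lam 0}" using is_lambda_bound[OF assms, of j] by simp
  qed
qed simp

lemma Lambda_seq_eq: "Lambda_seq Mv = (THE lam. is_lambda Mv lam)"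
  unfolding Lambda_seq_def is_lambda_def ..

lemma Lambda_seqI: "is_lambda Mv lam \<Longrightarrow> Lambda_seq Mv = lam"
  unfolding Lambda_seq_eq by (rule the_equality, assumption, rule is_lambda_unique)

lemma is_lambda_Lambda_seq: "finite {i. Mv i \<noteq> 0} \<Longrightarrow> is_lambda Mv (Lambda_seq Mv)"
  using is_lambda_exists[of Mv] Lambda_seqI[of Mv] by auto

text \<open>A nonincreasing sequence takes no value above its first one, so for infinite support the
  description fails and returns one fixed value.\<close>

lemma Lambda_seq_undefined:
  assumes "infinite {i. Mv i \<noteq> 0}" shows "Lambda_seq Mv = (THE lam. False)"
proof -
  have "is_lambda Mv = (\<lambda>lam. False)" using is_lambda_finite_support[of Mv] assms by blast
  then show ?thesis unfolding Lambda_seq_eq by simp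
qed

text \<open>The partition has at most \<open>a\<close> parts, each at most \<open>b\<close>. Then
  the window \<open>{1 - b..a}\<close> holds the positions of exactly the first \<open>a\<close>
  terms of the positive half and the first \<open>b\<close> terms of the other half.\<close>

definition fits :: "nat \<Rightarrow> nat \<Rightarrow> (nat \<Rightarrow> nat) \<Rightarrow> bool" where
  "fits a b Mv \<longleftrightarrow> finite {i. Mv i \<noteq> 0} \<and> Lambda_seq Mv 0 \<le> b \<and> (\<forall>j\<ge>a. Lambda_seq Mv j = 0)"

lemma fits_eventually:
  assumes "finite {i. Mv i \<noteq> 0}" shows "\<exists>K. \<forall>a b. K \<le> a \<longrightarrow> K \<le> b \<longrightarrow> fits a b Mv"
proof -
  obtain N where "\<forall>j\<ge>N. Lambda_seq Mv j = 0"
    using is_lambda_Lambda_seq[OF assms] unfolding is_lambda_def by blast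
  then show ?thesis using assms unfolding fits_def by (intro exI[of _ "max N (Lambda_seq Mv 0)"]) auto
qed

lemma fits_lambda: "fits a b Mv \<Longrightarrow> is_lambda Mv (Lambda_seq Mv)"
  unfolding fits_def using is_lambda_Lambda_seq by blast

lemma ell_strict_mono:
  assumes "is_lambda Mv (Lambda_seq Mv)"
  shows "strict_mono (\<lambda>j. ell Mv (Suc j))"
proof (rule strict_mono_Suc_iff[THEN iffD2], rule allI)
  fix n
  have "Lambda_seq Mv (Suc n) \<le> Lambda_seq Mv n" using assms unfolding is_lambda_def antimono_def by simp
  then show "ell Mv (Suc n) < ell Mv (Suc (Suc n))" unfolding ell_def by simp
qed

definition ell_set :: "(nat \<Rightarrow> nat) \<Rightarrow> int set" where
  "ell_set Mv = range (\<lambda>j. ell Mv (Suc j))"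

lemma ell_set_image: "ell Mv ` {1..} = ell_set Mv"
proof -
  have "{1::nat..} = range Suc" by (auto simp: image_iff Suc_le_eq gr0_conv_Suc)
  then show ?thesis unfolding ell_set_def by (simp add: image_image)
qed

lemma ell_compl_eq: "ell_compl Mv = - ell_set Mv"
  unfolding ell_compl_def ell_set_image ..

text \<open>\<open>Suc j\<close> translates an index from 0 into the index from 1 used by
  \<open>ell\<close>. Beyond \<open>a\<close> all parts vanish, so \<open>ell\<close> is the
  identity there, and the largest part bounds the displacement to the left by
  \<open>b\<close>.\<close>

lemma fits_ell:
  assumes "fits a b Mv"
  shows "j < a \<Longrightarrow> 1 - int b \<le> ell Mv (Suc j) \<and> ell Mv (Suc j) \<le> int a"
    and "a \<le> j \<Longrightarrow> ell Mv (Suc j) = int (Suc j)"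
proof -
  have lam: "is_lambda Mv (Lambda_seq Mv)" by (rule fits_lambda[OF assms])
  have sm: "strict_mono (\<lambda>j. ell Mv (Suc j))" by (rule ell_strict_mono[OF lam])
  show id: "ell Mv (Suc j) = int (Suc j)" if "a \<le> j" for j
    using assms that unfolding fits_def ell_def by simp
  assume j: "j < a"
  have "ell Mv (Suc j) < ell Mv (Suc a)" using strict_monoD[OF sm j] .
  then have "ell Mv (Suc j) \<le> int a" using id[of a] by simp
  moreover have "ell Mv (Suc 0) \<le> ell Mv (Suc j)" using monoD[OF strict_mono_mono[OF sm], of 0 j] by simp
  moreover have "1 - int b \<le> ell Mv (Suc 0)" using assms unfolding fits_def ell_def by simp
  ultimately show "1 - int b \<le> ell Mv (Suc j) \<and> ell Mv (Suc j) \<le> int a" by simp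
qed

lemma fits_ell_set:
  assumes "fits a b Mv"
  shows "z \<in> ell_set Mv \<Longrightarrow> 1 - int b \<le> z" and "int a < z \<Longrightarrow> z \<in> ell_set Mv"
    and "ell_set Mv \<inter> {1 - int b..int a} = (\<lambda>j. ell Mv (Suc j)) ` {..<a}"
proof -
  have hi: "ell Mv (Suc j) = int (Suc j)" if "a \<le> j" for j using fits_ell(2)[OF assms that] .
  have lo: "1 - int b \<le> ell Mv (Suc j)" for j
  proof (cases "j < a")
    case True
    then show ?thesis using fits_ell(1)[OF assms] by blast
  next
    case False
    then show ?thesis using hi[of j] by simp
  qed
  then show "z \<in> ell_set Mv \<Longrightarrow> 1 - int b \<le> z" unfolding ell_set_def by blast
  show "z \<in> ell_set Mv" if z: "int a < z"
  proof -
    have "ell Mv (Suc (nat (z - 1))) = z" using hi[of "nat (z - 1)"] z by simp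
    then show ?thesis unfolding ell_set_def by (metis rangeI)
  qed
  show "ell_set Mv \<inter> {1 - int b..int a} = (\<lambda>j. ell Mv (Suc j)) ` {..<a}"
  proof (intro set_eqI iffI)
    fix z assume z: "z \<in> ell_set Mv \<inter> {1 - int b..int a}"
    then obtain j where j: "z = ell Mv (Suc j)" unfolding ell_set_def by blast
    have "j < a" using hi[of j] z j by (cases "j < a") auto
    then show "z \<in> (\<lambda>j. ell Mv (Suc j)) ` {..<a}" using j by blast
  next
    fix z assume "z \<in> (\<lambda>j. ell Mv (Suc j)) ` {..<a}"
    then show "z \<in> ell_set Mv \<inter> {1 - int b..int a}" using fits_ell(1)[OF assms] unfolding ell_set_def by auto
  qed
qed

lemma fits_filter_ell:
  assumes "fits a b Mv"
  shows "filter (\<lambda>z. z \<in> ell_set Mv) [1 - int b..int a] = map (\<lambda>j. ell Mv (Suc j)) [0..<a]"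
proof (rule strict_sorted_equal)
  show "sorted_wrt (<) (filter (\<lambda>z. z \<in> ell_set Mv) [1 - int b..int a])" by (rule sorted_wrt_filter) simp
  show "sorted_wrt (<) (map (\<lambda>j. ell Mv (Suc j)) [0..<a])"
    using strict_monoD[OF ell_strict_mono[OF fits_lambda[OF assms]]] by (simp add: sorted_wrt_map sorted_wrt_iff_nth_less)
  show "set (filter (\<lambda>z. z \<in> ell_set Mv) [1 - int b..int a]) = set (map (\<lambda>j. ell Mv (Suc j)) [0..<a])"
    using fits_ell_set(3)[OF assms] by (auto simp: lessThan_atLeast0)
qed

lemma fits_compl_length:
  assumes "fits a b Mv"
  shows "length (filter (\<lambda>z. z \<notin> ell_set Mv) [1 - int b..int a]) = b"
proof -
  have "length (filter (\<lambda>z. z \<in> ell_set Mv) [1 - int b..int a]) + length (filter (\<lambda>z. z \<notin> ell_set Mv) [1 - int b..int a])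
     = length [1 - int b..int a]" by (rule sum_length_filter_compl)
  then show ?thesis unfolding fits_filter_ell[OF assms] by simp
qed

lemma compl_card_inj:
  assumes "finite {y \<in> A. x < y}" "finite {y \<in> A. x' < y}" "x \<in> A" "x' \<in> A"
    "card {y \<in> A. x < y} = card {y \<in> A. (x'::int) < y}"
  shows "x = x'"
proof (cases x x' rule: linorder_cases)
  case less
  then have "{y \<in> A. x' < y} \<subset> {y \<in> A. x < y}" using assms by auto
  then have "card {y \<in> A. x' < y} < card {y \<in> A. x < y}" by (rule psubset_card_mono[OF assms(1)])
  then show ?thesis using assms(5) by simp
next
  case greater
  then have "{y \<in> A. x < y} \<subset> {y \<in> A. x' < y}" using assms by auto
  then have "card {y \<in> A. x < y} < card {y \<in> A. x' < y}" by (rule psubset_card_mono[OF assms(2)])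
  then show ?thesis using assms(5) by simp
qed

text \<open>Above \<open>a\<close> every integer belongs to \<open>ell_set\<close>, so the elements
  of the complement from \<open>1 - b\<close> on are the \<open>b\<close> ones in the window. Having
  \<open>m\<close> larger ones means standing at index \<open>b - 1 - m\<close> of the increasing
  list.\<close>

lemma fits_kelt:
  assumes "fits a b Mv" "m < b"
  shows "kelt Mv m = filter (\<lambda>z. z \<notin> ell_set Mv) [1 - int b..int a] ! (b - 1 - m)"
proof -
  define ks where "ks = filter (\<lambda>z. z \<notin> ell_set Mv) [1 - int b..int a]"
  have len: "length ks = b" unfolding ks_def by (rule fits_compl_length[OF assms(1)])
  have srt: "sorted_wrt (<) ks" unfolding ks_def by (rule sorted_wrt_filter) simp
  define i where "i = b - 1 - m"
  have i: "i < b" "b - Suc i = m" using assms(2) unfolding i_def by auto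
  have inQ: "ks ! i \<in> ell_compl Mv" "1 - int b \<le> ks ! i"
    using nth_mem[of i ks] i len unfolding ks_def ell_compl_eq by auto
  have fin: "finite {y \<in> ell_compl Mv. x < y}" for x
  proof (rule finite_subset)
    show "{y \<in> ell_compl Mv. x < y} \<subseteq> {x..int a}"
    proof
      fix y assume y: "y \<in> {y \<in> ell_compl Mv. x < y}"
      then have "\<not> int a < y" using fits_ell_set(2)[OF assms(1), of y] unfolding ell_compl_eq by blast
      then show "y \<in> {x..int a}" using y by simp
    qed
  qed simp
  have "{y \<in> ell_compl Mv. ks ! i < y} = (!) ks ` {i<..<b}"
  proof (intro set_eqI iffI)
    fix y assume y: "y \<in> {y \<in> ell_compl Mv. ks ! i < y}"
    then have "y \<notin> ell_set Mv" "ks ! i < y" unfolding ell_compl_eq by auto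
    moreover then have "y \<le> int a" using fits_ell_set(2)[OF assms(1), of y] by (cases "int a < y") auto
    ultimately have "y \<in> set ks" using inQ(2) unfolding ks_def by auto
    then obtain j where j: "j < b" "y = ks ! j" using len by (auto simp: in_set_conv_nth)
    have "i < j"
    proof (rule ccontr)
      assume "\<not> i < j"
      then have "ks ! j \<le> ks ! i" using srt i len by (cases "i = j") (auto simp: sorted_wrt_iff_nth_less less_imp_le)
      then show False using y j by simp
    qed
    then show "y \<in> (!) ks ` {i<..<b}" using j by auto
  next
    fix y assume "y \<in> (!) ks ` {i<..<b}"
    then obtain j where j: "i < j" "j < b" "y = ks ! j" by auto
    then have "y \<in> set ks" "ks ! i < y" using len srt by (auto simp: sorted_wrt_iff_nth_less)
    then show "y \<in> {y \<in> ell_compl Mv. ks ! i < y}" unfolding ks_def ell_compl_eq by auto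
  qed
  moreover have "inj_on ((!) ks) {i<..<b}"
    using srt len by (auto simp: inj_on_def strict_sorted_iff nth_eq_iff_index_eq)
  ultimately have card: "card {y \<in> ell_compl Mv. ks ! i < y} = m" using i(2) by (simp add: card_image)
  show ?thesis unfolding kelt_def ks_def[symmetric] i_def[symmetric]
  proof (rule the_equality)
    show "ks ! i \<in> ell_compl Mv \<and> card {y \<in> ell_compl Mv. ks ! i < y} = m" using inQ card by simp
    fix x assume x: "x \<in> ell_compl Mv \<and> card {y \<in> ell_compl Mv. x < y} = m"
    show "x = ks ! i"
      by (rule compl_card_inj[of "ell_compl Mv"]) (use x inQ card fin in auto)
  qed
qed

text \<open>With the right end fixed at \<open>K\<close>, a large \<open>b\<close> brings any given
  elements of the complement into one window, where \<open>kelt\<close> is indexing of a distinct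
  list.\<close>

lemma kelt_inj:
  assumes "finite {i. Mv i \<noteq> 0}" shows "inj (kelt Mv)" "range (kelt Mv) = ell_compl Mv"
proof -
  obtain K where K: "\<And>a b. K \<le> a \<Longrightarrow> K \<le> b \<Longrightarrow> fits a b Mv" using fits_eventually[OF assms] by blast
  have rep: "kelt Mv m = filter (\<lambda>z. z \<notin> ell_set Mv) [1 - int b..int K] ! (b - 1 - m)" if "K \<le> b" "m < b" for b m
    by (rule fits_kelt[OF K]) (use that in auto)
  show "inj (kelt Mv)"
  proof (rule injI)
    fix m m' assume eq: "kelt Mv m = kelt Mv m'"
    define b where "b = max K (max (Suc m) (Suc m'))"
    let ?ks = "filter (\<lambda>z. z \<notin> ell_set Mv) [1 - int b..int K]"
    have b: "K \<le> b" "m < b" "m' < b" unfolding b_def by auto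
    have len: "length ?ks = b" by (rule fits_compl_length[OF K]) (use b in auto)
    have "?ks ! (b - 1 - m) = ?ks ! (b - 1 - m')" using eq rep b by simp
    moreover have "distinct ?ks" by (rule distinct_filter) simp
    ultimately have "b - 1 - m = b - 1 - m'" using len b by (subst (asm) nth_eq_iff_index_eq) auto
    then show "m = m'" using b by simp
  qed
  show "range (kelt Mv) = ell_compl Mv"
  proof (intro set_eqI iffI)
    fix z assume "z \<in> range (kelt Mv)"
    then obtain m where m: "z = kelt Mv m" by blast
    define b where "b = max K (Suc m)"
    let ?ks = "filter (\<lambda>z. z \<notin> ell_set Mv) [1 - int b..int K]"
    have b: "K \<le> b" "m < b" unfolding b_def by auto
    have len: "length ?ks = b" by (rule fits_compl_length[OF K]) (use b in auto)
    have "z \<in> set ?ks" unfolding m rep[OF b] by (rule nth_mem) (use len b in simp)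
    then show "z \<in> ell_compl Mv" unfolding ell_compl_eq by simp
  next
    fix z assume z: "z \<in> ell_compl Mv"
    define b where "b = max K (nat (1 - z))"
    let ?ks = "filter (\<lambda>z. z \<notin> ell_set Mv) [1 - int b..int K]"
    have b: "K \<le> b" "1 - int b \<le> z" unfolding b_def by auto
    have len: "length ?ks = b" by (rule fits_compl_length[OF K]) (use b in auto)
    have "z \<le> int K" using fits_ell_set(2)[OF K[of K K], of z] z unfolding ell_compl_eq by (cases "int K < z") auto
    then have "z \<in> set ?ks" using z b unfolding ell_compl_eq by auto
    then have "\<exists>i<length ?ks. ?ks ! i = z" unfolding in_set_conv_nth .
    then obtain i where i: "i < b" "z = ?ks ! i" using len by auto
    then have "kelt Mv (b - 1 - i) = z" using rep[OF b(1), of "b - 1 - i"] by simp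
    then show "z \<in> range (kelt Mv)" by blast
  qed
qed

section \<open>Values of the two-sided permutation on a window\<close>

lemma length_Ilist [simp]: "length (Ilist B n) = n"
  by (induction n) auto

lemma Ilist_nth: "k < n \<Longrightarrow> Ilist B n ! k = mallowsN B (Suc k)"
proof (induction n)
  case (Suc n)
  show ?case
  proof (cases "k = n")
    case True
    then show ?thesis by (simp only: mallowsN_def diff_Suc_1)
  next
    case False
    then show ?thesis using Suc by (simp add: nth_append)
  qed
qed simp

lemma Ilist_eq_map: "Ilist B n = map (\<lambda>k. mallowsN B (Suc k)) [0..<n]"
  by (rule nth_equalityI) (simp_all add: Ilist_nth del: Ilist.simps)

text \<open>The pathwise requirement on an array. It fails only on a null set, which covers the
  arrays where \<open>LEAST\<close> returns a meaningless repeated value or zero.\<close>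

definition valid_field :: "(nat \<times> nat \<Rightarrow> bool) \<Rightarrow> bool" where
  "valid_field B \<longleftrightarrow> (\<forall>n. distinct (Ilist B n) \<and> 0 \<notin> set (Ilist B n))"

lemma valid_field_mallowsN:
  assumes "valid_field B"
  shows "0 < mallowsN B (Suc k)" "mallowsN B (Suc k) = mallowsN B (Suc j) \<longleftrightarrow> k = j"
proof -
  have "mallowsN B (Suc k) \<in> set (Ilist B (Suc k))" using Ilist_nth[of k "Suc k" B] nth_mem[of k "Ilist B (Suc k)"] by simp
  moreover have "0 \<notin> set (Ilist B (Suc k))" using assms unfolding valid_field_def by blast
  ultimately show "0 < mallowsN B (Suc k)" by (metis gr0I)
  let ?n = "Suc (max k j)"
  have "distinct (Ilist B ?n)" using assms unfolding valid_field_def by blast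
  then have "Ilist B ?n ! k = Ilist B ?n ! j \<longleftrightarrow> k = j" by (subst nth_eq_iff_index_eq) auto
  moreover have "Ilist B ?n ! k = mallowsN B (Suc k)" "Ilist B ?n ! j = mallowsN B (Suc j)"
    by (rule Ilist_nth, simp)+
  ultimately show "mallowsN B (Suc k) = mallowsN B (Suc j) \<longleftrightarrow> k = j" by simp
qed

lemma two_sided_ell:
  assumes "finite {i. Mv i \<noteq> 0}"
  shows "two_sided_mallows Bp Bm Mv (ell Mv (Suc j)) = int (mallowsN Bp (Suc j))"
proof -
  have sm: "strict_mono (\<lambda>j. ell Mv (Suc j))" by (rule ell_strict_mono[OF is_lambda_Lambda_seq[OF assms]])
  have inj: "ell Mv (Suc i) = ell Mv (Suc j) \<longleftrightarrow> i = j" for i using strict_mono_eq[OF sm, of i j] .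
  have "(THE i. i \<ge> 1 \<and> ell Mv i = ell Mv (Suc j)) = Suc j"
  proof (rule the_equality)
    fix i assume "1 \<le> i \<and> ell Mv i = ell Mv (Suc j)"
    then show "i = Suc j" using inj[of "i - 1"] by (cases i) auto
  qed simp
  moreover have "\<exists>i\<ge>1. ell Mv i = ell Mv (Suc j)" by (rule exI[of _ "Suc j"]) simp
  ultimately show ?thesis unfolding two_sided_mallows_def by simp
qed

lemma two_sided_kelt:
  assumes "finite {i. Mv i \<noteq> 0}"
  shows "two_sided_mallows Bp Bm Mv (kelt Mv m) = 1 - int (mallowsN Bm (Suc m))"
proof -
  have "kelt Mv m \<in> ell_compl Mv" using kelt_inj(2)[OF assms] by blast
  then have "kelt Mv m \<notin> ell Mv ` {1..}" unfolding ell_compl_def by simp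
  then have nex: "\<not> (\<exists>i\<ge>1. ell Mv i = kelt Mv m)" by (metis atLeast_iff imageI)
  have the: "(THE m'. kelt Mv m' = kelt Mv m) = m"
    by (rule the_equality) (use kelt_inj(1)[OF assms] in \<open>auto dest: injD\<close>)
  show ?thesis unfolding two_sided_mallows_def if_not_P[OF nex] the by simp
qed

lemma ell_kelt_cases:
  assumes "finite {i. Mv i \<noteq> 0}"
  obtains (ell) j where "z = ell Mv (Suc j)" "z \<in> ell_set Mv" | (kelt) m where "z = kelt Mv m" "z \<notin> ell_set Mv"
proof (cases "z \<in> ell_set Mv")
  case True
  then show ?thesis using ell unfolding ell_set_def by blast
next
  case False
  then have "z \<in> range (kelt Mv)" unfolding kelt_inj(2)[OF assms] ell_compl_eq by simp
  then show ?thesis using kelt False by blast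
qed

lemma two_sided_pos_iff:
  assumes "finite {i. Mv i \<noteq> 0}" "valid_field Bp" "valid_field Bm"
  shows "0 < two_sided_mallows Bp Bm Mv z \<longleftrightarrow> z \<in> ell_set Mv"
proof -
  consider (ell) j where "z = ell Mv (Suc j)" "z \<in> ell_set Mv" | (kelt) m where "z = kelt Mv m" "z \<notin> ell_set Mv"
    using ell_kelt_cases[OF assms(1), of z] by blast
  then show ?thesis
  proof cases
  case (ell j)
  then show ?thesis using two_sided_ell[OF assms(1), of Bp Bm j] valid_field_mallowsN(1)[OF assms(2), of j] by simp
next
  case (kelt m)
  then show ?thesis using two_sided_kelt[OF assms(1), of Bp Bm m] valid_field_mallowsN(1)[OF assms(3), of m] by simp
  qed
qed

lemma two_sided_inj:
  assumes fin: "finite {i. Mv i \<noteq> 0}" and v: "valid_field Bp" "valid_field Bm"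
  shows "inj (two_sided_mallows Bp Bm Mv)"
proof (rule injI)
  fix z z' assume eq: "two_sided_mallows Bp Bm Mv z = two_sided_mallows Bp Bm Mv z'"
  have pos: "z \<in> ell_set Mv \<longleftrightarrow> z' \<in> ell_set Mv"
    using two_sided_pos_iff[OF fin v, of z] two_sided_pos_iff[OF fin v, of z'] eq by simp
  consider (ell) j where "z = ell Mv (Suc j)" "z \<in> ell_set Mv" | (kelt) m where "z = kelt Mv m" "z \<notin> ell_set Mv"
    using ell_kelt_cases[OF fin, of z] by blast
  then show "z = z'"
  proof cases
    case (ell j)
    then obtain j' where "z' = ell Mv (Suc j')" using pos unfolding ell_set_def by blast
    then show ?thesis using eq ell two_sided_ell[OF fin, of Bp Bm] valid_field_mallowsN(2)[OF v(1), of j j'] by simp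
  next
    case (kelt m)
    then have "z' \<in> range (kelt Mv)" using pos unfolding kelt_inj(2)[OF fin] ell_compl_eq by simp
    then obtain m' where "z' = kelt Mv m'" by blast
    then show ?thesis using eq kelt two_sided_kelt[OF fin, of Bp Bm] valid_field_mallowsN(2)[OF v(2), of m m'] by simp
  qed
qed

text \<open>To the right of a fitting box all values are positive and to its left none is, so both
  exceptional sets lie in a bounded interval.\<close>

lemma two_sided_admissible:
  assumes fin: "finite {i. Mv i \<noteq> 0}" and v: "valid_field Bp" "valid_field Bm"
  shows "admissible (two_sided_mallows Bp Bm Mv)"
proof -
  let ?X = "two_sided_mallows Bp Bm Mv"
  obtain K where K: "fits K K Mv" using fits_eventually[OF fin] by blast
  have "{i. i \<ge> 1 \<and> ?X i < 1} \<subseteq> {1..int K}"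
  proof
    fix i assume i: "i \<in> {i. i \<ge> 1 \<and> ?X i < 1}"
    then have "i \<notin> ell_set Mv" using two_sided_pos_iff[OF fin v, of i] by auto
    then have "\<not> int K < i" using fits_ell_set(2)[OF K] by blast
    then show "i \<in> {1..int K}" using i by simp
  qed
  then have 1: "finite {i. i \<ge> 1 \<and> ?X i < 1}" by (rule finite_subset) simp
  have "{i. i < 1 \<and> ?X i \<ge> 1} \<subseteq> {1 - int K..1}"
  proof
    fix i assume i: "i \<in> {i. i < 1 \<and> ?X i \<ge> 1}"
    then have "i \<in> ell_set Mv" using two_sided_pos_iff[OF fin v, of i] by auto
    then show "i \<in> {1 - int K..1}" using fits_ell_set(1)[OF K] i by simp
  qed
  then have 2: "finite {i. i < 1 \<and> ?X i \<ge> 1}" by (rule finite_subset) simp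
  show ?thesis unfolding admissible_def using two_sided_inj[OF assms] 1 2 by blast
qed

definition signs :: "nat \<Rightarrow> nat \<Rightarrow> (nat \<Rightarrow> nat) \<Rightarrow> bool list" where
  "signs a b Mv = map (\<lambda>z. z \<in> ell_set Mv) [1 - int b..int a]"

text \<open>The three parts depend on \<open>Mv\<close>, \<open>Bp\<close> and \<open>Bm\<close>
  separately, which are independent. The reversal and \<open>1 - int y\<close> come from the
  reflection that defines the nonpositive half.\<close>

lemma window_split:
  assumes f: "fits a b Mv" and v: "valid_field Bp" "valid_field Bm"
  defines "xs \<equiv> map (two_sided_mallows Bp Bm Mv) [1 - int b..int a]"
  shows "map (\<lambda>x. 0 < x) xs = signs a b Mv" "filter (\<lambda>x. 0 < x) xs = map int (Ilist Bp a)"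
    "filter (\<lambda>x. x \<le> 0) xs = rev (map (\<lambda>y. 1 - int y) (Ilist Bm b))" "distinct xs"
proof -
  have fin: "finite {i. Mv i \<noteq> 0}" using f unfolding fits_def by blast
  let ?X = "two_sided_mallows Bp Bm Mv"
  show "map (\<lambda>x. 0 < x) xs = signs a b Mv"
    unfolding xs_def signs_def using two_sided_pos_iff[OF fin v] by simp
  have "filter (\<lambda>x. 0 < x) xs = map ?X (filter (\<lambda>z. z \<in> ell_set Mv) [1 - int b..int a])"
    unfolding xs_def filter_map o_def using two_sided_pos_iff[OF fin v] by simp
  also have "\<dots> = map int (Ilist Bp a)"
    unfolding fits_filter_ell[OF f] Ilist_eq_map by (simp add: two_sided_ell[OF fin])
  finally show "filter (\<lambda>x. 0 < x) xs = map int (Ilist Bp a)" .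
  have ks: "filter (\<lambda>z. z \<notin> ell_set Mv) [1 - int b..int a] = rev (map (kelt Mv) [0..<b])"
  proof (rule nth_equalityI)
    show "length (filter (\<lambda>z. z \<notin> ell_set Mv) [1 - int b..int a]) = length (rev (map (kelt Mv) [0..<b]))"
      using fits_compl_length[OF f] by simp
    fix i assume "i < length (filter (\<lambda>z. z \<notin> ell_set Mv) [1 - int b..int a])"
    then have "i < b" using fits_compl_length[OF f] by simp
    then show "filter (\<lambda>z. z \<notin> ell_set Mv) [1 - int b..int a] ! i = rev (map (kelt Mv) [0..<b]) ! i"
      using fits_kelt[OF f, of "b - 1 - i"] by (simp add: rev_nth)
  qed
  have "filter (\<lambda>x. x \<le> 0) xs = map ?X (filter (\<lambda>z. z \<notin> ell_set Mv) [1 - int b..int a])"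
    unfolding xs_def filter_map o_def using two_sided_pos_iff[OF fin v] by (simp add: not_less[symmetric])
  also have "\<dots> = rev (map (\<lambda>y. 1 - int y) (Ilist Bm b))"
    unfolding ks Ilist_eq_map by (simp add: two_sided_kelt[OF fin] rev_map)
  finally show "filter (\<lambda>x. x \<le> 0) xs = rev (map (\<lambda>y. 1 - int y) (Ilist Bm b))" .
  show "distinct xs"
    unfolding xs_def using inj_on_subset[OF two_sided_inj[OF fin v] subset_UNIV] by (simp add: distinct_map)
qed

section \<open>The size of the partition and its lattice path\<close>

lemma area_sorted:
  fixes zs :: "'a::linorder list"
  shows "sorted_wrt (<) zs \<Longrightarrow> area (map f zs) = (\<Sum>z\<in>{z \<in> set zs. f z}. card {y \<in> set zs. z < y \<and> \<not> f y})"
proof (induction zs)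
  case (Cons x zs)
  have d: "distinct (x # zs)" and lt: "\<And>y. y \<in> set zs \<Longrightarrow> x < y" using Cons.prems strict_sorted_iff[of "x # zs"] by auto
  have "length (filter Not (map f zs)) = card (set (filter (\<lambda>y. \<not> f y) zs))"
    using d distinct_card[of "filter (\<lambda>y. \<not> f y) zs"] by (simp add: filter_map o_def)
  also have "set (filter (\<lambda>y. \<not> f y) zs) = {y \<in> set (x # zs). x < y \<and> \<not> f y}" using lt by auto
  finally have h: "length (filter Not (map f zs)) = card {y \<in> set (x # zs). x < y \<and> \<not> f y}" .
  have t: "card {y \<in> set zs. z < y \<and> \<not> f y} = card {y \<in> set (x # zs). z < y \<and> \<not> f y}" if "z \<in> set zs" for z
  proof -
    have "{y \<in> set zs. z < y \<and> \<not> f y} = {y \<in> set (x # zs). z < y \<and> \<not> f y}" using lt[OF that] by auto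
    then show ?thesis by simp
  qed
  have IH: "area (map f zs) = (\<Sum>z\<in>{z \<in> set zs. f z}. card {y \<in> set (x # zs). z < y \<and> \<not> f y})"
    using Cons t by simp
  show ?case
  proof (cases "f x")
    case True
    have "{z \<in> set (x # zs). f z} = insert x {z \<in> set zs. f z}" using True by auto
    moreover have "x \<notin> {z \<in> set zs. f z}" using d by simp
    ultimately show ?thesis using IH h True by (simp only: list.map area.simps) (simp del: set_simps)
  next
    case False
    have "{z \<in> set (x # zs). f z} = {z \<in> set zs. f z}" using False by auto
    then show ?thesis using IH False by (simp only: list.map area.simps) simp
  qed
qed simp

text \<open>To the right of \<open>ell Mv (Suc j)\<close> the window has
  \<open>a - Suc j + Lambda_seq Mv j\<close> positions, and \<open>a - Suc j\<close> of them are
  later values of \<open>ell\<close>.\<close>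

lemma fits_falses_after:
  assumes "fits a b Mv" "j < a"
  shows "card {y \<in> {1 - int b..int a}. ell Mv (Suc j) < y \<and> y \<notin> ell_set Mv} = Lambda_seq Mv j"
proof -
  let ?e = "\<lambda>j. ell Mv (Suc j)"
  have sm: "strict_mono ?e" by (rule ell_strict_mono[OF fits_lambda[OF assms(1)]])
  have ej: "1 - int b \<le> ?e j" "?e j \<le> int a" using fits_ell(1)[OF assms] by auto
  have "{?e j<..int a} = {y \<in> {1 - int b..int a}. ?e j < y \<and> y \<notin> ell_set Mv} \<union> ?e ` {j<..<a}"
  proof (intro set_eqI iffI)
    fix y assume y: "y \<in> {?e j<..int a}"
    show "y \<in> {y \<in> {1 - int b..int a}. ?e j < y \<and> y \<notin> ell_set Mv} \<union> ?e ` {j<..<a}"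
    proof (cases "y \<in> ell_set Mv")
      case True
      then have "y \<in> ell_set Mv \<inter> {1 - int b..int a}" using y ej by simp
      then obtain i where i: "y = ?e i" "i < a" unfolding fits_ell_set(3)[OF assms(1)] by blast
      have "j < i" using y i strict_mono_less[OF sm, of j i] by simp
      then show ?thesis using i by auto
    next
      case False
      then show ?thesis using y ej by simp
    qed
  next
    fix y assume "y \<in> {y \<in> {1 - int b..int a}. ?e j < y \<and> y \<notin> ell_set Mv} \<union> ?e ` {j<..<a}"
    then show "y \<in> {?e j<..int a}"
    proof
      assume "y \<in> ?e ` {j<..<a}"
      then obtain i where i: "y = ?e i" "j < i" "i < a" by auto
      then show ?thesis using strict_monoD[OF sm i(2)] fits_ell(1)[OF assms(1) i(3)] by simp
    qed simp
  qed
  moreover have "{y \<in> {1 - int b..int a}. ?e j < y \<and> y \<notin> ell_set Mv} \<inter> ?e ` {j<..<a} = {}"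
    unfolding ell_set_def by blast
  ultimately have "card {?e j<..int a} = card {y \<in> {1 - int b..int a}. ?e j < y \<and> y \<notin> ell_set Mv} + card (?e ` {j<..<a})"
    by (simp only:) (rule card_Un_disjoint, auto intro: finite_subset[of _ "{1 - int b..int a}"])
  moreover have "card (?e ` {j<..<a}) = a - Suc j"
    using strict_mono_imp_inj_on[OF sm] by (subst card_image) (auto intro: inj_on_subset)
  moreover have "int (card {?e j<..int a}) = int a - ?e j" using ej by simp
  ultimately show ?thesis using assms(2) unfolding ell_def by simp
qed

lemma area_signs:
  assumes "fits a b Mv"
  shows "area (signs a b Mv) = (\<Sum>j<a. Lambda_seq Mv j)"
proof -
  let ?e = "\<lambda>j. ell Mv (Suc j)"
  have sm: "strict_mono ?e" by (rule ell_strict_mono[OF fits_lambda[OF assms(1)]])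
  have set: "{z \<in> set [1 - int b..int a]. z \<in> ell_set Mv} = ?e ` {..<a}"
    using fits_ell_set(3)[OF assms] by auto
  have "area (signs a b Mv) = (\<Sum>z\<in>?e ` {..<a}. card {y \<in> {1 - int b..int a}. z < y \<and> y \<notin> ell_set Mv})"
    unfolding signs_def area_sorted[OF sorted_wrt_upto] set by simp
  also have "\<dots> = (\<Sum>j<a. card {y \<in> {1 - int b..int a}. ?e j < y \<and> y \<notin> ell_set Mv})"
    by (subst sum.reindex) (auto intro: inj_on_subset[OF strict_mono_imp_inj_on[OF sm]])
  also have "\<dots> = (\<Sum>j<a. Lambda_seq Mv j)" by (rule sum.cong[OF refl], rule fits_falses_after[OF assms]) simp
  finally show ?thesis .
qed

lemma fits_support: "fits a b Mv \<Longrightarrow> b \<le> i \<Longrightarrow> Mv i = 0"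
proof -
  assume f: "fits a b Mv" and i: "b \<le> i"
  have lam: "is_lambda Mv (Lambda_seq Mv)" by (rule fits_lambda[OF f])
  have "Lambda_seq Mv j \<noteq> Suc i" for j
    using is_lambda_bound[OF lam, of j] f i unfolding fits_def by simp
  then have "{j. Lambda_seq Mv j = Suc i} = {}" by simp
  moreover have "card {j. Lambda_seq Mv j = Suc i} = Mv i" using lam unfolding is_lambda_def by blast
  ultimately show ?thesis by simp
qed

text \<open>The size of the partition, counted by parts and by multiplicities. The second form is
  the exponent of \<open>q\<close> produced by the geometric weights.\<close>

lemma sum_Lambda_seq:
  assumes f: "fits a b Mv"
  shows "(\<Sum>j<a. Lambda_seq Mv j) = (\<Sum>i<b. Suc i * Mv i)"
proof -
  let ?l = "Lambda_seq Mv"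
  have lam: "is_lambda Mv ?l" by (rule fits_lambda[OF f])
  have le: "?l j \<le> b" for j using is_lambda_bound[OF lam, of j] f unfolding fits_def by simp
  have "(\<Sum>j<a. ?l j) = (\<Sum>v\<in>{..b}. \<Sum>j\<in>{j \<in> {..<a}. ?l j = v}. ?l j)"
    by (rule sum.group[symmetric]) (use le in auto)
  also have "\<dots> = (\<Sum>v\<in>{..b}. v * card {j \<in> {..<a}. ?l j = v})"
    by (rule sum.cong) (auto simp: mult.commute)
  also have "{..b} = insert 0 (Suc ` {..<b})" by (auto simp: image_Suc_lessThan)
  also have "(\<Sum>v\<in>insert 0 (Suc ` {..<b}). v * card {j \<in> {..<a}. ?l j = v}) = (\<Sum>i<b. Suc i * card {j \<in> {..<a}. ?l j = Suc i})"
    by (subst sum.insert) (auto simp: sum.reindex)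
  also have "\<dots> = (\<Sum>i<b. Suc i * Mv i)"
  proof (rule sum.cong[OF refl])
    fix i
    have "{j \<in> {..<a}. ?l j = Suc i} = {j. ?l j = Suc i}"
    proof -
      have "j < a" if "?l j = Suc i" for j using f that unfolding fits_def by (cases "a \<le> j") auto
      then show ?thesis by auto
    qed
    then show "Suc i * card {j \<in> {..<a}. ?l j = Suc i} = Suc i * Mv i" using lam unfolding is_lambda_def by simp
  qed
  finally show ?thesis .
qed

lemma signs_inj:
  assumes f: "fits a b Mv" "fits a b Mv'" and eq: "signs a b Mv = signs a b Mv'"
  shows "Mv = Mv'"
proof -
  have "\<forall>z\<in>set [1 - int b..int a]. z \<in> ell_set Mv \<longleftrightarrow> z \<in> ell_set Mv'"
    using eq unfolding signs_def by simp
  then have "filter (\<lambda>z. z \<in> ell_set Mv) [1 - int b..int a] = filter (\<lambda>z. z \<in> ell_set Mv') [1 - int b..int a]"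
    by (intro filter_cong) auto
  then have "map (\<lambda>j. ell Mv (Suc j)) [0..<a] = map (\<lambda>j. ell Mv' (Suc j)) [0..<a]"
    unfolding fits_filter_ell[OF f(1)] fits_filter_ell[OF f(2)] .
  then have e: "ell Mv (Suc j) = ell Mv' (Suc j)" if "j < a" for j using that by simp
  have "Lambda_seq Mv j = Lambda_seq Mv' j" for j
  proof (cases "j < a")
    case True
    then show ?thesis using e[OF True] unfolding ell_def by simp
  next
    case False
    then show ?thesis using f unfolding fits_def by simp
  qed
  then have l: "Lambda_seq Mv = Lambda_seq Mv'" by blast
  show ?thesis
  proof
    fix i
    have "Mv i = card {j. Lambda_seq Mv j = Suc i}" "Mv' i = card {j. Lambda_seq Mv' j = Suc i}"
      using fits_lambda[OF f(1)] fits_lambda[OF f(2)] unfolding is_lambda_def by auto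
    then show "Mv i = Mv' i" using l by simp
  qed
qed

text \<open>A word with \<open>a\<close> letters \<open>True\<close> and \<open>b\<close> letters
  \<open>False\<close> is the boundary path of a partition in the box.\<close>

lemma signs_surj:
  assumes len: "length S = a + b" and tr: "length (filter id S) = a"
  shows "\<exists>Mv. fits a b Mv \<and> signs a b Mv = S"
proof -
  define ps where "ps = filter (\<lambda>k. S ! k) [0..<a + b]"
  have "length ps = length (filter id (map ((!) S) [0..<a + b]))" unfolding ps_def by (simp add: filter_map o_def)
  also have "map ((!) S) [0..<a + b] = S" using len by (metis map_nth)
  finally have lps: "length ps = a" using tr by (simp only:)
  have sps: "sorted_wrt (<) ps" unfolding ps_def by (rule sorted_wrt_filter) simp
  have up: "j \<le> ps ! j" if "j < a" for j
    using that
  proof (induction j)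
    case (Suc j)
    then have "ps ! j < ps ! Suc j" using sps lps by (simp add: sorted_wrt_iff_nth_less)
    then show ?case using Suc by simp
  qed simp
  have step: "ps ! i - i \<le> ps ! j - j" if "i \<le> j" "j < a" for i j
    using that
  proof (induction j)
    case (Suc j)
    show ?case
    proof (cases "i = Suc j")
      case False
      then have "ps ! i - i \<le> ps ! j - j" using Suc by simp
      moreover have "ps ! j < ps ! Suc j" using Suc sps lps by (simp add: sorted_wrt_iff_nth_less)
      ultimately show ?thesis by simp
    qed simp
  qed simp
  have hi: "ps ! j - j \<le> b" if "j < a" for j
  proof -
    have "ps ! (a - 1) \<in> set ps" using lps that by (intro nth_mem) simp
    then have "ps ! (a - 1) < a + b" unfolding ps_def by simp
    then have "ps ! (a - 1) - (a - 1) \<le> b" using that by simp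
    moreover have "ps ! j - j \<le> ps ! (a - 1) - (a - 1)" by (rule step) (use that in auto)
    ultimately show ?thesis by linarith
  qed
  \<comment> \<open>\<open>ps ! j - j\<close> counts the \<open>False\<close> letters before the
    \<open>True\<close> with index \<open>j\<close>, so the part is the number of
    \<open>False\<close> letters after it. The facts \<open>up\<close> and \<open>hi\<close> make
    both natural subtractions exact.\<close>
  define lam where "lam j = (if j < a then b - (ps ! j - j) else 0)" for j
  define Mv where "Mv i = card {j. lam j = Suc i}" for i
  have "antimono lam"
  proof (rule antimonoI)
    fix i j :: nat assume "i \<le> j"
    then show "lam j \<le> lam i" unfolding lam_def using step[of i j] by auto
  qed
  moreover have z: "\<forall>j\<ge>a. lam j = 0" unfolding lam_def by simp
  ultimately have il: "is_lambda Mv lam" unfolding is_lambda_def Mv_def by blast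
  have L: "Lambda_seq Mv = lam" by (rule Lambda_seqI[OF il])
  have fits: "fits a b Mv"
    unfolding fits_def L using z is_lambda_finite_support[OF il] by (auto simp: lam_def)
  have e: "ell Mv (Suc j) = 1 - int b + int (ps ! j)" if "j < a" for j
    unfolding ell_def L lam_def using that up[OF that] hi[OF that] by simp
  have "signs a b Mv = S"
  proof (rule nth_equalityI)
    show "length (signs a b Mv) = length S" unfolding signs_def using len by simp
    fix k assume "k < length (signs a b Mv)"
    then have k: "k < a + b" unfolding signs_def by simp
    have "[1 - int b..int a] ! k = 1 - int b + int k" using k by (simp add: nth_upto)
    then have "signs a b Mv ! k \<longleftrightarrow> 1 - int b + int k \<in> ell_set Mv" unfolding signs_def using k by simp
    also have "\<dots> \<longleftrightarrow> 1 - int b + int k \<in> ell_set Mv \<inter> {1 - int b..int a}" using k by simp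
    also have "\<dots> \<longleftrightarrow> (\<exists>j<a. k = ps ! j)" unfolding fits_ell_set(3)[OF fits] using e by auto
    also have "\<dots> \<longleftrightarrow> k \<in> set ps" using lps by (auto simp: in_set_conv_nth)
    also have "\<dots> \<longleftrightarrow> S ! k" unfolding ps_def using k by simp
    finally show "signs a b Mv ! k = S ! k" .
  qed
  then show ?thesis using fits by blast
qed

section \<open>The law of windows\<close>

definition hi_part :: "nat \<Rightarrow> nat list \<Rightarrow> nat list" where
  "hi_part b p = map (\<lambda>k. k - b) (filter (\<lambda>k. b < k) p)"

text \<open>Positions and values are both reflected, to undo the reflection of the nonpositive
  half.\<close>

definition lo_part :: "nat \<Rightarrow> nat list \<Rightarrow> nat list" where
  "lo_part b p = rev (map (\<lambda>k. b + 1 - k) (filter (\<lambda>k. k \<le> b) p))"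

lemma parts_props:
  assumes p: "distinct p" "set p = {1..a + b}"
  shows "distinct (hi_part b p)" "set (hi_part b p) = {1..a}" "inv_count (hi_part b p) = inv_count (filter (\<lambda>k. b < k) p)"
    and "distinct (lo_part b p)" "set (lo_part b p) = {1..b}" "inv_count (lo_part b p) = inv_count (filter (\<lambda>k. k \<le> b) p)"
    and "length (map (\<lambda>k. b < k) p) = a + b" "length (filter id (map (\<lambda>k. b < k) p)) = a"
proof -
  have sh: "set (filter (\<lambda>k. b < k) p) = {b + 1..a + b}" using p(2) by auto
  have sl: "set (filter (\<lambda>k. k \<le> b) p) = {1..b}" using p(2) by auto
  have smh: "strict_mono_on (set (filter (\<lambda>k. b < k) p)) (\<lambda>k. k - b)" unfolding sh by (rule strict_mono_onI) auto
  show "distinct (hi_part b p)" unfolding hi_part_def using p(1) strict_mono_on_imp_inj_on[OF smh] by (simp add: distinct_map)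
  have "(\<lambda>k. k - b) ` {b + 1..a + b} = {1..a}"
  proof (intro set_eqI iffI)
    fix x assume "x \<in> {1..a}"
    then show "x \<in> (\<lambda>k. k - b) ` {b + 1..a + b}" by (intro image_eqI[of _ _ "x + b"]) auto
  qed auto
  then show "set (hi_part b p) = {1..a}" unfolding hi_part_def set_map sh .
  show "inv_count (hi_part b p) = inv_count (filter (\<lambda>k. b < k) p)" unfolding hi_part_def by (rule inv_count_map[OF smh])
  have injl: "inj_on (\<lambda>k. b + 1 - k) (set (filter (\<lambda>k. k \<le> b) p))" unfolding sl by (auto simp: inj_on_def)
  show "distinct (lo_part b p)" unfolding lo_part_def using p(1) injl by (simp add: distinct_map)
  have "(\<lambda>k. b + 1 - k) ` {1..b} = {1..b}"
  proof (intro set_eqI iffI)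
    fix x assume "x \<in> {1..b}"
    then show "x \<in> (\<lambda>k. b + 1 - k) ` {1..b}" by (intro image_eqI[of _ _ "b + 1 - x"]) auto
  qed auto
  then show "set (lo_part b p) = {1..b}" unfolding lo_part_def set_rev set_map sl .
  show "inv_count (lo_part b p) = inv_count (filter (\<lambda>k. k \<le> b) p)" unfolding lo_part_def
  proof (rule inv_count_rev_map)
    fix x y assume "x \<in> set (filter (\<lambda>k. k \<le> b) p)" "y \<in> set (filter (\<lambda>k. k \<le> b) p)"
    then show "b + 1 - x < b + 1 - y \<longleftrightarrow> y < x" by auto
  qed
  show "length (map (\<lambda>k. b < k) p) = a + b" using distinct_card[OF p(1)] p(2) by simp
  have "length (filter (\<lambda>k. b < k) p) = card (set (filter (\<lambda>k. b < k) p))" using p(1) by (intro distinct_card[symmetric] distinct_filter)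
  also have "\<dots> = a" unfolding sh by simp
  finally show "length (filter id (map (\<lambda>k. b < k) p)) = a" by (simp add: filter_map o_def)
qed

text \<open>Equality with \<open>p\<close> decouples into conditions on the three independent
  inputs. The reflection is undone because \<open>k\<close> to \<open>b + 1 - k\<close> is an
  involution of \<open>{1..b}\<close>.\<close>

lemma window_pattern_iff:
  assumes f: "fits a b Mv" and v: "valid_field Bp" "valid_field Bm" and p: "distinct p" "set p = {1..a + b}"
  shows "pattern (map (two_sided_mallows Bp Bm Mv) [1 - int b..int a]) = p \<longleftrightarrow>
    signs a b Mv = map (\<lambda>k. b < k) p \<and> pattern (Ilist Bp a) = hi_part b p \<and> pattern (Ilist Bm b) = lo_part b p"
proof -
  define xs where "xs = map (two_sided_mallows Bp Bm Mv) [1 - int b..int a]"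
  note w = window_split[OF f v, folded xs_def]
  have lb: "length (filter (\<lambda>x. x \<le> 0) xs) = b" unfolding w(3) by simp
  note ps = pattern_split[OF w(4), of 0, unfolded lb]
  have A: "map (\<lambda>k. b < k) (pattern xs) = signs a b Mv" unfolding ps(1) w(1) ..
  have "pattern (map int (Ilist Bp a)) = pattern (Ilist Bp a)" by (rule pattern_map) (auto simp: strict_mono_on_def)
  then have B: "filter (\<lambda>k. b < k) (pattern xs) = map (\<lambda>k. k + b) (pattern (Ilist Bp a))" unfolding ps(2) w(2) by simp
  have dm: "distinct (Ilist Bm b)" using v(2) unfolding valid_field_def by blast
  have "pattern (rev (map (\<lambda>y. 1 - int y) (Ilist Bm b))) = rev (map (\<lambda>k. length (Ilist Bm b) + 1 - k) (pattern (Ilist Bm b)))"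
    by (rule pattern_rev_map[OF dm]) auto
  then have C: "filter (\<lambda>k. k \<le> b) (pattern xs) = rev (map (\<lambda>k. b + 1 - k) (pattern (Ilist Bm b)))" unfolding ps(3) w(3) by simp
  have sQ: "set (pattern (Ilist Bm b)) = {1..b}" using set_pattern[OF dm] by simp
  show ?thesis unfolding xs_def[symmetric]
  proof
    assume eq: "pattern xs = p"
    have "hi_part b p = pattern (Ilist Bp a)" unfolding hi_part_def eq[symmetric] B by (simp add: o_def)
    moreover have "lo_part b p = map (\<lambda>k. b + 1 - (b + 1 - k)) (pattern (Ilist Bm b))"
      unfolding lo_part_def eq[symmetric] C by (simp add: rev_map o_def)
    moreover have "map (\<lambda>k. b + 1 - (b + 1 - k)) (pattern (Ilist Bm b)) = pattern (Ilist Bm b)"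
      by (rule map_idI) (use sQ in auto)
    ultimately show "signs a b Mv = map (\<lambda>k. b < k) p \<and> pattern (Ilist Bp a) = hi_part b p \<and> pattern (Ilist Bm b) = lo_part b p"
      using A eq by simp
  next
    assume h: "signs a b Mv = map (\<lambda>k. b < k) p \<and> pattern (Ilist Bp a) = hi_part b p \<and> pattern (Ilist Bm b) = lo_part b p"
    show "pattern xs = p"
    proof (rule list_eq_by_split[where P="\<lambda>k. b < k"])
      show "map (\<lambda>k. b < k) (pattern xs) = map (\<lambda>k. b < k) p" using A h by simp
      have "filter (\<lambda>k. b < k) (pattern xs) = map (\<lambda>k. k - b + b) (filter (\<lambda>k. b < k) p)"
        unfolding B using h by (simp add: hi_part_def o_def)
      also have "\<dots> = filter (\<lambda>k. b < k) p" by (rule map_idI) auto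
      finally show "filter (\<lambda>k. b < k) (pattern xs) = filter (\<lambda>k. b < k) p" .
      have "filter (\<lambda>k. k \<le> b) (pattern xs) = map (\<lambda>k. b + 1 - (b + 1 - k)) (filter (\<lambda>k. k \<le> b) p)"
        unfolding C using h by (simp add: lo_part_def rev_map o_def)
      also have "\<dots> = filter (\<lambda>k. k \<le> b) p" by (rule map_idI) auto
      finally show "filter (\<lambda>k. \<not> b < k) (pattern xs) = filter (\<lambda>k. \<not> b < k) p" by (simp add: not_less)
    qed
  qed
qed

section \<open>The law of the multiplicities and the joint probability space\<close>

lemma prob_space_geom_field: "prob_space (geom_field q)"
  unfolding geom_field_def by (intro prob_space_PiM measure_pmf.prob_space_axioms)

lemma space_geom_field [simp]: "space (geom_field q) = UNIV"
  by (simp add: geom_field_def space_PiM)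

lemma measurable_geom_component [measurable]: "(\<lambda>M. M i) \<in> geom_field q \<rightarrow>\<^sub>M count_space UNIV"
proof -
  have "(\<lambda>M. M i) \<in> geom_field q \<rightarrow>\<^sub>M measure_pmf (geometric_pmf (1 - q ^ Suc i))"
    unfolding geom_field_def by (rule measurable_component_singleton) simp
  then show ?thesis by (simp cong: measurable_cong_sets)
qed

lemma sets_geom_singleton: "{m} \<in> sets (geom_field q)"
proof -
  have "{M \<in> space (geom_field q). \<forall>i. M i = m i} \<in> sets (geom_field q)" by measurable
  moreover have "{M \<in> space (geom_field q). \<forall>i. M i = m i} = {m}" by auto
  ultimately show ?thesis by simp
qed

lemma measure_geom_prefix:
  assumes q: "0 \<le> q" "q < 1"
  shows "measure (geom_field q) {M. \<forall>i<n. M i = m i} = (\<Prod>i<n. (q ^ Suc i) ^ m i * (1 - q ^ Suc i))"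
proof -
  interpret P: product_prob_space "\<lambda>i. measure_pmf (geometric_pmf (1 - q ^ Suc i))" "UNIV :: nat set"
    by unfold_locales
  have "prod_emb UNIV (\<lambda>i. measure_pmf (geometric_pmf (1 - q ^ Suc i))) {..<n} (Pi\<^sub>E {..<n} (\<lambda>i. {m i})) = {M. \<forall>i<n. M i = m i}"
    by (simp add: prod_emb_def vimage_def restrict_PiE_iff Ball_def Pi_def)
  then have "measure (geom_field q) {M. \<forall>i<n. M i = m i} = (\<Prod>i<n. measure (geometric_pmf (1 - q ^ Suc i)) {m i})"
    unfolding geom_field_def using P.measure_PiM_emb[of "{..<n}" "\<lambda>i. {m i}"] by simp
  also have "\<dots> = (\<Prod>i<n. (q ^ Suc i) ^ m i * (1 - q ^ Suc i))"
  proof (rule prod.cong[OF refl])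
    fix i
    have "q ^ Suc i < 1" using q power_Suc_less_one[of q i] by (cases "q = 0") auto
    then have "0 < 1 - q ^ Suc i" "1 - q ^ Suc i \<le> 1" using q by auto
    then show "measure (geometric_pmf (1 - q ^ Suc i)) {m i} = (q ^ Suc i) ^ m i * (1 - q ^ Suc i)"
      by (simp add: measure_pmf_single)
  qed
  finally show ?thesis .
qed

text \<open>Relative to the zero sequence the weight is a finite product, since the factors
  \<open>1 - q ^ Suc i\<close> are common. The infinite product of these factors is the mass of the
  zero sequence; it appears only as a limit of prefix probabilities.\<close>

lemma measure_geom_singleton:
  assumes q: "0 \<le> q" "q < 1" and m: "\<And>i. b \<le> i \<Longrightarrow> m i = 0"
  shows "measure (geom_field q) {m} = q ^ (\<Sum>i<b. Suc i * m i) * measure (geom_field q) {\<lambda>_. 0}"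
proof -
  interpret prob_space "geom_field q" by (rule prob_space_geom_field)
  have lim: "(\<lambda>n. measure (geom_field q) {M. \<forall>i<n. M i = m i}) \<longlonglongrightarrow> measure (geom_field q) {m}" for m
  proof -
    have "(\<lambda>n. measure (geom_field q) {M. \<forall>i<n. M i = m i}) \<longlonglongrightarrow> measure (geom_field q) (\<Inter>n. {M. \<forall>i<n. M i = m i})"
    proof (rule finite_Lim_measure_decseq)
      have "{M \<in> space (geom_field q). \<forall>i<n. M i = m i} \<in> sets (geom_field q)" for n by measurable
      then show "range (\<lambda>n. {M. \<forall>i<n. M i = m i}) \<subseteq> sets (geom_field q)" by auto
      show "decseq (\<lambda>n. {M. \<forall>i<n. M i = m i})" by (rule decseq_SucI) auto
    qed
    moreover have "(\<Inter>n. {M. \<forall>i<n. M i = m i}) = {m}" by (auto intro!: ext)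
    ultimately show ?thesis by simp
  qed
  have "eventually (\<lambda>n. measure (geom_field q) {M. \<forall>i<n. M i = m i} =
     q ^ (\<Sum>i<b. Suc i * m i) * measure (geom_field q) {M. \<forall>i<n. M i = (\<lambda>_. 0) i}) sequentially"
    using eventually_ge_at_top[of b]
  proof eventually_elim
    case (elim n)
    have "(\<Prod>i<n. (q ^ Suc i) ^ m i) = (\<Prod>i<b. (q ^ Suc i) ^ m i)"
      by (rule prod.mono_neutral_right) (use elim m in auto)
    also have "\<dots> = (\<Prod>i<b. q ^ (Suc i * m i))" by (simp only: power_mult)
    also have "\<dots> = q ^ (\<Sum>i<b. Suc i * m i)" by (rule power_sum[symmetric])
    finally show ?case unfolding measure_geom_prefix[OF q] by (simp add: prod.distrib del: power_Suc)
  qed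
  then have "(\<lambda>n. measure (geom_field q) {M. \<forall>i<n. M i = m i}) \<longlonglongrightarrow> q ^ (\<Sum>i<b. Suc i * m i) * measure (geom_field q) {\<lambda>_. 0}"
    using tendsto_mult_left[OF lim[of "\<lambda>_. 0"], of "q ^ (\<Sum>i<b. Suc i * m i)"] by (subst tendsto_cong) auto
  then show ?thesis using lim[of m] LIMSEQ_unique by blast
qed

text \<open>The probabilities \<open>q ^ Suc i\<close> of a nonzero coordinate are summable, so
  Borel-Cantelli applies.\<close>

lemma AE_geom_finite:
  assumes q: "0 \<le> q" "q < 1"
  shows "AE M in geom_field q. finite {i. M i \<noteq> 0}"
proof -
  interpret prob_space "geom_field q" by (rule prob_space_geom_field)
  interpret P: product_prob_space "\<lambda>i. measure_pmf (geometric_pmf (1 - q ^ Suc i))" "UNIV :: nat set"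
    by unfold_locales
  define A where "A i = {M \<in> space (geom_field q). M i \<noteq> 0}" for i :: nat
  have A: "A i \<in> sets (geom_field q)" for i unfolding A_def by measurable
  have m: "measure (geom_field q) (A i) = q ^ Suc i" for i
  proof -
    have "q ^ Suc i < 1" using q power_Suc_less_one[of q i] by (cases "q = 0") auto
    then have p: "0 < 1 - q ^ Suc i" "1 - q ^ Suc i \<le> 1" using q by auto
    have "emeasure (geom_field q) {M \<in> space (geom_field q). M i \<in> - {0}} = emeasure (geometric_pmf (1 - q ^ Suc i)) (- {0})"
      unfolding geom_field_def by (rule P.emeasure_PiM_Collect_single) auto
    then have "measure (geom_field q) (A i) = measure (geometric_pmf (1 - q ^ Suc i)) (- {0})"
      unfolding A_def measure_def by simp
    also have "\<dots> = 1 - measure (geometric_pmf (1 - q ^ Suc i)) {0}"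
      using measure_pmf.prob_compl[of "{0}" "geometric_pmf (1 - q ^ Suc i)"] by (simp add: Compl_eq_Diff_UNIV)
    also have "\<dots> = q ^ Suc i" using p by (simp add: measure_pmf_single)
    finally show ?thesis .
  qed
  have "summable (\<lambda>i. measure (geom_field q) (A i))"
    unfolding m using q by (intro summable_Suc_iff[THEN iffD2] summable_geometric) simp
  from borel_cantelli_AE1[OF A _ this]
  have "AE M in geom_field q. eventually (\<lambda>i. M \<in> space (geom_field q) - A i) sequentially"
    by (simp add: emeasure_eq_measure)
  then show ?thesis
  proof eventually_elim
    case (elim M)
    then obtain N where N: "\<And>i. N \<le> i \<Longrightarrow> M i = 0" unfolding A_def eventually_sequentially by auto
    have "{i. M i \<noteq> 0} \<subseteq> {..<N}"
    proof
      fix i assume "i \<in> {i. M i \<noteq> 0}"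
      then show "i \<in> {..<N}" using N[of i] by (cases "N \<le> i") auto
    qed
    then show ?case by (rule finite_subset) simp
  qed
qed

lemma countable_finite_support: "countable {f :: nat \<Rightarrow> nat. finite {i. f i \<noteq> 0}}"
proof (rule countable_subset)
  let ?F = "\<lambda>l :: nat list. \<lambda>i. if i < length l then l ! i else 0"
  show "{f :: nat \<Rightarrow> nat. finite {i. f i \<noteq> 0}} \<subseteq> range ?F"
  proof
    fix f :: "nat \<Rightarrow> nat" assume "f \<in> {f. finite {i. f i \<noteq> 0}}"
    then obtain n where n: "\<And>i. f i \<noteq> 0 \<Longrightarrow> i < n" unfolding mem_Collect_eq finite_nat_set_iff_bounded by blast
    have "f = ?F (map f [0..<n])"
    proof
      fix i show "f i = ?F (map f [0..<n]) i" using n[of i] by (cases "i < n") auto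
    qed
    then show "f \<in> range ?F" by blast
  qed
qed simp

text \<open>For quantities that depend on \<open>Mv\<close> through definite descriptions. Finitely
  supported sequences are countably many, and each is a measurable singleton. All other sequences
  are merged into the constant sequence 1, where \<open>F\<close> has the same value.\<close>

lemma measurable_dep_finite_support:
  assumes g: "(\<lambda>\<omega>. Mv \<omega>) \<in> M \<rightarrow>\<^sub>M geom_field q"
    and F: "\<And>m. F m \<in> M \<rightarrow>\<^sub>M N"
    and const: "\<And>m. infinite {i. m i \<noteq> 0} \<Longrightarrow> F m = F (\<lambda>_. 1)"
  shows "(\<lambda>\<omega>. F (Mv \<omega>) \<omega>) \<in> M \<rightarrow>\<^sub>M N"
proof -
  define C where "C = {f :: nat \<Rightarrow> nat. finite {i. f i \<noteq> 0}}"
  have cC: "countable C" unfolding C_def by (rule countable_finite_support)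
  let ?c = "(\<lambda>_. 1) :: nat \<Rightarrow> nat"
  have cn: "?c \<notin> C" unfolding C_def by simp
  define h where "h m = (if m \<in> C then m else ?c)" for m
  have pre: "Mv -` {m} \<inter> space M \<in> sets M" for m
    by (rule measurable_sets[OF g sets_geom_singleton])
  have h: "(\<lambda>\<omega>. h (Mv \<omega>)) \<in> M \<rightarrow>\<^sub>M count_space (insert ?c C)"
  proof (subst measurable_count_space_eq_countable)
    show "countable (insert ?c C)" using cC by simp
    show "(\<lambda>\<omega>. h (Mv \<omega>)) \<in> space M \<rightarrow> insert ?c C \<and> (\<forall>a\<in>insert ?c C. (\<lambda>\<omega>. h (Mv \<omega>)) -` {a} \<inter> space M \<in> sets M)"
    proof (intro conjI ballI)
      fix a assume a: "a \<in> insert ?c C"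
      show "(\<lambda>\<omega>. h (Mv \<omega>)) -` {a} \<inter> space M \<in> sets M"
      proof (cases "a \<in> C")
        case True
        then have "(\<lambda>\<omega>. h (Mv \<omega>)) -` {a} \<inter> space M = Mv -` {a} \<inter> space M" using cn by (auto simp: h_def)
        then show ?thesis using pre by simp
      next
        case False
        then have "a = ?c" using a by simp
        then have "(\<lambda>\<omega>. h (Mv \<omega>)) -` {a} \<inter> space M = space M - (\<Union>m\<in>C. Mv -` {m} \<inter> space M)"
          using cn by (auto simp: h_def)
        moreover have "(\<Union>m\<in>C. Mv -` {m} \<inter> space M) \<in> sets M"
          by (rule sets.countable_UN'[OF cC]) (use pre in blast)
        ultimately show ?thesis by (simp only: sets.Diff[OF sets.top])
      qed
    qed (auto simp: h_def)
  qed
  have "(\<lambda>\<omega>. F (h (Mv \<omega>)) \<omega>) \<in> M \<rightarrow>\<^sub>M N"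
    by (rule measurable_compose_countable'[OF F h]) (use cC in auto)
  moreover have "F (h m) = F m" for m using const[of m] by (auto simp: h_def C_def)
  ultimately show ?thesis by simp
qed

lemma prob_space_two_sided: "prob_space (two_sided_field q)"
proof -
  interpret b: prob_space "bern_field q" by (rule prob_space_bern_field)
  interpret g: prob_space "geom_field q" by (rule prob_space_geom_field)
  interpret bg: pair_prob_space "bern_field q" "geom_field q" ..
  interpret bbg: pair_prob_space "bern_field q" "bern_field q \<Otimes>\<^sub>M geom_field q" ..
  show ?thesis unfolding two_sided_field_def by (rule bbg.P.prob_space_axioms)
qed

lemma space_two_sided [simp]: "space (two_sided_field q) = UNIV"
  by (simp add: two_sided_field_def space_pair_measure)

lemma measurable_two_sided_components [measurable]:
  "fst \<in> two_sided_field q \<rightarrow>\<^sub>M bern_field q"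
  "(\<lambda>\<omega>. fst (snd \<omega>)) \<in> two_sided_field q \<rightarrow>\<^sub>M bern_field q"
  "(\<lambda>\<omega>. snd (snd \<omega>)) \<in> two_sided_field q \<rightarrow>\<^sub>M geom_field q"
  unfolding two_sided_field_def by measurable

definition mallowsZ :: "(nat \<times> nat \<Rightarrow> bool) \<times> (nat \<times> nat \<Rightarrow> bool) \<times> (nat \<Rightarrow> nat) \<Rightarrow> int \<Rightarrow> int" where
  "mallowsZ \<omega> = two_sided_mallows (fst \<omega>) (fst (snd \<omega>)) (snd (snd \<omega>))"

lemma two_sided_mallows_cong:
  assumes "Lambda_seq Mv = Lambda_seq Mv'"
  shows "two_sided_mallows Bp Bm Mv = two_sided_mallows Bp Bm Mv'"
proof -
  have e: "ell Mv = ell Mv'" unfolding ell_def[abs_def] assms ..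
  then have "ell_compl Mv = ell_compl Mv'" unfolding ell_compl_def by simp
  then have k: "kelt Mv = kelt Mv'" unfolding kelt_def[abs_def] by simp
  show ?thesis unfolding two_sided_mallows_def[abs_def] e k ..
qed

lemma measurable_mallowsN [measurable]: "(\<lambda>B. mallowsN B i) \<in> bern_field q \<rightarrow>\<^sub>M count_space UNIV"
  unfolding mallowsN_def by (rule measurable_compose[OF measurable_Ilist, of "\<lambda>xs. xs ! (i - 1)"]) simp

lemma measurable_mallowsZ [measurable]: "(\<lambda>\<omega>. mallowsZ \<omega> z) \<in> two_sided_field q \<rightarrow>\<^sub>M count_space UNIV"
  unfolding mallowsZ_def
proof (rule measurable_dep_finite_support[where q=q and F="\<lambda>m \<omega>. two_sided_mallows (fst \<omega>) (fst (snd \<omega>)) m z"])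
  show "(\<lambda>\<omega>. snd (snd \<omega>)) \<in> two_sided_field q \<rightarrow>\<^sub>M geom_field q" by measurable
  fix m :: "nat \<Rightarrow> nat"
  show "(\<lambda>\<omega>. two_sided_mallows (fst \<omega>) (fst (snd \<omega>)) m z) \<in> two_sided_field q \<rightarrow>\<^sub>M count_space UNIV"
    unfolding two_sided_mallows_def by (cases "\<exists>i\<ge>1. ell m i = z") simp_all
  assume "infinite {i. m i \<noteq> 0}"
  then have "Lambda_seq m = Lambda_seq (\<lambda>_. 1)" using Lambda_seq_undefined[of m] Lambda_seq_undefined[of "\<lambda>_. 1"] by simp
  then show "(\<lambda>\<omega>. two_sided_mallows (fst \<omega>) (fst (snd \<omega>)) m z) = (\<lambda>\<omega>. two_sided_mallows (fst \<omega>) (fst (snd \<omega>)) (\<lambda>_. 1) z)"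
    using two_sided_mallows_cong by metis
qed

lemma measurable_map_count_space:
  fixes f :: "'a \<Rightarrow> 'b \<Rightarrow> 'c::countable"
  assumes "\<And>z. (\<lambda>\<omega>. f \<omega> z) \<in> M \<rightarrow>\<^sub>M count_space UNIV"
  shows "(\<lambda>\<omega>. map (f \<omega>) zs) \<in> M \<rightarrow>\<^sub>M count_space UNIV"
proof (induction zs)
  case (Cons z zs)
  have "(\<lambda>\<omega>. y # map (f \<omega>) zs) \<in> M \<rightarrow>\<^sub>M count_space UNIV" for y
    by (rule measurable_compose[OF Cons, of "\<lambda>l. y # l"]) simp
  from measurable_compose_countable[OF this assms[of z]] show ?case by simp
qed simp

lemma measurable_fits [measurable]: "(\<lambda>\<omega>. fits a b (snd (snd \<omega>))) \<in> two_sided_field q \<rightarrow>\<^sub>M count_space UNIV"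
  by (rule measurable_dep_finite_support[where q=q and F="\<lambda>m \<omega>. fits a b m"]) (auto simp: fits_def)

definition window :: "nat \<Rightarrow> nat \<Rightarrow> (nat \<times> nat \<Rightarrow> bool) \<times> (nat \<times> nat \<Rightarrow> bool) \<times> (nat \<Rightarrow> nat) \<Rightarrow> int list" where
  "window a b \<omega> = map (mallowsZ \<omega>) [1 - int b..int a]"

lemma measurable_window [measurable]: "window a b \<in> two_sided_field q \<rightarrow>\<^sub>M count_space UNIV"
  unfolding window_def[abs_def] by (rule measurable_map_count_space) measurable

lemma AE_valid_field:
  assumes "0 \<le> q" "q < 1" shows "AE B in bern_field q. valid_field B"
  using AE_Ilist[OF assms] unfolding valid_field_def by eventually_elim auto

lemma finite_support_iff:
  fixes m :: "nat \<Rightarrow> nat"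
  shows "finite {i. m i \<noteq> 0} \<longleftrightarrow> (\<exists>N. \<forall>i. N \<le> i \<longrightarrow> m i = 0)"
proof
  assume "finite {i. m i \<noteq> 0}"
  then obtain N where "\<forall>i\<in>{i. m i \<noteq> 0}. i < N" unfolding finite_nat_set_iff_bounded by blast
  then show "\<exists>N. \<forall>i. N \<le> i \<longrightarrow> m i = 0" by (intro exI[of _ N]) auto
next
  assume "\<exists>N. \<forall>i. N \<le> i \<longrightarrow> m i = 0"
  then obtain N where N: "\<And>i. N \<le> i \<Longrightarrow> m i = 0" by blast
  have "{i. m i \<noteq> 0} \<subseteq> {..<N}"
  proof
    fix i assume "i \<in> {i. m i \<noteq> 0}"
    then show "i \<in> {..<N}" using N[of i] by (cases "N \<le> i") auto
  qed
  then show "finite {i. m i \<noteq> 0}" by (rule finite_subset) simp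
qed

lemma AE_two_sided:
  assumes q: "0 \<le> q" "q < 1"
  shows "AE \<omega> in two_sided_field q. valid_field (fst \<omega>) \<and> valid_field (fst (snd \<omega>)) \<and> finite {i. snd (snd \<omega>) i \<noteq> 0}"
proof -
  interpret b: prob_space "bern_field q" by (rule prob_space_bern_field)
  interpret g: prob_space "geom_field q" by (rule prob_space_geom_field)
  interpret bg: pair_prob_space "bern_field q" "geom_field q" ..
  interpret bbg: pair_prob_space "bern_field q" "bern_field q \<Otimes>\<^sub>M geom_field q" ..
  have mv [measurable]: "Measurable.pred (bern_field q) valid_field"
  proof -
    have "Measurable.pred (bern_field q) (\<lambda>B. distinct (Ilist B n) \<and> 0 \<notin> set (Ilist B n))" for n
      by (rule measurable_compose[OF measurable_Ilist, of "\<lambda>xs. distinct xs \<and> 0 \<notin> set xs"]) simp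
    then show ?thesis unfolding valid_field_def[abs_def] by (intro pred_intros_countable)
  qed
  have mf [measurable]: "Measurable.pred (geom_field q) (\<lambda>m. finite {i. m i \<noteq> 0})"
    unfolding finite_support_iff by measurable
  have bg: "AE \<omega> in bern_field q \<Otimes>\<^sub>M geom_field q. valid_field (fst \<omega>) \<and> finite {i. snd \<omega> i \<noteq> 0}"
  proof (rule bg.AE_pair_measure)
    show "{x \<in> space (bern_field q \<Otimes>\<^sub>M geom_field q). valid_field (fst x) \<and> finite {i. snd x i \<noteq> 0}} \<in> sets (bern_field q \<Otimes>\<^sub>M geom_field q)"
      by measurable
    show "AE x in bern_field q. AE y in geom_field q. valid_field (fst (x, y)) \<and> finite {i. snd (x, y) i \<noteq> 0}"
      using AE_valid_field[OF q] by eventually_elim (use AE_geom_finite[OF q] in simp)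
  qed
  show ?thesis unfolding two_sided_field_def
  proof (rule bbg.AE_pair_measure)
    show "{x \<in> space (bern_field q \<Otimes>\<^sub>M bern_field q \<Otimes>\<^sub>M geom_field q). valid_field (fst x) \<and> valid_field (fst (snd x)) \<and> finite {i. snd (snd x) i \<noteq> 0}}
        \<in> sets (bern_field q \<Otimes>\<^sub>M bern_field q \<Otimes>\<^sub>M geom_field q)"
      by measurable
    show "AE x in bern_field q. AE y in bern_field q \<Otimes>\<^sub>M geom_field q.
       valid_field (fst (x, y)) \<and> valid_field (fst (snd (x, y))) \<and> finite {i. snd (snd (x, y)) i \<noteq> 0}"
      using AE_valid_field[OF q] by eventually_elim (use bg in simp)
  qed
qed

lemma measure_two_sided_rect:
  assumes "A \<in> sets (bern_field q)" "B \<in> sets (bern_field q)" "C \<in> sets (geom_field q)"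
  shows "measure (two_sided_field q) (A \<times> B \<times> C) = measure (bern_field q) A * (measure (bern_field q) B * measure (geom_field q) C)"
proof -
  interpret b: prob_space "bern_field q" by (rule prob_space_bern_field)
  interpret g: prob_space "geom_field q" by (rule prob_space_geom_field)
  interpret bg: pair_prob_space "bern_field q" "geom_field q" ..
  interpret bbg: pair_prob_space "bern_field q" "bern_field q \<Otimes>\<^sub>M geom_field q" ..
  have "emeasure (two_sided_field q) (A \<times> B \<times> C) = emeasure (bern_field q) A * emeasure (bern_field q \<Otimes>\<^sub>M geom_field q) (B \<times> C)"
    unfolding two_sided_field_def using assms by (intro bg.P.emeasure_pair_measure_Times) auto
  also have "emeasure (bern_field q \<Otimes>\<^sub>M geom_field q) (B \<times> C) = emeasure (bern_field q) B * emeasure (geom_field q) C"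
    using assms by (intro g.emeasure_pair_measure_Times) auto
  finally show ?thesis by (simp add: measure_def enn2real_mult)
qed

text \<open>The probability of the increasing pattern, that is \<open>1 / Z\<close> for size
  \<open>n\<close>.\<close>

definition sorted_prob :: "real \<Rightarrow> nat \<Rightarrow> real" where
  "sorted_prob q n = measure (Ipmf q n) {xs. sorted xs}"

lemma bern_prob_pattern:
  assumes q: "0 \<le> q" "q < 1" and p: "distinct p" "set p = {1..n}"
  shows "{B. pattern (Ilist B n) = p} \<in> sets (bern_field q)"
    and "measure (bern_field q) {B. pattern (Ilist B n) = p} = q ^ inv_count p * sorted_prob q n"
proof -
  have eq: "{B. pattern (Ilist B n) = p} = (\<lambda>B. Ilist B n) -` {xs. pattern xs = p} \<inter> space (bern_field q)" by auto
  show "{B. pattern (Ilist B n) = p} \<in> sets (bern_field q)"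
    unfolding eq by (rule measurable_sets[OF measurable_Ilist]) simp
  have "measure (bern_field q) {B. pattern (Ilist B n) = p} = measure (distr (bern_field q) (count_space UNIV) (\<lambda>B. Ilist B n)) {xs. pattern xs = p}"
    unfolding eq by (rule measure_distr[symmetric]) auto
  then show "measure (bern_field q) {B. pattern (Ilist B n) = p} = q ^ inv_count p * sorted_prob q n"
    unfolding distr_Ilist[OF q] sorted_prob_def using prob_pattern[OF q p] by simp
qed

text \<open>Almost surely the event is a product of events in the three factors. Their exponents of
  \<open>q\<close> are the inversions among the high values, those among the low values and the area
  of the interleaving, which \<open>inv_count_split\<close> adds up to \<open>inv_count p\<close>.
  The remaining factor does not depend on \<open>p\<close>.\<close>

lemma prob_window_pattern:
  assumes q: "0 \<le> q" "q < 1" and p: "distinct p" "set p = {1..a + b}"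
  shows "measure (two_sided_field q) {\<omega>. fits a b (snd (snd \<omega>)) \<and> pattern (window a b \<omega>) = p} =
    q ^ inv_count p * (sorted_prob q a * sorted_prob q b * measure (geom_field q) {\<lambda>_. 0})"
proof -
  interpret prob_space "two_sided_field q" by (rule prob_space_two_sided)
  note pp = parts_props[OF p]
  obtain m where m: "fits a b m" "signs a b m = map (\<lambda>k. b < k) p" using signs_surj[OF pp(7,8)] by blast
  let ?A = "{B. pattern (Ilist B a) = hi_part b p}" and ?B = "{B. pattern (Ilist B b) = lo_part b p}"
  have sets: "?A \<in> sets (bern_field q)" "?B \<in> sets (bern_field q)" "{m} \<in> sets (geom_field q)"
    using bern_prob_pattern(1)[OF q pp(1,2)] bern_prob_pattern(1)[OF q pp(4,5)] sets_geom_singleton by auto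
  have "measure (two_sided_field q) {\<omega>. fits a b (snd (snd \<omega>)) \<and> pattern (window a b \<omega>) = p} =
    measure (two_sided_field q) (?A \<times> ?B \<times> {m})"
  proof (rule finite_measure_eq_AE)
    show "AE \<omega> in two_sided_field q. \<omega> \<in> {\<omega>. fits a b (snd (snd \<omega>)) \<and> pattern (window a b \<omega>) = p} \<longleftrightarrow> \<omega> \<in> ?A \<times> ?B \<times> {m}"
      using AE_two_sided[OF q]
    proof eventually_elim
      case (elim \<omega>)
      obtain Bp Bm Mv where w: "\<omega> = (Bp, Bm, Mv)" by (metis prod_cases3)
      have v: "valid_field Bp" "valid_field Bm" using elim w by auto
      have "fits a b Mv \<and> pattern (window a b \<omega>) = p \<longleftrightarrow>
        fits a b Mv \<and> signs a b Mv = map (\<lambda>k. b < k) p \<and> pattern (Ilist Bp a) = hi_part b p \<and> pattern (Ilist Bm b) = lo_part b p"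
        unfolding window_def mallowsZ_def w using window_pattern_iff[OF _ v p, of Mv] by auto
      also have "\<dots> \<longleftrightarrow> Mv = m \<and> pattern (Ilist Bp a) = hi_part b p \<and> pattern (Ilist Bm b) = lo_part b p"
        using m signs_inj[OF _ m(1), of Mv] by auto
      finally show ?case unfolding w by auto
    qed
    have "{\<omega> \<in> space (two_sided_field q). fits a b (snd (snd \<omega>)) \<and> pattern (window a b \<omega>) = p} \<in> sets (two_sided_field q)"
      by measurable
    then show "{\<omega>. fits a b (snd (snd \<omega>)) \<and> pattern (window a b \<omega>) = p} \<in> sets (two_sided_field q)" by simp
    show "?A \<times> ?B \<times> {m} \<in> sets (two_sided_field q)" unfolding two_sided_field_def using sets by auto
  qed
  also have "\<dots> = measure (bern_field q) ?A * (measure (bern_field q) ?B * measure (geom_field q) {m})"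
    by (rule measure_two_sided_rect[OF sets])
  also have "measure (geom_field q) {m} = q ^ area (map (\<lambda>k. b < k) p) * measure (geom_field q) {\<lambda>_. 0}"
    using measure_geom_singleton[OF q, of b m] fits_support[OF m(1)] sum_Lambda_seq[OF m(1)] area_signs[OF m(1)] m(2) by simp
  also have "measure (bern_field q) ?A = q ^ inv_count (filter (\<lambda>k. b < k) p) * sorted_prob q a"
    using bern_prob_pattern(2)[OF q pp(1,2)] pp(3) by simp
  also have "measure (bern_field q) ?B = q ^ inv_count (filter (\<lambda>k. k \<le> b) p) * sorted_prob q b"
    using bern_prob_pattern(2)[OF q pp(4,5)] pp(6) by simp
  finally show ?thesis unfolding inv_count_split[of p b] power_add by (simp add: mult_ac)
qed

definition perm_lists :: "nat \<Rightarrow> nat list set" where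
  "perm_lists n = {p. distinct p \<and> set p = {1..n}}"

lemma finite_perm_lists: "finite (perm_lists n)"
proof (rule finite_subset)
  show "perm_lists n \<subseteq> {p. set p \<subseteq> {1..n} \<and> length p = n}"
    unfolding perm_lists_def by (auto dest: distinct_card)
  show "finite {p. set p \<subseteq> {1..n} \<and> length p = n}" by (rule finite_lists_length_eq) simp
qed

lemma perm_lists_nonzero: "[0] \<notin> perm_lists n"
proof
  assume "[0] \<in> perm_lists n"
  then have "(0::nat) \<in> {1..n}" unfolding perm_lists_def by (metis (mono_tags, lifting) list.set_intros(1) mem_Collect_eq)
  then show False by simp
qed

lemma integral_finite_range:
  fixes \<psi> :: "'b \<Rightarrow> real"
  assumes "prob_space M" "finite S" and Z: "\<And>p. p \<in> S \<Longrightarrow> {\<omega> \<in> space M. Z \<omega> = p} \<in> sets M"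
    and f: "f \<in> borel_measurable M"
    and AE: "AE \<omega> in M. f \<omega> = (\<Sum>p\<in>S. \<psi> p * indicator {\<omega> \<in> space M. Z \<omega> = p} \<omega>)"
  shows "(\<integral>\<omega>. f \<omega> \<partial>M) = (\<Sum>p\<in>S. \<psi> p * measure M {\<omega> \<in> space M. Z \<omega> = p})"
proof -
  interpret prob_space M by fact
  have "(\<integral>\<omega>. f \<omega> \<partial>M) = (\<integral>\<omega>. (\<Sum>p\<in>S. \<psi> p * indicator {\<omega> \<in> space M. Z \<omega> = p} \<omega>) \<partial>M)"
    by (rule integral_cong_AE[OF f _ AE]) (use Z in measurable)
  also have "\<dots> = (\<Sum>p\<in>S. \<integral>\<omega>. \<psi> p * indicator {\<omega> \<in> space M. Z \<omega> = p} \<omega> \<partial>M)"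
    by (rule Bochner_Integration.integral_sum) (use Z in \<open>auto intro!: integrable_mult_right integrable_real_indicator simp: emeasure_eq_measure\<close>)
  also have "\<dots> = (\<Sum>p\<in>S. \<psi> p * measure M {\<omega> \<in> space M. Z \<omega> = p})"
  proof (rule sum.cong[OF refl])
    fix p
    have "{\<omega> \<in> space M. Z \<omega> = p} \<inter> space M = {\<omega> \<in> space M. Z \<omega> = p}" by auto
    then show "(\<integral>\<omega>. \<psi> p * indicator {\<omega> \<in> space M. Z \<omega> = p} \<omega> \<partial>M) = \<psi> p * measure M {\<omega> \<in> space M. Z \<omega> = p}"
      by simp
  qed
  finally show ?thesis .
qed

text \<open>The window pattern on the fitting event and the pattern under \<open>Ipmf\<close> have
  weights proportional to \<open>q ^ inv_count p\<close> on the same finite set. The constant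
  function 1 in the place of \<open>\<psi>\<close> determines both constants of
  proportionality.\<close>

lemma window_law:
  fixes \<psi> :: "nat list \<Rightarrow> real"
  assumes q: "0 \<le> q" "q < 1"
  shows "(\<integral>\<omega>. (if fits a b (snd (snd \<omega>)) then \<psi> (pattern (window a b \<omega>)) else 0) \<partial>two_sided_field q) =
    measure (two_sided_field q) {\<omega>. fits a b (snd (snd \<omega>))} * (\<integral>xs. \<psi> (pattern xs) \<partial>Ipmf q (a + b))"
proof -
  interpret prob_space "two_sided_field q" by (rule prob_space_two_sided)
  let ?M = "two_sided_field q" and ?S = "perm_lists (a + b)"
  define K where "K = sorted_prob q a * sorted_prob q b * measure (geom_field q) {\<lambda>_. 0}"
  \<comment> \<open>\<open>[0]\<close> is not a permutation of \<open>{1..a + b}\<close>, so it can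
    mark the event that the partition does not fit.\<close>
  define Z where "Z \<omega> = (if fits a b (snd (snd \<omega>)) then pattern (window a b \<omega>) else [0])" for \<omega>
  have mZ [measurable]: "Z \<in> ?M \<rightarrow>\<^sub>M count_space UNIV" unfolding Z_def[abs_def] by measurable
  have G: "measure ?M {\<omega> \<in> space ?M. Z \<omega> = p} = q ^ inv_count p * K" if "p \<in> ?S" for p
  proof -
    have "p \<noteq> [0]" using that perm_lists_nonzero by metis
    then have "{\<omega> \<in> space ?M. Z \<omega> = p} = {\<omega>. fits a b (snd (snd \<omega>)) \<and> pattern (window a b \<omega>) = p}"
      unfolding Z_def by auto
    then show ?thesis using prob_window_pattern[OF q, of p a b] that unfolding perm_lists_def K_def by simp
  qed
  have AEZ: "AE \<omega> in ?M. fits a b (snd (snd \<omega>)) \<longrightarrow> Z \<omega> \<in> ?S"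
    using AE_two_sided[OF q]
  proof eventually_elim
    case (elim \<omega>)
    show ?case
    proof
      assume f: "fits a b (snd (snd \<omega>))"
      have d: "distinct (window a b \<omega>)" unfolding window_def mallowsZ_def using window_split(4)[OF f] elim by blast
      have "length (window a b \<omega>) = a + b" by (simp add: window_def)
      then show "Z \<omega> \<in> ?S" using f distinct_pattern[OF d] set_pattern[OF d] unfolding Z_def perm_lists_def by simp
    qed
  qed
  have main: "(\<integral>\<omega>. (if fits a b (snd (snd \<omega>)) then \<phi> (pattern (window a b \<omega>)) else 0) \<partial>?M) =
     (\<Sum>p\<in>?S. \<phi> p * (q ^ inv_count p * K))" for \<phi> :: "nat list \<Rightarrow> real"
  proof -
    have "(\<integral>\<omega>. (if fits a b (snd (snd \<omega>)) then \<phi> (pattern (window a b \<omega>)) else 0) \<partial>?M) =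
       (\<Sum>p\<in>?S. \<phi> p * measure ?M {\<omega> \<in> space ?M. Z \<omega> = p})"
    proof (rule integral_finite_range[OF prob_space_axioms finite_perm_lists])
      show "AE \<omega> in ?M. (if fits a b (snd (snd \<omega>)) then \<phi> (pattern (window a b \<omega>)) else 0) =
          (\<Sum>p\<in>?S. \<phi> p * indicator {\<omega> \<in> space ?M. Z \<omega> = p} \<omega>)"
        using AEZ
      proof eventually_elim
        case (elim \<omega>)
        show ?case
        proof (cases "fits a b (snd (snd \<omega>))")
          case True
          have "(\<Sum>p\<in>?S. \<phi> p * indicator {\<omega> \<in> space ?M. Z \<omega> = p} \<omega>) = (\<Sum>p\<in>?S. if Z \<omega> = p then \<phi> p else 0)"
            by (rule sum.cong) auto
          also have "\<dots> = \<phi> (Z \<omega>)" using elim True finite_perm_lists by (simp add: sum.delta)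
          finally show ?thesis using True by (simp add: Z_def)
        next
          case False
          have "[0] \<notin> ?S" by (rule perm_lists_nonzero)
          then have "(\<Sum>p\<in>?S. \<phi> p * indicator {\<omega> \<in> space ?M. Z \<omega> = p} \<omega>) = 0"
          proof (intro sum.neutral ballI)
            fix p assume "p \<in> ?S"
            then have "Z \<omega> \<noteq> p" using False \<open>[0] \<notin> ?S\<close> by (auto simp: Z_def)
            then show "\<phi> p * indicator {\<omega> \<in> space ?M. Z \<omega> = p} \<omega> = 0" by simp
          qed
          then show ?thesis using False by simp
        qed
      qed
    qed measurable
    then show ?thesis using G by simp
  qed
  have Ip: "(\<integral>xs. \<phi> (pattern xs) \<partial>Ipmf q (a + b)) = (\<Sum>p\<in>?S. \<phi> p * (q ^ inv_count p * sorted_prob q (a + b)))" for \<phi> :: "nat list \<Rightarrow> real"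
  proof -
    have "(\<integral>xs. \<phi> (pattern xs) \<partial>Ipmf q (a + b)) = (\<Sum>p\<in>?S. \<phi> p * measure (Ipmf q (a + b)) {xs \<in> space (Ipmf q (a + b)). pattern xs = p})"
    proof (rule integral_finite_range[OF measure_pmf.prob_space_axioms finite_perm_lists])
      show "AE xs in Ipmf q (a + b). \<phi> (pattern xs) = (\<Sum>p\<in>?S. \<phi> p * indicator {xs \<in> space (Ipmf q (a + b)). pattern xs = p} xs)"
      proof (unfold AE_measure_pmf_iff, rule ballI)
        fix xs assume "xs \<in> set_pmf (Ipmf q (a + b))"
        then have xs: "length xs = a + b" "distinct xs" using set_Ipmf by blast+
        then have pS: "pattern xs \<in> ?S" using distinct_pattern[OF xs(2)] set_pattern[OF xs(2)] unfolding perm_lists_def by simp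
        have "(\<Sum>p\<in>?S. \<phi> p * indicator {xs \<in> space (Ipmf q (a + b)). pattern xs = p} xs) = (\<Sum>p\<in>?S. if pattern xs = p then \<phi> p else 0)"
          by (rule sum.cong) auto
        also have "\<dots> = \<phi> (pattern xs)" using pS finite_perm_lists by (simp add: sum.delta)
        finally show "\<phi> (pattern xs) = (\<Sum>p\<in>?S. \<phi> p * indicator {xs \<in> space (Ipmf q (a + b)). pattern xs = p} xs)" by simp
      qed
    qed simp_all
    then show ?thesis using prob_pattern[OF q] unfolding sorted_prob_def perm_lists_def by simp
  qed
  define W where "W = (\<Sum>p\<in>?S. q ^ inv_count p)"
  define C where "C = sorted_prob q (a + b)"
  have one: "C * W = 1" using Ip[of "\<lambda>_. 1"] unfolding W_def C_def by (simp add: sum_distrib_left mult.commute)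
  have "measure ?M {\<omega>. fits a b (snd (snd \<omega>))} = (\<integral>\<omega>. (if fits a b (snd (snd \<omega>)) then 1 else 0 :: real) \<partial>?M)"
  proof -
    have "(\<integral>\<omega>. (if fits a b (snd (snd \<omega>)) then 1 else 0 :: real) \<partial>?M) = (\<integral>\<omega>. indicator {\<omega>. fits a b (snd (snd \<omega>))} \<omega> \<partial>?M)"
      by (rule Bochner_Integration.integral_cong) (auto simp: indicator_def)
    then show ?thesis by simp
  qed
  also have "\<dots> = K * W" using main[of "\<lambda>_. 1"] unfolding W_def by (simp add: sum_distrib_left mult.commute)
  finally have P: "measure ?M {\<omega>. fits a b (snd (snd \<omega>))} = K * W" .
  have "(\<Sum>p\<in>?S. \<psi> p * (q ^ inv_count p * K)) = K * (\<Sum>p\<in>?S. \<psi> p * q ^ inv_count p)"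
    by (simp add: sum_distrib_left mult_ac)
  moreover have "(\<Sum>p\<in>?S. \<psi> p * (q ^ inv_count p * C)) = C * (\<Sum>p\<in>?S. \<psi> p * q ^ inv_count p)"
    by (simp add: sum_distrib_left mult_ac)
  ultimately show ?thesis unfolding main Ip P C_def[symmetric] using one by (simp add: mult.commute)
qed

section \<open>Measurability of the redwood tree\<close>

text \<open>
  The Bochner integral in \<^const>\<open>redwood_prob\<close> is \<open>0\<close> unless its integrand is measurable on the whole space, so the null set
  on which the definite descriptions in \<^const>\<open>std_records\<close> and \<^const>\<open>Lambda_seq\<close> are undefined cannot be ignored.
  There they are one fixed arbitrary value, which is measurable.
\<close>

lemma measurable_count2:
  fixes h :: "'b::countable \<Rightarrow> 'c::countable \<Rightarrow> 'd"
  assumes f: "f \<in> M \<rightarrow>\<^sub>M count_space UNIV" and g: "g \<in> M \<rightarrow>\<^sub>M count_space UNIV"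
  shows "(\<lambda>\<omega>. h (f \<omega>) (g \<omega>)) \<in> M \<rightarrow>\<^sub>M count_space UNIV"
proof -
  have "(\<lambda>\<omega>. h x (g \<omega>)) \<in> M \<rightarrow>\<^sub>M count_space UNIV" for x
    by (rule measurable_compose[OF g, of "h x"]) simp
  from measurable_compose_countable[OF this f] show ?thesis .
qed

lemma measurable_count_spaceI:
  fixes f :: "'a \<Rightarrow> 'b::countable"
  assumes "\<And>y. Measurable.pred M (\<lambda>\<omega>. f \<omega> = y)"
  shows "f \<in> M \<rightarrow>\<^sub>M count_space UNIV"
proof (subst measurable_count_space_eq_countable)
  show "f \<in> space M \<rightarrow> UNIV \<and> (\<forall>a\<in>UNIV. f -` {a} \<inter> space M \<in> sets M)"
  proof (intro conjI ballI)
    fix y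
    have "{\<omega> \<in> space M. f \<omega> = y} \<in> sets M" using assms by (rule predE)
    moreover have "{\<omega> \<in> space M. f \<omega> = y} = f -` {y} \<inter> space M" by auto
    ultimately show "f -` {y} \<inter> space M \<in> sets M" by simp
  qed simp
qed simp

text \<open>\<open>sorted_list_of_set\<close> sends infinite sets to \<open>[]\<close>, hence the
  second alternative for the empty list. Infinite is expressed as unbounded, so that only countable
  quantifiers over memberships remain.\<close>

lemma sorted_list_of_set_eq_iff:
  fixes A :: "int set"
  shows "sorted_list_of_set A = l \<longleftrightarrow>
    (if l = [] then (\<forall>i. i \<notin> A) \<or> (\<forall>n. \<exists>i. i \<in> A \<and> n < \<bar>i\<bar>) else sorted_wrt (<) l \<and> (\<forall>i. i \<in> A \<longleftrightarrow> i \<in> set l))"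
proof (cases "finite A")
  case True
  have bd: "\<not> (\<forall>n. \<exists>i. i \<in> A \<and> n < \<bar>i\<bar>)"
  proof
    assume all: "\<forall>n. \<exists>i. i \<in> A \<and> n < \<bar>i\<bar>"
    have fin: "finite (abs ` A)" using True by simp
    obtain i where i: "i \<in> A" "Max (abs ` A) < \<bar>i\<bar>" using all by blast
    have "\<bar>i\<bar> \<le> Max (abs ` A)" by (rule Max_ge[OF fin]) (use i in simp)
    then show False using i by simp
  qed
  show ?thesis
  proof (cases "l = []")
    case l: True
    show ?thesis unfolding l using True bd by auto
  next
    case l: False
    have "sorted_list_of_set A = l \<longleftrightarrow> sorted_wrt (<) l \<and> A = set l"
    proof
      assume "sorted_list_of_set A = l"
      then show "sorted_wrt (<) l \<and> A = set l" using True by (metis set_sorted_list_of_set strict_sorted_list_of_set)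
    next
      assume "sorted_wrt (<) l \<and> A = set l"
      then show "sorted_list_of_set A = l" by (metis sorted_list_of_set.idem_if_sorted_distinct strict_sorted_iff)
    qed
    then show ?thesis using l by (simp add: set_eq_iff)
  qed
next
  case False
  have unb: "\<forall>n. \<exists>i. i \<in> A \<and> n < \<bar>i\<bar>"
  proof (rule ccontr)
    assume "\<not> (\<forall>n. \<exists>i. i \<in> A \<and> n < \<bar>i\<bar>)"
    then obtain n where n: "\<And>i. i \<in> A \<Longrightarrow> \<bar>i\<bar> \<le> n" by (meson not_less)
    have "A \<subseteq> {- n..n}"
    proof
      fix i assume "i \<in> A"
      then have "\<bar>i\<bar> \<le> n" by (rule n)
      then show "i \<in> {- n..n}" by auto
    qed
    then show False using False finite_subset by blast
  qed
  have "A \<noteq> set l" using False by auto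
  then have ne: "\<not> (\<forall>i. i \<in> A \<longleftrightarrow> i \<in> set l)" by blast
  have e: "sorted_list_of_set A = []" using False by simp
  show ?thesis
  proof (cases "l = []")
    case True
    show ?thesis unfolding e if_P[OF True] using unb True by blast
  next
    case l: False
    show ?thesis unfolding e if_not_P[OF l] using ne l by blast
  qed
qed

context
  fixes M :: "'a measure" and X :: "'a \<Rightarrow> int \<Rightarrow> int"
  assumes X [measurable]: "\<And>z. (\<lambda>\<omega>. X \<omega> z) \<in> M \<rightarrow>\<^sub>M count_space UNIV"
begin

lemma pred_record [measurable]: "Measurable.pred M (\<lambda>\<omega>. p \<in> record_indices (X \<omega>))"
proof -
  have [measurable]: "Measurable.pred M (\<lambda>\<omega>. X \<omega> k < X \<omega> p)" for k
    by (rule measurable_count2[of "\<lambda>\<omega>. X \<omega> k" M "\<lambda>\<omega>. X \<omega> p" "(<)"]) measurable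
  show ?thesis unfolding record_indices_def mem_Collect_eq by measurable
qed

lemma pred_two_sided_records [measurable]: "Measurable.pred M (\<lambda>\<omega>. two_sided_records (X \<omega>))"
proof -
  have [measurable]: "Measurable.pred M (\<lambda>\<omega>. X \<omega> p \<le> 0)" "Measurable.pred M (\<lambda>\<omega>. 0 < X \<omega> p)" for p
    by (rule measurable_compose[OF X], simp)+
  show ?thesis unfolding two_sided_records_def Bex_def by measurable
qed

text \<open>Induction on \<open>k\<close> in both directions from 0, through the descriptions of
  index 0, of the successor and of the predecessor. Off the event \<open>two_sided_records\<close>
  the value is the constant \<open>c k\<close>.\<close>

lemma measurable_std_records [measurable]: "(\<lambda>\<omega>. std_records (X \<omega>) k) \<in> M \<rightarrow>\<^sub>M count_space UNIV"
proof -
  have [measurable]: "Measurable.pred M (\<lambda>\<omega>. X \<omega> p \<le> 0)" "Measurable.pred M (\<lambda>\<omega>. 0 < X \<omega> p)" for p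
    by (rule measurable_compose[OF X], simp)+
  define c where "c = (THE \<rho> :: int \<Rightarrow> int. False)"
  have split: "std_records (X \<omega>) k = z \<longleftrightarrow> (two_sided_records (X \<omega>) \<and> std_records (X \<omega>) k = z) \<or> (\<not> two_sided_records (X \<omega>) \<and> c k = z)" for \<omega> k z
    using std_records_undefined[of "X \<omega>"] unfolding c_def by (cases "two_sided_records (X \<omega>)") auto
  have red: "Measurable.pred M (\<lambda>\<omega>. std_records (X \<omega>) k = z)"
    if "Measurable.pred M (\<lambda>\<omega>. two_sided_records (X \<omega>) \<and> std_records (X \<omega>) k = z)" for k z
    by (subst split) (intro pred_intros_logic that pred_two_sided_records measurable_const, simp_all)
  have "\<forall>z. Measurable.pred M (\<lambda>\<omega>. std_records (X \<omega>) k = z)"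
  proof (induction k rule: int_induct[where k=0])
    case base
    show ?case
    proof (rule allI, rule red)
      fix z
      have eq: "(two_sided_records (X \<omega>) \<and> std_records (X \<omega>) 0 = z) \<longleftrightarrow> two_sided_records (X \<omega>) \<and>
         (z \<in> record_indices (X \<omega>) \<and> X \<omega> z \<le> 0 \<and> (\<forall>w. z < w \<longrightarrow> w \<in> record_indices (X \<omega>) \<longrightarrow> 0 < X \<omega> w))" for \<omega>
        using rec_enum_zero[OF rec_enum_std_records, of "X \<omega>" z] by blast
      show "Measurable.pred M (\<lambda>\<omega>. two_sided_records (X \<omega>) \<and> std_records (X \<omega>) 0 = z)" unfolding eq by measurable
    qed
  next
    case (step1 k)
    then have [measurable]: "Measurable.pred M (\<lambda>\<omega>. std_records (X \<omega>) k = z)" for z by blast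
    show ?case
    proof (rule allI, rule red)
      fix z
      have eq: "(two_sided_records (X \<omega>) \<and> std_records (X \<omega>) (k + 1) = z) \<longleftrightarrow> two_sided_records (X \<omega>) \<and>
         (\<exists>y. std_records (X \<omega>) k = y \<and> z \<in> record_indices (X \<omega>) \<and> y < z \<and> (\<forall>w. y < w \<longrightarrow> w < z \<longrightarrow> w \<notin> record_indices (X \<omega>)))" for \<omega>
        using rec_enum_next[OF rec_enum_std_records, of "X \<omega>" k z] by blast
      show "Measurable.pred M (\<lambda>\<omega>. two_sided_records (X \<omega>) \<and> std_records (X \<omega>) (k + 1) = z)" unfolding eq by measurable
    qed
  next
    case (step2 k)
    then have [measurable]: "Measurable.pred M (\<lambda>\<omega>. std_records (X \<omega>) k = z)" for z by blast
    show ?case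
    proof (rule allI, rule red)
      fix z
      have eq: "(two_sided_records (X \<omega>) \<and> std_records (X \<omega>) (k - 1) = z) \<longleftrightarrow> two_sided_records (X \<omega>) \<and>
         (\<exists>y. std_records (X \<omega>) k = y \<and> z \<in> record_indices (X \<omega>) \<and> z < y \<and> (\<forall>w. z < w \<longrightarrow> w < y \<longrightarrow> w \<notin> record_indices (X \<omega>)))" for \<omega>
        using rec_enum_prev[OF rec_enum_std_records, of "X \<omega>" k z] by blast
      show "Measurable.pred M (\<lambda>\<omega>. two_sided_records (X \<omega>) \<and> std_records (X \<omega>) (k - 1) = z)" unfolding eq by measurable
    qed
  qed
  from this[rule_format] show ?thesis by (rule measurable_count_spaceI)
qed

lemma measurable_sigma_block: "(\<lambda>\<omega>. sigma_block (X \<omega>) k) \<in> M \<rightarrow>\<^sub>M count_space UNIV"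
proof -
  have [measurable]: "(\<lambda>\<omega>. X \<omega> (std_records (X \<omega>) j)) \<in> M \<rightarrow>\<^sub>M count_space UNIV" for j
    by (rule measurable_compose_countable[OF X measurable_std_records])
  define A where "A \<omega> = {i. X \<omega> (std_records (X \<omega>) k) < X \<omega> i \<and> X \<omega> i < X \<omega> (std_records (X \<omega>) (k + 1))}" for \<omega>
  have 1: "Measurable.pred M (\<lambda>\<omega>. X \<omega> (std_records (X \<omega>) j) < X \<omega> i)" for i j
    by (rule measurable_count2[of "\<lambda>\<omega>. X \<omega> (std_records (X \<omega>) j)" M "\<lambda>\<omega>. X \<omega> i" "(<)"]) measurable
  have 2: "Measurable.pred M (\<lambda>\<omega>. X \<omega> i < X \<omega> (std_records (X \<omega>) j))" for i j
    by (rule measurable_count2[of "\<lambda>\<omega>. X \<omega> i" M "\<lambda>\<omega>. X \<omega> (std_records (X \<omega>) j)" "(<)"]) measurable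
  have [measurable]: "Measurable.pred M (\<lambda>\<omega>. i \<in> A \<omega>)" for i
    unfolding A_def mem_Collect_eq by (intro pred_intros_logic 1 2)
  have "Measurable.pred M (\<lambda>\<omega>. sorted_list_of_set (A \<omega>) = l)" for l
    unfolding sorted_list_of_set_eq_iff by measurable
  then have L: "(\<lambda>\<omega>. sorted_list_of_set (A \<omega>)) \<in> M \<rightarrow>\<^sub>M count_space UNIV" by (rule measurable_count_spaceI)
  have "(\<lambda>\<omega>. map (X \<omega>) (sorted_list_of_set (A \<omega>))) \<in> M \<rightarrow>\<^sub>M count_space UNIV"
    by (rule measurable_compose_countable[OF _ L]) (rule measurable_map_count_space[OF X])
  then show ?thesis unfolding sigma_block_def Let_def A_def .
qed

lemma pred_in_redwood: "Measurable.pred M (\<lambda>\<omega>. w \<in> redwood (X \<omega>))"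
proof -
  have "w \<in> redwood (X \<omega>) \<longleftrightarrow> (\<exists>k. w = one_pow k) \<or> (\<exists>k v. w = branch_word k v \<and> v \<in> bst (sigma_block (X \<omega>) k))" for \<omega>
    unfolding redwood_def by blast
  moreover have [measurable]: "Measurable.pred M (\<lambda>\<omega>. v \<in> bst (sigma_block (X \<omega>) k))" for v k
    by (rule measurable_compose[OF measurable_sigma_block, of "\<lambda>xs. v \<in> bst xs"]) simp
  ultimately show ?thesis by simp
qed

end

section \<open>Random sets of words and the ratio in the redwood tree\<close>

instance letter :: countable
  by countable_datatype

text \<open>A finite set is enumerated by a distinct list, and there are only countably many lists.
  Infinite sets have \<open>card\<close> 0 and join the case \<open>n = 0\<close>.\<close>

lemma measurable_card_random_set:
  fixes A :: "'a \<Rightarrow> 'b::countable set"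
  assumes A: "\<And>w. Measurable.pred M (\<lambda>\<omega>. w \<in> A \<omega>)"
  shows "(\<lambda>\<omega>. card (A \<omega>)) \<in> M \<rightarrow>\<^sub>M count_space UNIV"
proof (rule measurable_count_spaceI)
  fix n
  note [measurable] = A
  define Q where "Q n \<omega> \<longleftrightarrow> (\<exists>l. distinct l \<and> length l = n \<and> (\<forall>w. w \<in> A \<omega> \<longleftrightarrow> w \<in> set l))" for n \<omega>
  have Q: "Q n \<omega> \<longleftrightarrow> finite (A \<omega>) \<and> card (A \<omega>) = n" for n \<omega>
  proof
    assume "Q n \<omega>"
    then obtain l where l: "distinct l" "length l = n" "\<forall>w. w \<in> A \<omega> \<longleftrightarrow> w \<in> set l" unfolding Q_def by blast
    then have "A \<omega> = set l" by blast
    then show "finite (A \<omega>) \<and> card (A \<omega>) = n" using l distinct_card by auto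
  next
    assume f: "finite (A \<omega>) \<and> card (A \<omega>) = n"
    then obtain l where "set l = A \<omega>" "distinct l" using finite_distinct_list by blast
    then show "Q n \<omega>" unfolding Q_def using f distinct_card by fastforce
  qed
  have mQ [measurable]: "Measurable.pred M (Q n)" for n unfolding Q_def[abs_def] by measurable
  have eq: "card (A \<omega>) = n \<longleftrightarrow> Q n \<omega> \<or> (n = 0 \<and> (\<forall>k. \<not> Q k \<omega>))" for \<omega>
    unfolding Q by (cases "finite (A \<omega>)") auto
  show "Measurable.pred M (\<lambda>\<omega>. card (A \<omega>) = n)" unfolding eq by measurable
qed

lemma length_one_pow: "length (one_pow k) = nat \<bar>k\<bar>"
  by (auto simp: one_pow_def)

lemma Y_basic_edge_length: "Y_basic_edge u v \<Longrightarrow> length v \<le> Suc (length u) \<and> length u \<le> Suc (length v)"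
  unfolding Y_basic_edge_def by (auto simp: length_one_pow)

text \<open>An edge changes the length of a word by at most one, so the ball stays among the words
  of length at most \<open>length v + r\<close>, a finite set.\<close>

lemma ball_graph_redwood_local:
  fixes v :: "letter list" and r :: nat
  defines "D \<equiv> {w. length w \<le> length v + r}"
  shows "ball_graph r (Y, edgesY Y) v = ball_graph r (Y \<inter> D, edgesY (Y \<inter> D)) v"
proof -
  have sub: "edgesY Z \<subseteq> Z \<times> Z" for Z by (auto simp: edgesY_def)
  have mono: "edgesY (Y \<inter> D) \<subseteq> edgesY Y" by (auto simp: edgesY_def)
  have len: "k \<le> r \<Longrightarrow> (v, u) \<in> edgesY Y ^^ k \<Longrightarrow> length u \<le> length v + k" for k u
  proof (induction k arbitrary: u)
    case (Suc k)
    then obtain z where z: "(v, z) \<in> edgesY Y ^^ k" "(z, u) \<in> edgesY Y" by auto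
    have "length u \<le> Suc (length z)" using z(2) Y_basic_edge_length unfolding edgesY_def by blast
    then show ?case using Suc.IH[of z] z(1) Suc.prems by simp
  qed simp
  have eq: "k \<le> r \<Longrightarrow> (v, u) \<in> edgesY Y ^^ k \<longleftrightarrow> (v, u) \<in> edgesY (Y \<inter> D) ^^ k" for k u
  proof (induction k arbitrary: u)
    case (Suc k)
    have step: "(z, u) \<in> edgesY Y \<longleftrightarrow> (z, u) \<in> edgesY (Y \<inter> D)" if "(v, z) \<in> edgesY Y ^^ k" for z
    proof
      assume e: "(z, u) \<in> edgesY Y"
      have "(v, u) \<in> edgesY Y ^^ Suc k" using that e by auto
      then have "length u \<le> length v + Suc k" using len[of "Suc k" u] Suc.prems by simp
      then have "u \<in> D" using Suc.prems unfolding D_def by simp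
      moreover have "z \<in> D" using len[of k z] that Suc.prems unfolding D_def by simp
      ultimately show "(z, u) \<in> edgesY (Y \<inter> D)" using e unfolding edgesY_def by auto
    qed (use mono in blast)
    show ?case
    proof
      assume "(v, u) \<in> edgesY Y ^^ Suc k"
      then obtain z where "(v, z) \<in> edgesY Y ^^ k" "(z, u) \<in> edgesY Y" by auto
      then show "(v, u) \<in> edgesY (Y \<inter> D) ^^ Suc k" using step Suc by auto
    next
      assume "(v, u) \<in> edgesY (Y \<inter> D) ^^ Suc k"
      then obtain z where "(v, z) \<in> edgesY (Y \<inter> D) ^^ k" "(z, u) \<in> edgesY (Y \<inter> D)" by auto
      then show "(v, u) \<in> edgesY Y ^^ Suc k" using mono Suc by auto
    qed
  qed simp
  define B where "B = {u. \<exists>k\<le>r. (v, u) \<in> edgesY Y ^^ k}"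
  have B2: "{u. \<exists>k\<le>r. (v, u) \<in> edgesY (Y \<inter> D) ^^ k} = B" unfolding B_def using eq by blast
  have BD: "B \<subseteq> D"
  proof
    fix u assume "u \<in> B"
    then obtain k where "k \<le> r" "(v, u) \<in> edgesY Y ^^ k" unfolding B_def by blast
    then show "u \<in> D" using len[of k u] unfolding D_def by simp
  qed
  have E: "edgesY (Y \<inter> D) \<inter> B \<times> B = edgesY Y \<inter> B \<times> B" using BD unfolding edgesY_def by auto
  have i: "edgesY Z \<inter> Z \<times> Z = edgesY Z" for Z using sub[of Z] by blast
  show ?thesis unfolding ball_graph_def Let_def fst_conv snd_conv i B_def[symmetric] B2 E ..
qed

text \<open>The ball event at \<open>v\<close> depends only on the trace of the random set on
  finitely many words. It is a finite union, over the favourable traces \<open>S\<close>, of finite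
  intersections of membership conditions.\<close>

lemma measurable_redwood_ratio:
  assumes A: "\<And>w. Measurable.pred M (\<lambda>\<omega>. w \<in> Y \<omega>)"
  shows "(\<lambda>\<omega>. redwood_ratio r H (Y \<omega>)) \<in> borel_measurable M"
proof -
  note [measurable] = A
  have finl: "finite {w::letter list. length w \<le> n}" for n
  proof -
    have "(UNIV::letter set) \<subseteq> {L0, L1, Ups}" by (auto intro: letter.exhaust)
    then have "finite (UNIV::letter set)" by (rule finite_subset) simp
    from finite_lists_length_le[OF this, of n] show ?thesis by simp
  qed
  have iso: "Measurable.pred M (\<lambda>\<omega>. v \<in> Y \<omega> \<inter> TL_set \<and> rooted_iso (ball_graph r (Y \<omega>, edgesY (Y \<omega>)) v) H)" for v
  proof -
    let ?D = "{w. length w \<le> length v + r}"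
    let ?P = "\<lambda>S. v \<in> S \<inter> TL_set \<and> rooted_iso (ball_graph r (S, edgesY S) v) H"
    have "?P (Y \<omega>) \<longleftrightarrow> ?P (Y \<omega> \<inter> ?D)" for \<omega>
      using ball_graph_redwood_local[of r "Y \<omega>" v] by auto
    moreover have "?P (Y \<omega> \<inter> ?D) \<longleftrightarrow> (\<exists>S\<in>{S \<in> Pow ?D. ?P S}. \<forall>w\<in>?D. w \<in> Y \<omega> \<longleftrightarrow> w \<in> S)" for \<omega>
    proof
      assume "?P (Y \<omega> \<inter> ?D)"
      then show "\<exists>S\<in>{S \<in> Pow ?D. ?P S}. \<forall>w\<in>?D. w \<in> Y \<omega> \<longleftrightarrow> w \<in> S" by (intro bexI[of _ "Y \<omega> \<inter> ?D"]) auto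
    next
      assume "\<exists>S\<in>{S \<in> Pow ?D. ?P S}. \<forall>w\<in>?D. w \<in> Y \<omega> \<longleftrightarrow> w \<in> S"
      then obtain S where S: "S \<subseteq> ?D" "?P S" "\<forall>w\<in>?D. w \<in> Y \<omega> \<longleftrightarrow> w \<in> S" by blast
      then have "Y \<omega> \<inter> ?D = S" by blast
      then show "?P (Y \<omega> \<inter> ?D)" using S(2) by simp
    qed
    ultimately have eq: "?P (Y \<omega>) \<longleftrightarrow> (\<exists>S\<in>{S \<in> Pow ?D. ?P S}. \<forall>w\<in>?D. w \<in> Y \<omega> \<longleftrightarrow> w \<in> S)" for \<omega> by blast
    have "finite {S \<in> Pow ?D. ?P S}" using finl by simp
    then show ?thesis unfolding eq
      by (intro pred_intros_finite finl pred_intros_logic A) auto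
  qed
  have TL: "Measurable.pred M (\<lambda>\<omega>. w \<in> Y \<omega> \<inter> TL_set)" for w
    by simp
  have iso': "Measurable.pred M (\<lambda>\<omega>. v \<in> {v \<in> Y \<omega> \<inter> TL_set. rooted_iso (ball_graph r (Y \<omega>, edgesY (Y \<omega>)) v) H})" for v
    using iso[of v] by simp
  have card1: "(\<lambda>\<omega>. card {v \<in> Y \<omega> \<inter> TL_set. rooted_iso (ball_graph r (Y \<omega>, edgesY (Y \<omega>)) v) H}) \<in> M \<rightarrow>\<^sub>M count_space UNIV"
    by (rule measurable_card_random_set[OF iso'])
  have card2: "(\<lambda>\<omega>. card (Y \<omega> \<inter> TL_set)) \<in> M \<rightarrow>\<^sub>M count_space UNIV"
    by (rule measurable_card_random_set[OF TL])
  have "(\<lambda>\<omega>. real (card {v \<in> Y \<omega> \<inter> TL_set. rooted_iso (ball_graph r (Y \<omega>, edgesY (Y \<omega>)) v) H})) \<in> borel_measurable M"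
    "(\<lambda>\<omega>. real (card (Y \<omega> \<inter> TL_set))) \<in> borel_measurable M"
    by (rule measurable_compose[OF card1], simp, rule measurable_compose[OF card2], simp)
  then show ?thesis unfolding redwood_ratio_def by (rule borel_measurable_divide)
qed

section \<open>Convergence of the mean\<close>

lemma redwood_ratio_bounds: "0 \<le> redwood_ratio r H Y" "redwood_ratio r H Y \<le> 1"
proof -
  show "redwood_ratio r H Y \<le> 1"
  proof (cases "finite (Y \<inter> TL_set)")
    case True
    then have "card {v \<in> Y \<inter> TL_set. rooted_iso (ball_graph r (Y, edgesY Y) v) H} \<le> card (Y \<inter> TL_set)"
      by (intro card_mono) auto
    then show ?thesis unfolding redwood_ratio_def by (auto simp: divide_le_eq_1)
  next
    case False
    then show ?thesis unfolding redwood_ratio_def by simp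
  qed
qed (simp add: redwood_ratio_def)

lemma level_ratio_bounds: "0 \<le> level_ratio r H t xs" "level_ratio r H t xs \<le> 1"
  unfolding level_ratio_def using block_ratio_bounds finite_bst by blast+

lemma redwood_prob_eq:
  "redwood_prob q r H = (\<integral>\<omega>. redwood_ratio r H (redwood (mallowsZ \<omega>)) \<partial>two_sided_field q)"
  unfolding redwood_prob_def redwood_ratio_def mallowsZ_def
  by (rule Bochner_Integration.integral_cong) (simp_all add: case_prod_beta Let_def)

definition level_mean :: "real \<Rightarrow> nat \<Rightarrow> 'h set \<times> ('h \<times> 'h) set \<times> 'h \<Rightarrow> nat \<Rightarrow> nat \<Rightarrow> real" where
  "level_mean q r H a b = (\<integral>xs. level_ratio r H b (pattern xs) \<partial>Ipmf q (a + b))"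

lemma level_mean_bounds: "0 \<le> level_mean q r H a b" "level_mean q r H a b \<le> 1"
proof -
  have int: "integrable (Ipmf q (a + b)) (\<lambda>xs. level_ratio r H b (pattern xs))"
    by (rule measure_pmf.integrable_const_bound[of _ 1]) (auto simp: level_ratio_bounds)
  show "0 \<le> level_mean q r H a b" unfolding level_mean_def by (rule integral_nonneg_AE) (simp add: level_ratio_bounds)
  show "level_mean q r H a b \<le> 1" unfolding level_mean_def
    by (rule measure_pmf.integral_le_const[OF int]) (simp add: level_ratio_bounds)
qed

lemma count_mean_eq_sum: "count_mean q r H N = (\<Sum>b<N. level_mean q r H (N - b) b)"
proof -
  have int: "integrable (Ipmf q N) (\<lambda>xs. level_ratio r H b (pattern xs))" for b
    by (rule measure_pmf.integrable_const_bound[of _ 1]) (auto simp: level_ratio_bounds)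
  have "count_mean q r H N = (\<integral>xs. (\<Sum>b<N. level_ratio r H b (pattern xs)) \<partial>Ipmf q N)"
    unfolding count_mean_def
  proof (rule integral_cong_AE)
    show "AE xs in Ipmf q N. bst_count r H xs = (\<Sum>b<N. level_ratio r H b (pattern xs))"
    proof (unfold AE_measure_pmf_iff, rule ballI)
      fix xs assume "xs \<in> set_pmf (Ipmf q N)"
      then have xs: "length xs = N" "distinct xs" using set_Ipmf by blast+
      have "bst_count r H xs = bst_count r H (pattern xs)" by (simp add: bst_count_def)
      also have "\<dots> = (\<Sum>b<N. level_ratio r H b (pattern xs))"
        by (rule bst_count_eq_sum_level_ratio[OF distinct_pattern[OF xs(2)]]) (use set_pattern[OF xs(2)] xs(1) in simp)
      finally show "bst_count r H xs = (\<Sum>b<N. level_ratio r H b (pattern xs))" .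
    qed
  qed simp_all
  also have "\<dots> = (\<Sum>b<N. \<integral>xs. level_ratio r H b (pattern xs) \<partial>Ipmf q N)"
    by (rule Bochner_Integration.integral_sum) (rule int)
  also have "\<dots> = (\<Sum>b<N. level_mean q r H (N - b) b)"
    unfolding level_mean_def by (rule sum.cong) auto
  finally show ?thesis .
qed

text \<open>Off \<open>Bad K\<close> the partition fits and the window ratio equals the redwood
  ratio for all larger windows at once, and \<open>Bad K\<close> decreases to a null set. The exact
  law of the window is available only on the fitting event. Restricting to this event and replacing
  the ratio cost at most the probability of \<open>Bad K\<close> each, hence the threshold
  \<open>e / 2\<close>.\<close>

lemma level_mean_approx:
  assumes q: "0 \<le> q" "q < 1" and e: "0 < e"
  shows "\<exists>K. \<forall>a b. K \<le> a \<longrightarrow> K \<le> b \<longrightarrow> \<bar>level_mean q r H a b - redwood_prob q r H\<bar> \<le> e"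
proof -
  interpret prob_space "two_sided_field q" by (rule prob_space_two_sided)
  let ?M = "two_sided_field q"
  define \<Phi> where "\<Phi> \<omega> = redwood_ratio r H (redwood (mallowsZ \<omega>))" for \<omega>
  define L where "L a b \<omega> = level_ratio r H 0 (window a b \<omega>)" for a b \<omega>
  have \<Phi> [measurable]: "\<Phi> \<in> borel_measurable ?M" unfolding \<Phi>_def[abs_def]
    by (rule measurable_redwood_ratio[OF pred_in_redwood[OF measurable_mallowsZ]])
  have L [measurable]: "L a b \<in> borel_measurable ?M" for a b unfolding L_def[abs_def]
    by (rule measurable_compose[OF measurable_window]) simp
  have \<Phi>b: "0 \<le> \<Phi> \<omega>" "\<Phi> \<omega> \<le> 1" for \<omega> unfolding \<Phi>_def by (rule redwood_ratio_bounds)+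
  have Lb: "0 \<le> L a b \<omega>" "L a b \<omega> \<le> 1" for a b \<omega> unfolding L_def by (rule level_ratio_bounds)+
  define Bad where "Bad K = {\<omega> \<in> space ?M. \<not> (\<forall>a b. K \<le> a \<longrightarrow> K \<le> b \<longrightarrow> fits a b (snd (snd \<omega>)) \<and> L a b \<omega> = \<Phi> \<omega>)}" for K :: nat
  have Bad: "Bad K \<in> sets ?M" for K unfolding Bad_def by measurable
  have "(\<lambda>K. prob (Bad K)) \<longlonglongrightarrow> prob (\<Inter>K. Bad K)"
  proof (rule finite_Lim_measure_decseq)
    show "range Bad \<subseteq> sets ?M" using Bad by auto
    show "decseq Bad" unfolding decseq_def Bad_def by (auto intro: order_trans)
  qed
  moreover have "prob (\<Inter>K. Bad K) = 0"
  proof -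
    have "AE \<omega> in ?M. \<omega> \<notin> (\<Inter>K. Bad K)"
      using AE_two_sided[OF q]
    proof eventually_elim
      case (elim \<omega>)
      have adm: "admissible (mallowsZ \<omega>)" unfolding mallowsZ_def using two_sided_admissible elim by blast
      obtain K1 where K1: "\<And>a b. K1 \<le> a \<Longrightarrow> K1 \<le> b \<Longrightarrow> L a b \<omega> = \<Phi> \<omega>"
        using window_ratio[OF adm, of r H] unfolding L_def \<Phi>_def window_def by blast
      obtain K2 where K2: "\<And>a b. K2 \<le> a \<Longrightarrow> K2 \<le> b \<Longrightarrow> fits a b (snd (snd \<omega>))" using fits_eventually elim by blast
      have "\<omega> \<notin> Bad (max K1 K2)" unfolding Bad_def using K1 K2 by auto
      then show ?case by blast
    qed
    then show ?thesis using Bad by (subst prob_eq_0) auto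
  qed
  ultimately have "eventually (\<lambda>K. prob (Bad K) < e / 2) sequentially"
    using e by (intro order_tendstoD(2)[of _ 0]) auto
  then obtain K where K: "prob (Bad K) < e / 2" unfolding eventually_sequentially by blast
  show ?thesis
  proof (intro exI allI impI)
    fix a b assume ab: "K \<le> a" "K \<le> b"
    let ?f = "\<lambda>\<omega>. fits a b (snd (snd \<omega>))"
    let ?P = "measure ?M {\<omega>. ?f \<omega>}" and ?m = "level_mean q r H a b"
    define G where "G \<omega> = (if ?f \<omega> then L a b \<omega> else 0)" for \<omega>
    have G [measurable]: "G \<in> borel_measurable ?M" unfolding G_def[abs_def] by measurable
    have Gb: "0 \<le> G \<omega>" "G \<omega> \<le> 1" for \<omega> unfolding G_def using Lb by auto
    have indB: "integrable ?M (indicator (Bad K) :: _ \<Rightarrow> real)" using Bad by (simp add: integrable_real_indicator emeasure_eq_measure)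
    have intG: "integrable ?M G" by (rule integrable_const_bound[of _ 1]) (auto simp: Gb)
    have int\<Phi>: "integrable ?M \<Phi>" by (rule integrable_const_bound[of _ 1]) (auto simp: \<Phi>b)
    have Gm: "expectation G = ?P * ?m"
    proof -
      have "expectation G = (\<integral>\<omega>. (if ?f \<omega> then level_ratio r H b (pattern (window a b \<omega>)) else 0) \<partial>?M)"
      proof (rule integral_cong_AE)
        show "AE \<omega> in ?M. G \<omega> = (if ?f \<omega> then level_ratio r H b (pattern (window a b \<omega>)) else 0)"
          using AE_two_sided[OF q]
        proof eventually_elim
          case (elim \<omega>)
          show ?case
          proof (cases "?f \<omega>")
            case True
            have v: "valid_field (fst \<omega>)" "valid_field (fst (snd \<omega>))" using elim by auto
            note w = window_split[OF True v, folded mallowsZ_def, folded window_def]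
            \<comment> \<open>The window has exactly \<open>b\<close> nonpositive entries, so level
              0 of the window is level \<open>b\<close> of its pattern.\<close>
            have "length (filter (\<lambda>x. x \<le> 0) (window a b \<omega>)) = b" unfolding w(3) by simp
            then show ?thesis using level_ratio_pattern[OF w(4), of r H 0] True unfolding G_def L_def by simp
          qed (simp add: G_def)
        qed
        have "(\<lambda>\<omega>. level_ratio r H b (pattern (window a b \<omega>))) \<in> borel_measurable ?M"
          by (rule measurable_compose[OF measurable_window]) simp
        then show "(\<lambda>\<omega>. if ?f \<omega> then level_ratio r H b (pattern (window a b \<omega>)) else 0) \<in> borel_measurable ?M" by measurable
      qed measurable
      also have "\<dots> = ?P * ?m" unfolding level_mean_def by (rule window_law[OF q])
      finally show ?thesis .
    qed
    have good: "\<omega> \<notin> Bad K \<Longrightarrow> ?f \<omega> \<and> L a b \<omega> = \<Phi> \<omega>" for \<omega>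
      unfolding Bad_def using ab by auto
    have 1: "\<bar>expectation G - redwood_prob q r H\<bar> \<le> prob (Bad K)"
    proof -
      have "expectation G - redwood_prob q r H = expectation (\<lambda>\<omega>. G \<omega> - \<Phi> \<omega>)"
        unfolding redwood_prob_eq \<Phi>_def[symmetric] using intG int\<Phi> by (simp add: Bochner_Integration.integral_diff)
      also have "\<bar>\<dots>\<bar> \<le> expectation (\<lambda>\<omega>. \<bar>G \<omega> - \<Phi> \<omega>\<bar>)" by (rule integral_abs_bound)
      also have "\<dots> \<le> expectation (indicator (Bad K))"
      proof (rule integral_mono)
        show "integrable ?M (\<lambda>\<omega>. \<bar>G \<omega> - \<Phi> \<omega>\<bar>)" using intG int\<Phi> by auto
        show "\<bar>G \<omega> - \<Phi> \<omega>\<bar> \<le> indicator (Bad K) \<omega>" for \<omega>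
        proof (cases "\<omega> \<in> Bad K")
          case True
          then show ?thesis using Gb[of \<omega>] \<Phi>b[of \<omega>] by simp
        next
          case False
          then show ?thesis using good[OF False] by (simp add: G_def)
        qed
      qed (rule indB)
      finally show ?thesis by simp
    qed
    have 2: "1 - ?P \<le> prob (Bad K)"
    proof -
      have F: "{\<omega>. ?f \<omega>} \<in> sets ?M"
      proof -
        have "{\<omega> \<in> space ?M. ?f \<omega>} \<in> sets ?M" by measurable
        then show ?thesis by simp
      qed
      have "1 - ?P = prob (space ?M - {\<omega>. ?f \<omega>})" by (rule prob_compl[OF F, symmetric])
      also have "\<dots> \<le> prob (Bad K)" by (rule finite_measure_mono[OF _ Bad]) (use good in auto)
      finally show ?thesis .
    qed
    have P1: "?P \<le> 1" by (rule prob_le_1)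
    have "\<bar>?m - expectation G\<bar> = (1 - ?P) * ?m"
      unfolding Gm using P1 level_mean_bounds[of q r H a b] by (simp add: algebra_simps abs_of_nonneg mult_left_le)
    also have "\<dots> \<le> (1 - ?P) * 1" using P1 level_mean_bounds[of q r H a b] by (intro mult_left_mono) auto
    finally have 3: "\<bar>?m - expectation G\<bar> \<le> prob (Bad K)" using 2 by simp
    have "\<bar>?m - redwood_prob q r H\<bar> \<le> \<bar>?m - expectation G\<bar> + \<bar>expectation G - redwood_prob q r H\<bar>"
      using abs_triangle_ineq[of "?m - expectation G" "expectation G - redwood_prob q r H"] by simp
    also have "\<dots> \<le> prob (Bad K) + prob (Bad K)" by (rule add_mono[OF 3 1])
    also have "\<dots> \<le> e" using K by simp
    finally show "\<bar>?m - redwood_prob q r H\<bar> \<le> e" .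
  qed
qed

text \<open>All but at most \<open>2 * K\<close> levels have both \<open>b\<close> and
  \<open>n - b\<close> at least \<open>K\<close>, where the mean is within \<open>e / 2\<close> of
  the limit. Each exceptional level contributes an extra 1 at most, which division by
  \<open>n\<close> makes negligible.\<close>

lemma count_mean_tendsto:
  assumes q: "0 \<le> q" "q < 1"
  shows "(\<lambda>n. count_mean q r H n / real n) \<longlonglongrightarrow> redwood_prob q r H"
proof (rule LIMSEQ_I)
  fix e :: real assume e: "0 < e"
  define R where "R = redwood_prob q r H"
  have R: "0 \<le> R" "R \<le> 1"
  proof -
    interpret prob_space "two_sided_field q" by (rule prob_space_two_sided)
    have m: "(\<lambda>\<omega>. redwood_ratio r H (redwood (mallowsZ \<omega>))) \<in> borel_measurable (two_sided_field q)"
      by (rule measurable_redwood_ratio[OF pred_in_redwood[OF measurable_mallowsZ]])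
    have int: "integrable (two_sided_field q) (\<lambda>\<omega>. redwood_ratio r H (redwood (mallowsZ \<omega>)))"
      by (rule integrable_const_bound[of _ 1]) (auto simp: redwood_ratio_bounds m)
    show "0 \<le> R" unfolding R_def redwood_prob_eq by (rule integral_nonneg_AE) (simp add: redwood_ratio_bounds)
    show "R \<le> 1" unfolding R_def redwood_prob_eq by (rule integral_le_const[OF int]) (simp add: redwood_ratio_bounds)
  qed
  obtain K where K: "\<And>a b. K \<le> a \<Longrightarrow> K \<le> b \<Longrightarrow> \<bar>level_mean q r H a b - R\<bar> \<le> e / 2"
    using level_mean_approx[OF q, of "e / 2" r H] e unfolding R_def by auto
  obtain N0 where N0: "4 * real K / e < real N0" using reals_Archimedean2 by blast
  show "\<exists>N. \<forall>n\<ge>N. norm (count_mean q r H n / real n - redwood_prob q r H) < e"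
  proof (intro exI allI impI)
    fix n assume n: "Suc N0 \<le> n"
    have npos: "0 < real n" using n by simp
    have "count_mean q r H n - real n * R = (\<Sum>b<n. level_mean q r H (n - b) b - R)"
      unfolding count_mean_eq_sum by (simp add: sum_subtractf)
    also have "\<bar>\<dots>\<bar> \<le> (\<Sum>b<n. \<bar>level_mean q r H (n - b) b - R\<bar>)" by (rule sum_abs)
    also have "\<dots> \<le> (\<Sum>b<n. e / 2 + (if b < K \<or> n - b < K then 1 else 0))"
    proof (rule sum_mono)
      fix b assume "b \<in> {..<n}"
      show "\<bar>level_mean q r H (n - b) b - R\<bar> \<le> e / 2 + (if b < K \<or> n - b < K then 1 else 0)"
      proof (cases "b < K \<or> n - b < K")
        case True
        have "\<bar>level_mean q r H (n - b) b - R\<bar> \<le> 1" using level_mean_bounds[of q r H "n - b" b] R by auto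
        then show ?thesis using True e by auto
      next
        case False
        then show ?thesis using K[of "n - b" b] by simp
      qed
    qed
    also have "\<dots> = real n * (e / 2) + real (card {b \<in> {..<n}. b < K \<or> n - b < K})"
    proof -
      have "(\<Sum>b<n. if b < K \<or> n - b < K then 1 else 0 :: real) = (\<Sum>b\<in>{b \<in> {..<n}. b < K \<or> n - b < K}. 1)"
        by (rule sum.inter_filter[symmetric]) simp
      then show ?thesis by (simp only: sum.distrib) simp
    qed
    also have "real (card {b \<in> {..<n}. b < K \<or> n - b < K}) \<le> real (2 * K)"
    proof -
      have "{b \<in> {..<n}. b < K \<or> n - b < K} \<subseteq> {..<K} \<union> {n - K..<n}" by auto
      then have "card {b \<in> {..<n}. b < K \<or> n - b < K} \<le> card ({..<K} \<union> {n - K..<n})" by (intro card_mono) auto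
      also have "\<dots> \<le> card {..<K} + card {n - K..<n}" by (rule card_Un_le)
      finally show ?thesis by simp
    qed
    finally have main: "\<bar>count_mean q r H n - real n * R\<bar> \<le> real n * (e / 2) + real (2 * K)" by simp
    have "4 * real K / e < real n" using N0 n by (simp add: Suc_le_eq order_less_trans)
    then have "real (2 * K) < real n * (e / 2)" using e by (simp add: field_simps)
    then have "\<bar>count_mean q r H n - real n * R\<bar> < real n * e" using main by simp
    then have "\<bar>count_mean q r H n - real n * R\<bar> / real n < e" using npos by (simp add: pos_divide_less_eq mult.commute)
    moreover have "count_mean q r H n / real n - R = (count_mean q r H n - real n * R) / real n"
      using npos by (simp add: field_simps)
    ultimately show "norm (count_mean q r H n / real n - redwood_prob q r H) < e"
      unfolding R_def[symmetric] by (simp add: abs_divide)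
  qed
qed

lemma local_freq_eq: "local_freq B n r H = bst_count r H (Ilist B n) / real n"
  unfolding local_freq_def BST_Pi_def Pi_list_pattern bst_pattern Let_def bst_count_def iso_count_def ..

theorem theorem1p1:
  fixes q :: real and r :: nat
    and V :: "'h set" and E :: "('h \<times> 'h) set" and root :: 'h
  assumes "0 \<le> q" and "q < 1"
    and "1 \<le> r"
    and "finite V" and "root \<in> V" and "E \<subseteq> V \<times> V" and "sym E" and "irrefl E"
  shows "AE B in bern_field q.
           (\<lambda>n. local_freq B n r (V, E, root)) \<longlonglongrightarrow> redwood_prob q r (V, E, root)"
  using AE_bst_count_centered[OF assms(1,2), of r "(V, E, root)"]
proof eventually_elim
  case (elim B)
  have "(\<lambda>n. (bst_count r (V, E, root) (Ilist B n) - count_mean q r (V, E, root) n) / real n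
      + count_mean q r (V, E, root) n / real n) \<longlonglongrightarrow> 0 + redwood_prob q r (V, E, root)"
    by (rule tendsto_add[OF elim count_mean_tendsto[OF assms(1,2)]])
  then show ?case unfolding local_freq_eq by (simp add: diff_divide_distrib)
qed

end
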